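(* The category $\mathsf{Graph}$ admits an enrichment over $\mathsf{Gpd}$ whose hom-groupoid from $X$ to $Y$ is $\Pi_1([X,Y])$. With this enrichment, $\Pi_1\colon\mathsf{Graph}\to\mathsf{Gpd}$ is a $\mathsf{Gpd}$-enriched functor.
   Context: Graphs are simple undirected loopless graphs; graph maps send adjacent vertices to equal or adjacent vertices; $\mathsf{Gpd}$ is the cartesian closed category of small groupoids (enriched over itself via functor groupoids). $I_n$ has vertices $0,\dots,n$, edges $i\sim i+1$. The box product $X\square Y$ has vertices $V(X)\times V(Y)$ and $(x,y)\sim(x',y')$ iff ($x\sim x'$, $y=y'$) or ($x=x'$, $y\sim y'$). The internal hom $[X,Y]$ has vertices the graph maps $X\to Y$, with $f\sim g$ iff $f\ne g$ and for all $x$, $f(x)=g(x)$ or $f(x)\sim g(x)$; $(\mathsf{Graph},\square,I_0,[-,-])$ is closed symmetric monoidal, hence enriched over itself with composition maps $[Y,Z]\square[X,Y]\to[X,Z]$. Paths of length $n$ are graph maps $I_n\to X$; $P_{\mathbb{N}}X(x,x')$ is the quotient of $\coprod_n P_nX(x,x')$ (where $P_nX(x,x')$ has paths of length $n$ from $x$ to $x'$ as vertices, adjacent iff distinct and pointwise equal-or-adjacent) by the equivalence generated by reparametrization $\gamma\sim\gamma\circ s$ along surjective order-preserving graph maps $s\colon I_m\to I_n$. The fundamental groupoid $\Pi_1X$ has objects vertices and morphisms $\pi_0P_{\mathbb{N}}X(x,x')$ (path-components), composition by concatenation of paths. $\Pi_1$ is a strict monoidal functor $(\mathsf{Graph},\square)\to(\mathsf{Gpd},\times)$,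 and the enrichment in question is the one obtained from the self-enrichment of $\mathsf{Graph}$ by change of base along $\Pi_1$: composition is $\Pi_1[Y,Z]\times\Pi_1[X,Y]\cong\Pi_1([Y,Z]\square[X,Y])\to\Pi_1[X,Z]$. *)

theory Defs
  imports "HOL-Library.FuncSet"
begin

section \<open>Graphs and graph maps\<close>

record 'v graph =
  verts :: "'v set"
  adj :: "'v \<Rightarrow> 'v \<Rightarrow> bool"

definition is_graph :: "'v graph \<Rightarrow> bool" where
  "is_graph X \<longleftrightarrow>
     (\<forall>x y. adj X x y \<longrightarrow> x \<in> verts X \<and> y \<in> verts X) \<and> symp (adj X) \<and> irreflp (adj X)"

definition adj_eq :: "'v graph \<Rightarrow> 'v \<Rightarrow> 'v \<Rightarrow> bool" where
  "adj_eq X x y \<longleftrightarrow> x = y \<or> adj X x y"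

text \<open>Maps are taken extensional on the vertex set, so that equality in HOL is equality of maps;
  the same convention is used for functors and natural transformations below.\<close>

definition graph_maps :: "'v graph \<Rightarrow> 'w graph \<Rightarrow> ('v \<Rightarrow> 'w) set" where
  "graph_maps X Y =
     {f \<in> verts X \<rightarrow>\<^sub>E verts Y. \<forall>x y. adj X x y \<longrightarrow> adj_eq Y (f x) (f y)}"

definition path_graph :: "nat \<Rightarrow> nat graph" where
  "path_graph n =
     \<lparr>verts = {0..n}, adj = (\<lambda>i j. i \<le> n \<and> j \<le> n \<and> (j = Suc i \<or> i = Suc j))\<rparr>"

definition box :: "'v graph \<Rightarrow> 'w graph \<Rightarrow> ('v \<times> 'w) graph" where
  "box X Y =
     \<lparr>verts = verts X \<times> verts Y,
      adj = (\<lambda>(x, y) (x', y').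
        (adj X x x' \<and> y = y' \<and> y \<in> verts Y) \<or> (x = x' \<and> x \<in> verts X \<and> adj Y y y'))\<rparr>"

definition ihom :: "'v graph \<Rightarrow> 'w graph \<Rightarrow> ('v \<Rightarrow> 'w) graph" where
  "ihom X Y =
     \<lparr>verts = graph_maps X Y,
      adj = (\<lambda>f g. f \<in> graph_maps X Y \<and> g \<in> graph_maps X Y \<and> f \<noteq> g \<and>
                   (\<forall>x\<in>verts X. adj_eq Y (f x) (g x)))\<rparr>"

definition graph_id :: "'v graph \<Rightarrow> 'v \<Rightarrow> 'v" where
  "graph_id X = (\<lambda>x\<in>verts X. x)"

definition hom_comp ::
  "'u graph \<Rightarrow> 'v graph \<Rightarrow> 'w graph \<Rightarrow> ('v \<Rightarrow> 'w) \<times> ('u \<Rightarrow> 'v) \<Rightarrow> 'u \<Rightarrow> 'w" where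
  "hom_comp X Y Z =
     (\<lambda>(g, f) \<in> verts (box (ihom Y Z) (ihom X Y)). compose (verts X) g f)"

definition hom_unit :: "'v graph \<Rightarrow> nat \<Rightarrow> 'v \<Rightarrow> 'v" where
  "hom_unit X = (\<lambda>i\<in>verts (path_graph 0). graph_id X)"

definition hom_eval :: "'v graph \<Rightarrow> 'w graph \<Rightarrow> ('v \<Rightarrow> 'w) \<times> 'v \<Rightarrow> 'w" where
  "hom_eval X Y = (\<lambda>(f, x) \<in> verts (box (ihom X Y) X). f x)"

definition coprod_graph :: "(nat \<Rightarrow> 'v graph) \<Rightarrow> (nat \<times> 'v) graph" where
  "coprod_graph G =
     \<lparr>verts = (SIGMA n:UNIV. verts (G n)),
      adj = (\<lambda>(m, a) (n, b). m = n \<and> adj (G m) a b)\<rparr>"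

definition quotient_graph :: "'v graph \<Rightarrow> ('v \<times> 'v) set \<Rightarrow> 'v set graph" where
  "quotient_graph G R =
     \<lparr>verts = verts G // R,
      adj = (\<lambda>A B. A \<in> verts G // R \<and> B \<in> verts G // R \<and> A \<noteq> B \<and>
                   (\<exists>a\<in>A. \<exists>b\<in>B. adj G a b))\<rparr>"

definition conn_rel :: "'v graph \<Rightarrow> ('v \<times> 'v) set" where
  "conn_rel G = {(a, b). \<exists>n. \<exists>\<gamma>\<in>graph_maps (path_graph n) G. \<gamma> 0 = a \<and> \<gamma> n = b}"

definition pi0 :: "'v graph \<Rightarrow> 'v set set" where
  "pi0 G = verts G // conn_rel G"


section \<open>Path graphs up to reparametrization\<close>

text \<open>A path is a pair of its length \<open>n\<close> and a graph map out of \<open>path_graph n\<close>.\<close>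

type_synonym 'v path = "nat \<times> (nat \<Rightarrow> 'v)"

definition path_space :: "'v graph \<Rightarrow> 'v \<Rightarrow> 'v \<Rightarrow> nat \<Rightarrow> (nat \<Rightarrow> 'v) graph" where
  "path_space X x x' n =
     (let P = {\<gamma> \<in> graph_maps (path_graph n) X. \<gamma> 0 = x \<and> \<gamma> n = x'}
      in \<lparr>verts = P,
          adj = (\<lambda>\<gamma> \<delta>. \<gamma> \<in> P \<and> \<delta> \<in> P \<and> \<gamma> \<noteq> \<delta> \<and> (\<forall>i\<in>{0..n}. adj_eq X (\<gamma> i) (\<delta> i)))\<rparr>)"

definition all_paths :: "'v graph \<Rightarrow> 'v \<Rightarrow> 'v \<Rightarrow> 'v path graph" where
  "all_paths X x x' = coprod_graph (path_space X x x')"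

definition reparam :: "'v path \<Rightarrow> 'v path \<Rightarrow> bool" where
  "reparam p q \<longleftrightarrow>
     (\<exists>s\<in>graph_maps (path_graph (fst q)) (path_graph (fst p)).
        mono_on {0..fst q} s \<and> s ` {0..fst q} = {0..fst p} \<and>
        snd q = compose {0..fst q} (snd p) s)"

definition reparam_equiv :: "'v graph \<Rightarrow> 'v \<Rightarrow> 'v \<Rightarrow> ('v path \<times> 'v path) set" where
  "reparam_equiv X x x' =
     (let V = verts (all_paths X x x')
      in {(p, q) \<in> V \<times> V. equivclp (\<lambda>p q. p \<in> V \<and> q \<in> V \<and> reparam p q) p q})"

definition PN :: "'v graph \<Rightarrow> 'v \<Rightarrow> 'v \<Rightarrow> 'v path set graph" where
  "PN X x x' = quotient_graph (all_paths X x x') (reparam_equiv X x x')"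

definition path_class :: "'v graph \<Rightarrow> 'v path \<Rightarrow> 'v path set set" where
  "path_class X p =
     (let x = snd p 0; x' = snd p (fst p)
      in conn_rel (PN X x x') `` {reparam_equiv X x x' `` {p}})"

definition path_const :: "'v \<Rightarrow> 'v path" where
  "path_const x = (0, \<lambda>i\<in>{0..0}. x)"

definition path_concat :: "'v path \<Rightarrow> 'v path \<Rightarrow> 'v path" where
  "path_concat p q =
     (fst p + fst q,
      \<lambda>i\<in>{0..fst p + fst q}. if i \<le> fst p then snd p i else snd q (i - fst p))"

definition path_map :: "('v \<Rightarrow> 'w) \<Rightarrow> 'v path \<Rightarrow> 'w path" where
  "path_map f p = (fst p, compose {0..fst p} f (snd p))"


section \<open>Groupoids\<close>

text \<open>All structure maps are \<open>undefined\<close> off their proper domains, so that equality of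
  records is equality of groupoids.\<close>

record ('o, 'm) gpd =
  gobj :: "'o set"
  garr :: "'m set"
  gdom :: "'m \<Rightarrow> 'o"
  gcod :: "'m \<Rightarrow> 'o"
  gid :: "'o \<Rightarrow> 'm"
  gcomp :: "'m \<Rightarrow> 'm \<Rightarrow> 'm"

definition composable :: "('o, 'm) gpd \<Rightarrow> 'm \<Rightarrow> 'm \<Rightarrow> bool" where
  "composable G g f \<longleftrightarrow> g \<in> garr G \<and> f \<in> garr G \<and> gdom G g = gcod G f"

definition groupoid :: "('o, 'm) gpd \<Rightarrow> bool" where
  "groupoid G \<longleftrightarrow>
     gdom G \<in> garr G \<rightarrow>\<^sub>E gobj G \<and>
     gcod G \<in> garr G \<rightarrow>\<^sub>E gobj G \<and>
     gid G \<in> gobj G \<rightarrow>\<^sub>E garr G \<and>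
     (\<forall>x\<in>gobj G. gdom G (gid G x) = x \<and> gcod G (gid G x) = x) \<and>
     (\<forall>g f. composable G g f \<longrightarrow>
        gcomp G g f \<in> garr G \<and> gdom G (gcomp G g f) = gdom G f \<and>
        gcod G (gcomp G g f) = gcod G g) \<and>
     (\<forall>g f. \<not> composable G g f \<longrightarrow> gcomp G g f = undefined) \<and>
     (\<forall>f\<in>garr G. gcomp G f (gid G (gdom G f)) = f \<and> gcomp G (gid G (gcod G f)) f = f) \<and>
     (\<forall>h g f. composable G h g \<and> composable G g f \<longrightarrow>
        gcomp G h (gcomp G g f) = gcomp G (gcomp G h g) f) \<and>
     (\<forall>f\<in>garr G. \<exists>g\<in>garr G.
        gdom G g = gcod G f \<and> gcod G g = gdom G f \<and>
        gcomp G g f = gid G (gdom G f) \<and> gcomp G f g = gid G (gcod G f))"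

record ('o, 'm, 'p, 'q) gfun =
  fob :: "'o \<Rightarrow> 'p"
  far :: "'m \<Rightarrow> 'q"

definition is_functor :: "('o, 'm) gpd \<Rightarrow> ('p, 'q) gpd \<Rightarrow> ('o, 'm, 'p, 'q) gfun \<Rightarrow> bool" where
  "is_functor G H F \<longleftrightarrow>
     fob F \<in> gobj G \<rightarrow>\<^sub>E gobj H \<and>
     far F \<in> garr G \<rightarrow>\<^sub>E garr H \<and>
     (\<forall>f\<in>garr G. gdom H (far F f) = fob F (gdom G f) \<and> gcod H (far F f) = fob F (gcod G f)) \<and>
     (\<forall>x\<in>gobj G. far F (gid G x) = gid H (fob F x)) \<and>
     (\<forall>g f. composable G g f \<longrightarrow> far F (gcomp G g f) = gcomp H (far F g) (far F f))"

definition id_functor :: "('o, 'm) gpd \<Rightarrow> ('o, 'm, 'o, 'm) gfun" where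
  "id_functor G = \<lparr>fob = (\<lambda>x\<in>gobj G. x), far = (\<lambda>f\<in>garr G. f)\<rparr>"

text \<open>The first argument of \<open>fcomp\<close> is the source of the composite \<open>T \<circ> S\<close>.\<close>

definition fcomp ::
  "('o, 'm) gpd \<Rightarrow> ('p, 'q, 'r, 's) gfun \<Rightarrow> ('o, 'm, 'p, 'q) gfun \<Rightarrow> ('o, 'm, 'r, 's) gfun" where
  "fcomp G T S =
     \<lparr>fob = compose (gobj G) (fob T) (fob S), far = compose (garr G) (far T) (far S)\<rparr>"

definition unit_gpd :: "(unit, unit) gpd" where
  "unit_gpd =
     \<lparr>gobj = {()}, garr = {()}, gdom = (\<lambda>_. ()), gcod = (\<lambda>_. ()), gid = (\<lambda>_. ()),
      gcomp = (\<lambda>_ _. ())\<rparr>"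

definition prod_gpd :: "('o, 'm) gpd \<Rightarrow> ('p, 'q) gpd \<Rightarrow> ('o \<times> 'p, 'm \<times> 'q) gpd" where
  "prod_gpd G H =
     \<lparr>gobj = gobj G \<times> gobj H,
      garr = garr G \<times> garr H,
      gdom = (\<lambda>(a, b) \<in> garr G \<times> garr H. (gdom G a, gdom H b)),
      gcod = (\<lambda>(a, b) \<in> garr G \<times> garr H. (gcod G a, gcod H b)),
      gid = (\<lambda>(x, y) \<in> gobj G \<times> gobj H. (gid G x, gid H y)),
      gcomp = (\<lambda>(a, b) (a', b').
        if composable G a a' \<and> composable H b b' then (gcomp G a a', gcomp H b b')
        else undefined)\<rparr>"

definition prod_functor ::
  "('o, 'm) gpd \<Rightarrow> ('p, 'q) gpd \<Rightarrow> ('o, 'm, 'o1, 'm1) gfun \<Rightarrow> ('p, 'q, 'p1, 'q1) gfun \<Rightarrow>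
   ('o \<times> 'p, 'm \<times> 'q, 'o1 \<times> 'p1, 'm1 \<times> 'q1) gfun" where
  "prod_functor G H S T =
     \<lparr>fob = (\<lambda>(x, y) \<in> gobj G \<times> gobj H. (fob S x, fob T y)),
      far = (\<lambda>(a, b) \<in> garr G \<times> garr H. (far S a, far T b))\<rparr>"

definition assoc_functor ::
  "('o, 'm) gpd \<Rightarrow> ('p, 'q) gpd \<Rightarrow> ('r, 's) gpd \<Rightarrow>
   (('o \<times> 'p) \<times> 'r, ('m \<times> 'q) \<times> 's, 'o \<times> 'p \<times> 'r, 'm \<times> 'q \<times> 's) gfun" where
  "assoc_functor G H K =
     \<lparr>fob = (\<lambda>((x, y), z) \<in> (gobj G \<times> gobj H) \<times> gobj K. (x, y, z)),
      far = (\<lambda>((a, b), c) \<in> (garr G \<times> garr H) \<times> garr K. (a, b, c))\<rparr>"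

definition fst_functor ::
  "('o, 'm) gpd \<Rightarrow> ('p, 'q) gpd \<Rightarrow> ('o \<times> 'p, 'm \<times> 'q, 'o, 'm) gfun" where
  "fst_functor G H =
     \<lparr>fob = (\<lambda>z \<in> gobj G \<times> gobj H. fst z), far = (\<lambda>z \<in> garr G \<times> garr H. fst z)\<rparr>"

definition snd_functor ::
  "('o, 'm) gpd \<Rightarrow> ('p, 'q) gpd \<Rightarrow> ('o \<times> 'p, 'm \<times> 'q, 'p, 'q) gfun" where
  "snd_functor G H =
     \<lparr>fob = (\<lambda>z \<in> gobj G \<times> gobj H. snd z), far = (\<lambda>z \<in> garr G \<times> garr H. snd z)\<rparr>"

text \<open>Arrows of functor groupoids are triples consisting of the source, the target and the
  family of components of a natural transformation.\<close>

type_synonym ('o, 'm, 'p, 'q) ntrans =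
  "('o, 'm, 'p, 'q) gfun \<times> ('o, 'm, 'p, 'q) gfun \<times> ('o \<Rightarrow> 'q)"

definition nat_transs :: "('o, 'm) gpd \<Rightarrow> ('p, 'q) gpd \<Rightarrow> ('o, 'm, 'p, 'q) ntrans set" where
  "nat_transs G H =
     {(S, T, \<tau>). is_functor G H S \<and> is_functor G H T \<and> \<tau> \<in> gobj G \<rightarrow>\<^sub>E garr H \<and>
        (\<forall>x\<in>gobj G. gdom H (\<tau> x) = fob S x \<and> gcod H (\<tau> x) = fob T x) \<and>
        (\<forall>f\<in>garr G. gcomp H (\<tau> (gcod G f)) (far S f) = gcomp H (far T f) (\<tau> (gdom G f)))}"

definition fun_gpd ::
  "('o, 'm) gpd \<Rightarrow> ('p, 'q) gpd \<Rightarrow> (('o, 'm, 'p, 'q) gfun, ('o, 'm, 'p, 'q) ntrans) gpd" where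
  "fun_gpd G H =
     \<lparr>gobj = {S. is_functor G H S},
      garr = nat_transs G H,
      gdom = (\<lambda>(S, T, \<tau>) \<in> nat_transs G H. S),
      gcod = (\<lambda>(S, T, \<tau>) \<in> nat_transs G H. T),
      gid = (\<lambda>S \<in> {S. is_functor G H S}. (S, S, \<lambda>x\<in>gobj G. gid H (fob S x))),
      gcomp = (\<lambda>(S', T', \<sigma>) (S, T, \<tau>).
        if (S', T', \<sigma>) \<in> nat_transs G H \<and> (S, T, \<tau>) \<in> nat_transs G H \<and> S' = T
        then (S, T', \<lambda>x\<in>gobj G. gcomp H (\<sigma> x) (\<tau> x)) else undefined)\<rparr>"

definition curry_functor ::
  "('o, 'm) gpd \<Rightarrow> ('p, 'q) gpd \<Rightarrow> ('o \<times> 'p, 'm \<times> 'q, 'r, 's) gfun \<Rightarrow>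
   ('o, 'm, ('p, 'q, 'r, 's) gfun, ('p, 'q, 'r, 's) ntrans) gfun" where
  "curry_functor G H T =
     (let T\<^sub>1 = (\<lambda>x. \<lparr>fob = (\<lambda>y\<in>gobj H. fob T (x, y)), far = (\<lambda>b\<in>garr H. far T (gid G x, b))\<rparr>)
      in \<lparr>fob = (\<lambda>x\<in>gobj G. T\<^sub>1 x),
          far = (\<lambda>a\<in>garr G. (T\<^sub>1 (gdom G a), T\<^sub>1 (gcod G a), \<lambda>y\<in>gobj H. far T (a, gid H y)))\<rparr>)"


section \<open>Categories and functors enriched over groupoids\<close>

record ('o, 'm) cat =
  cob :: "'o set"
  chom :: "'o \<Rightarrow> 'o \<Rightarrow> 'm set"
  ccomp :: "'o \<Rightarrow> 'o \<Rightarrow> 'o \<Rightarrow> 'm \<Rightarrow> 'm \<Rightarrow> 'm"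
  cid :: "'o \<Rightarrow> 'm"

definition is_category :: "('o, 'm) cat \<Rightarrow> bool" where
  "is_category K \<longleftrightarrow>
     (\<forall>X\<in>cob K. cid K X \<in> chom K X X) \<and>
     (\<forall>X\<in>cob K. \<forall>Y\<in>cob K. \<forall>Z\<in>cob K. \<forall>g\<in>chom K Y Z. \<forall>f\<in>chom K X Y.
        ccomp K X Y Z g f \<in> chom K X Z) \<and>
     (\<forall>X\<in>cob K. \<forall>Y\<in>cob K. \<forall>f\<in>chom K X Y.
        ccomp K X X Y f (cid K X) = f \<and> ccomp K X Y Y (cid K Y) f = f) \<and>
     (\<forall>W\<in>cob K. \<forall>X\<in>cob K. \<forall>Y\<in>cob K. \<forall>Z\<in>cob K.
        \<forall>h\<in>chom K Y Z. \<forall>g\<in>chom K X Y. \<forall>f\<in>chom K W X.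
        ccomp K W X Z (ccomp K X Y Z h g) f = ccomp K W Y Z h (ccomp K W X Y g f))"

record ('o, 'p, 'q) enr_cat =
  eob :: "'o set"
  ehom :: "'o \<Rightarrow> 'o \<Rightarrow> ('p, 'q) gpd"
  ecomp :: "'o \<Rightarrow> 'o \<Rightarrow> 'o \<Rightarrow> ('p \<times> 'p, 'q \<times> 'q, 'p, 'q) gfun"
  eunit :: "'o \<Rightarrow> (unit, unit, 'p, 'q) gfun"

definition gpd_enriched_category :: "('o, 'p, 'q) enr_cat \<Rightarrow> bool" where
  "gpd_enriched_category C \<longleftrightarrow>
     (\<forall>X\<in>eob C. \<forall>Y\<in>eob C. groupoid (ehom C X Y)) \<and>
     (\<forall>X\<in>eob C. \<forall>Y\<in>eob C. \<forall>Z\<in>eob C.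
        is_functor (prod_gpd (ehom C Y Z) (ehom C X Y)) (ehom C X Z) (ecomp C X Y Z)) \<and>
     (\<forall>X\<in>eob C. is_functor unit_gpd (ehom C X X) (eunit C X)) \<and>
     (\<forall>W\<in>eob C. \<forall>X\<in>eob C. \<forall>Y\<in>eob C. \<forall>Z\<in>eob C.
        let A = ehom C Y Z; B = ehom C X Y; D = ehom C W X; P = prod_gpd (prod_gpd A B) D in
        fcomp P (ecomp C W X Z) (prod_functor (prod_gpd A B) D (ecomp C X Y Z) (id_functor D)) =
        fcomp P (ecomp C W Y Z)
          (fcomp P (prod_functor A (prod_gpd B D) (id_functor A) (ecomp C W X Y))
             (assoc_functor A B D))) \<and>
     (\<forall>X\<in>eob C. \<forall>Y\<in>eob C.
        let A = ehom C X Y in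
        fcomp (prod_gpd unit_gpd A) (ecomp C X Y Y)
          (prod_functor unit_gpd A (eunit C Y) (id_functor A)) = snd_functor unit_gpd A \<and>
        fcomp (prod_gpd A unit_gpd) (ecomp C X X Y)
          (prod_functor A unit_gpd (id_functor A) (eunit C X)) = fst_functor A unit_gpd)"

text \<open>An enrichment of an ordinary category \<open>K\<close> is an enriched category with underlying
  category \<open>K\<close>; a functor from the terminal groupoid to a hom-groupoid is identified with
  an object of the latter.\<close>

definition is_enrichment_of :: "('o, 'p, 'q) enr_cat \<Rightarrow> ('o, 'p) cat \<Rightarrow> bool" where
  "is_enrichment_of C K \<longleftrightarrow>
     is_category K \<and> gpd_enriched_category C \<and> eob C = cob K \<and>
     (\<forall>X\<in>cob K. \<forall>Y\<in>cob K. gobj (ehom C X Y) = chom K X Y) \<and>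
     (\<forall>X\<in>cob K. \<forall>Y\<in>cob K. \<forall>Z\<in>cob K. \<forall>g\<in>chom K Y Z. \<forall>f\<in>chom K X Y.
        fob (ecomp C X Y Z) (g, f) = ccomp K X Y Z g f) \<and>
     (\<forall>X\<in>cob K. fob (eunit C X) () = cid K X)"

record ('o, 'p, 'q, 'o1, 'p1, 'q1) enr_fun =
  efob :: "'o \<Rightarrow> 'o1"
  efhom :: "'o \<Rightarrow> 'o \<Rightarrow> ('p, 'q, 'p1, 'q1) gfun"

definition gpd_enriched_functor ::
  "('o, 'p, 'q) enr_cat \<Rightarrow> ('o1, 'p1, 'q1) enr_cat \<Rightarrow> ('o, 'p, 'q, 'o1, 'p1, 'q1) enr_fun \<Rightarrow> bool"
  where
  "gpd_enriched_functor C D T \<longleftrightarrow>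
     gpd_enriched_category C \<and> gpd_enriched_category D \<and>
     (\<forall>X\<in>eob C. efob T X \<in> eob D) \<and>
     (\<forall>X\<in>eob C. \<forall>Y\<in>eob C.
        is_functor (ehom C X Y) (ehom D (efob T X) (efob T Y)) (efhom T X Y)) \<and>
     (\<forall>X\<in>eob C. \<forall>Y\<in>eob C. \<forall>Z\<in>eob C.
        let A = ehom C Y Z; B = ehom C X Y in
        fcomp (prod_gpd A B) (efhom T X Z) (ecomp C X Y Z) =
        fcomp (prod_gpd A B) (ecomp D (efob T X) (efob T Y) (efob T Z))
          (prod_functor A B (efhom T Y Z) (efhom T X Y))) \<and>
     (\<forall>X\<in>eob C. fcomp unit_gpd (efhom T X X) (eunit C X) = eunit D (efob T X))"

text \<open>The self-enrichment of the category of groupoids; on arrows, composition is the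
  horizontal composition of natural transformations.\<close>

definition Gpd_self ::
  "(('o, 'm) gpd, ('o, 'm, 'o, 'm) gfun, ('o, 'm, 'o, 'm) ntrans) enr_cat" where
  "Gpd_self =
     \<lparr>eob = {G. groupoid G},
      ehom = fun_gpd,
      ecomp = (\<lambda>G H K.
        \<lparr>fob = (\<lambda>(T, S) \<in> gobj (prod_gpd (fun_gpd H K) (fun_gpd G H)). fcomp G T S),
         far = (\<lambda>((T, T', \<beta>), (S, S', \<alpha>)) \<in> garr (prod_gpd (fun_gpd H K) (fun_gpd G H)).
           (fcomp G T S, fcomp G T' S',
            \<lambda>x\<in>gobj G. gcomp K (\<beta> (fob S' x)) (far T (\<alpha> x))))\<rparr>),
      eunit = (\<lambda>G.
        \<lparr>fob = (\<lambda>_. id_functor G), far = (\<lambda>_. gid (fun_gpd G G) (id_functor G))\<rparr>)\<rparr>"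


section \<open>The fundamental groupoid\<close>

text \<open>The arrows from \<open>x\<close> to \<open>x'\<close> are the path-components of \<open>PN X x x'\<close>, tagged with
  their endpoints. For such a component \<open>C\<close>, the elements of \<open>\<Union>C\<close> are the representing paths,
  and a union of classes over all representatives is the usual way to lift an operation that
  respects the equivalence.\<close>

type_synonym 'v pi1_arr = "'v \<times> 'v \<times> 'v path set set"

definition Pi1_arrows :: "'v graph \<Rightarrow> 'v pi1_arr set" where
  "Pi1_arrows X = {(x, x', C). x \<in> verts X \<and> x' \<in> verts X \<and> C \<in> pi0 (PN X x x')}"

definition Pi1 :: "'v graph \<Rightarrow> ('v, 'v pi1_arr) gpd" where
  "Pi1 X =
     \<lparr>gobj = verts X,
      garr = Pi1_arrows X,
      gdom = (\<lambda>(x, x', C) \<in> Pi1_arrows X. x),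
      gcod = (\<lambda>(x, x', C) \<in> Pi1_arrows X. x'),
      gid = (\<lambda>x\<in>verts X. (x, x, path_class X (path_const x))),
      gcomp = (\<lambda>(y, z, D) (x, y', C).
        if (y, z, D) \<in> Pi1_arrows X \<and> (x, y', C) \<in> Pi1_arrows X \<and> y = y'
        then (x, z, \<Union>p\<in>\<Union>C. \<Union>q\<in>\<Union>D. path_class X (path_concat p q)) else undefined)\<rparr>"

definition Pi1_map ::
  "'v graph \<Rightarrow> 'w graph \<Rightarrow> ('v \<Rightarrow> 'w) \<Rightarrow> ('v, 'v pi1_arr, 'w, 'w pi1_arr) gfun" where
  "Pi1_map X Y f =
     \<lparr>fob = restrict f (verts X),
      far = (\<lambda>(x, x', C) \<in> Pi1_arrows X. (f x, f x', \<Union>p\<in>\<Union>C. path_class Y (path_map f p)))\<rparr>"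

text \<open>The monoidal structure isomorphism from \<open>\<Pi>\<^sub>1 X \<times> \<Pi>\<^sub>1 Y\<close> to \<open>\<Pi>\<^sub>1 (X \<box> Y)\<close>, the inverse
  of the functor induced by the two projections: traverse the first path, then the second.\<close>

definition Pi1_mu ::
  "'v graph \<Rightarrow> 'w graph \<Rightarrow>
   ('v \<times> 'w, 'v pi1_arr \<times> 'w pi1_arr, 'v \<times> 'w, ('v \<times> 'w) pi1_arr) gfun" where
  "Pi1_mu X Y =
     \<lparr>fob = (\<lambda>z \<in> verts X \<times> verts Y. z),
      far = (\<lambda>(a, b) \<in> Pi1_arrows X \<times> Pi1_arrows Y.
        gcomp (Pi1 (box X Y))
          (far (Pi1_map Y (box X Y) (\<lambda>y\<in>verts Y. (gcod (Pi1 X) a, y))) b)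
          (far (Pi1_map X (box X Y) (\<lambda>x\<in>verts X. (x, gdom (Pi1 Y) b))) a))\<rparr>"

definition Pi1_unit :: "(unit, unit, nat, nat pi1_arr) gfun" where
  "Pi1_unit = \<lparr>fob = (\<lambda>_. 0), far = (\<lambda>_. gid (Pi1 (path_graph 0)) 0)\<rparr>"


section \<open>The enrichment of graphs over groupoids\<close>

definition Graph_cat :: "('v graph, 'v \<Rightarrow> 'v) cat" where
  "Graph_cat =
     \<lparr>cob = {X. is_graph X}, chom = graph_maps, ccomp = (\<lambda>X Y Z. compose (verts X)),
      cid = graph_id\<rparr>"

text \<open>Change of base along \<open>Pi1\<close> of the self-enrichment of the category of graphs.\<close>

definition Graph_enriched :: "('v graph, 'v \<Rightarrow> 'v, ('v \<Rightarrow> 'v) pi1_arr) enr_cat" where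
  "Graph_enriched =
     \<lparr>eob = {X. is_graph X},
      ehom = (\<lambda>X Y. Pi1 (ihom X Y)),
      ecomp = (\<lambda>X Y Z.
        fcomp (prod_gpd (Pi1 (ihom Y Z)) (Pi1 (ihom X Y)))
          (Pi1_map (box (ihom Y Z) (ihom X Y)) (ihom X Z) (hom_comp X Y Z))
          (Pi1_mu (ihom Y Z) (ihom X Y))),
      eunit = (\<lambda>X. fcomp unit_gpd (Pi1_map (path_graph 0) (ihom X X) (hom_unit X)) Pi1_unit)\<rparr>"

text \<open>On hom-groupoids, \<open>Pi1\<close> acts by the transpose of
  \<open>\<Pi>\<^sub>1 [X, Y] \<times> \<Pi>\<^sub>1 X \<cong> \<Pi>\<^sub>1 ([X, Y] \<box> X) \<rightarrow> \<Pi>\<^sub>1 Y\<close>, the last map being induced by evaluation.\<close>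

definition Pi1_enriched ::
  "('v graph, 'v \<Rightarrow> 'v, ('v \<Rightarrow> 'v) pi1_arr, ('v, 'v pi1_arr) gpd,
    ('v, 'v pi1_arr, 'v, 'v pi1_arr) gfun, ('v, 'v pi1_arr, 'v, 'v pi1_arr) ntrans) enr_fun" where
  "Pi1_enriched =
     \<lparr>efob = Pi1,
      efhom = (\<lambda>X Y. curry_functor (Pi1 (ihom X Y)) (Pi1 X)
        (fcomp (prod_gpd (Pi1 (ihom X Y)) (Pi1 X))
          (Pi1_map (box (ihom X Y) X) Y (hom_eval X Y))
          (Pi1_mu (ihom X Y) X)))\<rparr>"

end

theory Submission
  imports Defs
begin

text \<open>Every arrow of \<open>\<Pi>\<^sub>1 X\<close> is the class of a path, and two paths give the same arrow as soon as they
  are related by reparametrizations and pointwise adjacency relative to the endpoints (homotopy).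
  All operations are therefore computed on representing paths, where concatenation is strictly
  associative and unital. The only point at which homotopies are really needed, apart from inverses,
  is the interchange law in a box product: running through \<open>p\<close> and then \<open>q\<close> is homotopic to running
  through \<open>q\<close> and then \<open>p\<close>, which reduces to a single square by induction on both paths. It makes
  \<open>\<Pi>\<^sub>1 X \<times> \<Pi>\<^sub>1 Y \<rightarrow> \<Pi>\<^sub>1 (X \<box> Y)\<close> functorial. On representatives, the composition of the enrichment is
  whiskering followed by concatenation, so its associativity and unit laws hold strictly, and its
  compatibility with horizontal composition of natural transformations is naturality.\<close>


section \<open>Paths\<close>

text \<open>An arrow of \<open>Pi1 X\<close> sits behind three layers: reparametrization classes,
  the graph on these classes, and the components of that graph. They are flattened into one relation
  \<open>htpy\<close> on paths whose classes are exactly the sets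
  \<open>\<Union>(path_class X p)\<close>, so that a union over representatives can be evaluated on
  a single one. Concatenation is strict because lengths are free and simply add up. The price is
  that homotopic paths may differ in length, and pointwise adjacency can only be applied after
  stuttering to a common length. The box product has no diagonal edges, so two paths cannot be run
  simultaneously in it. This is why \<open>Pi1_mu\<close> runs them one after the other, and why its
  compatibility with composition is a homotopy and not an equality of paths.\<close>

definition mk_path :: "nat \<Rightarrow> (nat \<Rightarrow> 'v) \<Rightarrow> 'v path" where
  "mk_path n f = (n, restrict f {0..n})"

definition paths :: "'v graph \<Rightarrow> 'v path set" where
  "paths X = {p. snd p \<in> graph_maps (path_graph (fst p)) X}"

abbreviation psrc :: "'v path \<Rightarrow> 'v" where
  "psrc p \<equiv> snd p 0"

abbreviation ptgt :: "'v path \<Rightarrow> 'v" where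
  "ptgt p \<equiv> snd p (fst p)"

lemma adj_eq_refl [simp]: "adj_eq X x x"
  by (simp add: adj_eq_def)

lemma adj_eq_sym: "is_graph X \<Longrightarrow> adj_eq X x y \<Longrightarrow> adj_eq X y x"
  by (auto simp: adj_eq_def is_graph_def symp_def)

lemma is_graph_path_graph: "is_graph (path_graph n)"
  by (auto simp: is_graph_def path_graph_def symp_def irreflp_def)

text \<open>It suffices to test the forward edges from \<open>i\<close> to \<open>Suc i\<close>:
  symmetry of \<open>adj_eq\<close> supplies the backward ones.\<close>

lemma graph_maps_path_graph_iff:
  assumes "is_graph X"
  shows "f \<in> graph_maps (path_graph n) X \<longleftrightarrow>
    f \<in> extensional {0..n} \<and> (\<forall>i\<le>n. f i \<in> verts X) \<and> (\<forall>i<n. adj_eq X (f i) (f (Suc i)))"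
  using adj_eq_sym[OF assms]
  by (fastforce simp: graph_maps_def path_graph_def PiE_def Pi_def)

lemma paths_iff:
  assumes "is_graph X"
  shows "p \<in> paths X \<longleftrightarrow> snd p \<in> extensional {0..fst p} \<and>
    (\<forall>i\<le>fst p. snd p i \<in> verts X) \<and> (\<forall>i<fst p. adj_eq X (snd p i) (snd p (Suc i)))"
  by (simp add: paths_def graph_maps_path_graph_iff[OF assms])

lemma fst_mk_path [simp]: "fst (mk_path n f) = n"
  by (simp add: mk_path_def)

lemma snd_mk_path [simp]: "i \<le> n \<Longrightarrow> snd (mk_path n f) i = f i"
  by (simp add: mk_path_def)

lemma mk_path_extensional [simp]: "snd (mk_path n f) \<in> extensional {0..n}"
  by (simp add: mk_path_def)

lemma mk_path_in_paths:
  assumes "is_graph X"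
  shows "mk_path n f \<in> paths X \<longleftrightarrow>
    (\<forall>i\<le>n. f i \<in> verts X) \<and> (\<forall>i<n. adj_eq X (f i) (f (Suc i)))"
  by (simp add: paths_iff[OF assms])

lemma mk_path_eqI: "n = m \<Longrightarrow> (\<And>i. i \<le> n \<Longrightarrow> f i = g i) \<Longrightarrow> mk_path n f = mk_path m g"
  by (auto simp: mk_path_def intro!: restrict_ext)

lemma paths_mk_path: "p \<in> paths X \<Longrightarrow> p = mk_path (fst p) (snd p)"
  by (auto simp: paths_def mk_path_def graph_maps_def path_graph_def PiE_def
      intro!: prod_eqI extensional_restrict[symmetric])

lemma mk_path_eq_pathI:
  assumes "p \<in> paths X" "n = fst p" "\<And>i. i \<le> n \<Longrightarrow> f i = snd p i"
  shows "mk_path n f = p"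
  using assms paths_mk_path[of p X] mk_path_eqI[of n "fst p" f "snd p"] by simp

lemma path_verts: "p \<in> paths X \<Longrightarrow> i \<le> fst p \<Longrightarrow> snd p i \<in> verts X"
  by (auto simp: paths_def graph_maps_def path_graph_def)

lemma endpoints_in_verts [simp]:
  "p \<in> paths X \<Longrightarrow> psrc p \<in> verts X" "p \<in> paths X \<Longrightarrow> ptgt p \<in> verts X"
  by (simp_all add: path_verts)

lemma path_const_alt: "path_const x = mk_path 0 (\<lambda>_. x)"
  by (simp add: path_const_def mk_path_def)

lemma path_concat_alt:
  "path_concat p q = mk_path (fst p + fst q) (\<lambda>i. if i \<le> fst p then snd p i else snd q (i - fst p))"
  by (simp add: path_concat_def mk_path_def)

lemma path_map_alt: "path_map f p = mk_path (fst p) (\<lambda>i. f (snd p i))"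
  by (simp add: path_map_def mk_path_def compose_def)

lemma path_const_simps [simp]: "fst (path_const x) = 0" "snd (path_const x) 0 = x"
  by (simp_all add: path_const_alt)

lemma path_const_in_paths: "is_graph X \<Longrightarrow> x \<in> verts X \<Longrightarrow> path_const x \<in> paths X"
  by (simp add: path_const_alt mk_path_in_paths)

lemma path_concat_simps [simp]:
  "fst (path_concat p q) = fst p + fst q"
  "psrc (path_concat p q) = psrc p"
  by (simp_all add: path_concat_alt)

lemma ptgt_path_concat [simp]:
  "ptgt p = psrc q \<Longrightarrow> snd (path_concat p q) (fst p + fst q) = ptgt q"
  by (simp add: path_concat_alt)

lemma path_map_simps [simp]:
  "fst (path_map f p) = fst p" "psrc (path_map f p) = f (psrc p)"
  "snd (path_map f p) (fst p) = f (ptgt p)"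
  by (simp_all add: path_map_alt)

lemma path_concat_in_paths:
  assumes X: "is_graph X" and pq: "p \<in> paths X" "q \<in> paths X" "ptgt p = psrc q"
  shows "path_concat p q \<in> paths X"
proof -
  have "adj_eq X (if i \<le> fst p then snd p i else snd q (i - fst p))
      (if Suc i \<le> fst p then snd p (Suc i) else snd q (Suc i - fst p))"
    if i: "i < fst p + fst q" for i
  proof -
    \<comment> \<open>The matching endpoints matter at the junction \<open>i = fst p\<close>: this
      is the first step of \<open>q\<close>, which leaves from
      \<open>psrc q = ptgt p\<close>.\<close>
    consider "i < fst p" | "i = fst p" | "i > fst p" by linarith
    then show ?thesis
    proof cases
      case 3
      then have "i - fst p < fst q" "Suc i - fst p = Suc (i - fst p)" using i by auto
      then show ?thesis using 3 pq by (simp add: paths_iff[OF X])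
    qed (use i pq in \<open>auto simp: paths_iff[OF X]\<close>)
  qed
  then show ?thesis
    using pq by (auto simp: path_concat_alt mk_path_in_paths[OF X] paths_iff[OF X])
qed

lemma path_concat_const_right: "p \<in> paths X \<Longrightarrow> path_concat p (path_const x) = p"
  unfolding path_concat_alt by (rule mk_path_eq_pathI) auto

lemma path_concat_const_left: "p \<in> paths X \<Longrightarrow> psrc p = x \<Longrightarrow> path_concat (path_const x) p = p"
  unfolding path_concat_alt by (rule mk_path_eq_pathI) auto

lemma path_concat_assoc:
  "ptgt p = psrc q \<Longrightarrow> path_concat (path_concat p q) r = path_concat p (path_concat q r)"
  unfolding path_concat_alt[of "path_concat p q"] path_concat_alt[of p "path_concat q r"]
  by (rule mk_path_eqI) (auto simp: path_concat_alt)

lemma path_map_cong: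
  "p \<in> paths X \<Longrightarrow> (\<And>x. x \<in> verts X \<Longrightarrow> f x = g x) \<Longrightarrow> path_map f p = path_map g p"
  by (auto simp: path_map_alt path_verts intro!: mk_path_eqI)

lemma path_map_const: "path_map f (path_const x) = path_const (f x)"
  by (auto simp: path_map_alt path_const_alt intro!: mk_path_eqI)

lemma path_map_concat: "path_map f (path_concat p q) = path_concat (path_map f p) (path_map f q)"
  unfolding path_map_alt[of f "path_concat p q"] path_concat_alt[of "path_map f p"]
  by (rule mk_path_eqI) (auto simp: path_concat_alt path_map_alt)

lemma path_map_path_map: "path_map f (path_map g p) = path_map (\<lambda>x. f (g x)) p"
  by (auto simp: path_map_alt intro!: mk_path_eqI)

lemma path_map_ident: "p \<in> paths X \<Longrightarrow> (\<And>x. x \<in> verts X \<Longrightarrow> f x = x) \<Longrightarrow> path_map f p = p"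
  unfolding path_map_alt by (rule mk_path_eq_pathI) (auto simp: path_verts)

text \<open>Graph maps without the extensionality condition, so that a plain function such as
  \<open>\<lambda>x. (x, y)\<close> qualifies without being restricted.\<close>

definition graph_hom :: "'v graph \<Rightarrow> 'w graph \<Rightarrow> ('v \<Rightarrow> 'w) \<Rightarrow> bool" where
  "graph_hom X Y f \<longleftrightarrow> f \<in> verts X \<rightarrow> verts Y \<and> (\<forall>x y. adj X x y \<longrightarrow> adj_eq Y (f x) (f y))"

lemma graph_maps_imp_hom: "f \<in> graph_maps X Y \<Longrightarrow> graph_hom X Y f"
  by (auto simp: graph_maps_def graph_hom_def)

lemma graph_hom_restrict:
  "is_graph X \<Longrightarrow> graph_hom X Y f \<Longrightarrow> restrict f (verts X) \<in> graph_maps X Y"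
  by (auto simp: graph_maps_def graph_hom_def is_graph_def)

lemma graph_hom_adj_eq: "graph_hom X Y f \<Longrightarrow> adj_eq X x y \<Longrightarrow> adj_eq Y (f x) (f y)"
  by (auto simp: graph_hom_def adj_eq_def)

lemma path_map_in_paths:
  assumes "is_graph X" "is_graph Y" "graph_hom X Y f" "p \<in> paths X"
  shows "path_map f p \<in> paths Y"
  using assms graph_hom_adj_eq[OF assms(3)]
  by (auto simp: path_map_alt mk_path_in_paths paths_iff graph_hom_def)

section \<open>Single edges and induction along a path\<close>

definition edge_path :: "'v \<Rightarrow> 'v \<Rightarrow> 'v path" where
  "edge_path x y = mk_path 1 (\<lambda>i. if i = 0 then x else y)"

lemma edge_path_simps [simp]:
  "fst (edge_path x y) = 1" "psrc (edge_path x y) = x" "snd (edge_path x y) (Suc 0) = y"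
  by (simp_all add: edge_path_def)

lemma edge_path_in_paths:
  "is_graph X \<Longrightarrow> x \<in> verts X \<Longrightarrow> y \<in> verts X \<Longrightarrow> adj_eq X x y \<Longrightarrow> edge_path x y \<in> paths X"
  by (simp add: edge_path_def mk_path_in_paths)

lemma path_map_edge: "path_map f (edge_path x y) = edge_path (f x) (f y)"
  by (auto simp: path_map_alt edge_path_def intro!: mk_path_eqI)

text \<open>Every path arises from a constant one by appending single steps, which may be stationary
  since only \<open>adj_eq\<close> is asked for. Inducting on the path and not on its length lets
  the interchange law treat one appended edge at a time.\<close>

lemma path_induct [consumes 2, case_names const snoc]:
  assumes X: "is_graph X" and "p \<in> paths X"
    and const: "\<And>x. x \<in> verts X \<Longrightarrow> P (path_const x)"
    and snoc: "\<And>p y. p \<in> paths X \<Longrightarrow> P p \<Longrightarrow> y \<in> verts X \<Longrightarrow> adj_eq X (ptgt p) y \<Longrightarrow>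
      P (path_concat p (edge_path (ptgt p) y))"
  shows "P p"
  using \<open>p \<in> paths X\<close>
proof (induction "fst p" arbitrary: p)
  case 0
  have "p = path_const (psrc p)"
    by (subst paths_mk_path[OF 0(2)]) (auto simp: path_const_alt 0(1)[symmetric] intro!: mk_path_eqI)
  then show ?case using const[of "psrc p"] path_verts[OF 0(2), of 0] by auto
next
  case (Suc n)
  define q where "q = mk_path n (snd p)"
  have q: "q \<in> paths X" and adj: "adj_eq X (ptgt q) (ptgt p)"
    using Suc(2,3) unfolding q_def by (auto simp: mk_path_in_paths[OF X] paths_iff[OF X] Suc(2)[symmetric])
  have "p = path_concat q (edge_path (ptgt q) (ptgt p))"
    by (subst paths_mk_path[OF Suc(3)])
      (auto simp: path_concat_alt q_def edge_path_def Suc(2)[symmetric] le_Suc_eq intro!: mk_path_eqI)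
  then show ?case
    using snoc[OF q Suc(1)[OF _ q] _ adj] path_verts[OF Suc(3)] by (simp add: q_def)
qed


section \<open>Reparametrization and homotopy\<close>

text \<open>Adjacency bounds each step of \<open>s\<close> by one in either direction and
  monotonicity rules out going back, so \<open>s\<close> stays or advances by one. A walk of this
  kind from \<open>0\<close> to \<open>fst p\<close> is conversely monotone and surjective.
  Reparametrizations can then be given by explicit formulas and checked step by step.\<close>

lemma reparam_iff:
  "reparam p q \<longleftrightarrow> (\<exists>s. s 0 = 0 \<and> s (fst q) = fst p \<and>
     (\<forall>i<fst q. s (Suc i) = s i \<or> s (Suc i) = Suc (s i)) \<and>
     snd q = (\<lambda>i\<in>{0..fst q}. snd p (s i)))" (is "_ \<longleftrightarrow> (\<exists>s. ?R s)")
proof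
  assume "reparam p q"
  then obtain s where s: "s \<in> graph_maps (path_graph (fst q)) (path_graph (fst p))"
    "mono_on {0..fst q} s" "s ` {0..fst q} = {0..fst p}" "snd q = compose {0..fst q} (snd p) s"
    unfolding reparam_def by blast
  obtain i where i: "i \<le> fst q" "s i = 0" using s(3) by (metis (no_types) atLeastAtMost_iff imageE le0)
  obtain j where j: "j \<le> fst q" "s j = fst p"
    using s(3) by (metis (no_types) atLeastAtMost_iff imageE le0 order_refl)
  have "s 0 = 0" using mono_onD[OF s(2), of 0 i] i by simp
  moreover have "s (fst q) = fst p"
  proof (rule antisym)
    have "s (fst q) \<in> {0..fst p}" unfolding s(3)[symmetric] by simp
    then show "s (fst q) \<le> fst p" by simp
  qed (use mono_onD[OF s(2), of j "fst q"] j in simp)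
  moreover have "s (Suc k) = s k \<or> s (Suc k) = Suc (s k)" if k: "k < fst q" for k
  proof -
    have "adj (path_graph (fst q)) k (Suc k)" using k by (simp add: path_graph_def)
    then have "adj_eq (path_graph (fst p)) (s k) (s (Suc k))"
      using s(1) by (simp add: graph_maps_def)
    moreover have "s k \<le> s (Suc k)" using mono_onD[OF s(2), of k "Suc k"] k by simp
    ultimately show ?thesis by (auto simp: adj_eq_def path_graph_def)
  qed
  ultimately show "\<exists>s. ?R s" using s(4) by (auto simp: compose_def)
next
  assume "\<exists>s. ?R s"
  then obtain s where s: "?R s" by blast
  have mono: "s i \<le> s j" if "i \<le> j" "j \<le> fst q" for i j
    using that
  proof (induction j rule: dec_induct)
    case (step k)
    then show ?case using s by (metis Suc_le_eq Suc_leD le_Suc_eq order_trans)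
  qed simp
  \<comment> \<open>Discrete intermediate value property: a walk from 0 with steps of size at most
    one skips no value.\<close>
  have surj: "\<exists>i\<le>k. s i = m" if "m \<le> s k" "k \<le> fst q" for m k
    using that
  proof (induction k)
    case (Suc k)
    then show ?case using s by (metis Suc_le_eq Suc_leD le_Suc_eq order_refl)
  qed (use s in auto)
  let ?s = "restrict s {0..fst q}"
  have le: "s i \<le> fst p" if "i \<le> fst q" for i using mono[OF that] s by simp
  have gm: "?s \<in> graph_maps (path_graph (fst q)) (path_graph (fst p))"
  proof -
    have "adj_eq (path_graph (fst p)) (s i) (s (Suc i))" if "i < fst q" for i
      using s that le[of "Suc i"] le[of i] by (auto simp: path_graph_def adj_eq_def)
    moreover have "s i \<in> verts (path_graph (fst p))" if "i \<le> fst q" for i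
      using le[OF that] by (simp add: path_graph_def)
    ultimately show ?thesis by (simp add: graph_maps_path_graph_iff is_graph_path_graph)
  qed
  have "?s ` {0..fst q} = {0..fst p}"
  proof (intro equalityI subsetI)
    fix m assume "m \<in> {0..fst p}"
    then obtain i where "i \<le> fst q" "s i = m" using surj[of m "fst q"] s by auto
    then show "m \<in> ?s ` {0..fst q}" by (intro image_eqI[of _ _ i]) auto
  qed (use le in auto)
  moreover have "mono_on {0..fst q} ?s" by (auto simp: mono_on_def mono)
  moreover have "snd q = compose {0..fst q} (snd p) ?s"
    using s by (auto simp: compose_def)
  ultimately show "reparam p q" using gm unfolding reparam_def by blast
qed

lemma reparam_mk_path:
  assumes "s 0 = 0" "s m = fst p" "\<And>i. i < m \<Longrightarrow> s (Suc i) = s i \<or> s (Suc i) = Suc (s i)"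
    "\<And>i. i \<le> m \<Longrightarrow> f i = snd p (s i)"
  shows "reparam p (mk_path m f)"
  unfolding reparam_iff using assms by (auto simp: mk_path_def intro!: exI[of _ s])

lemma reparamE:
  assumes "reparam p q"
  obtains s where "s 0 = 0" "s (fst q) = fst p"
    "\<And>i. i < fst q \<Longrightarrow> s (Suc i) = s i \<or> s (Suc i) = Suc (s i)"
    "q = mk_path (fst q) (\<lambda>i. snd p (s i))" "\<And>i. i \<le> fst q \<Longrightarrow> s i \<le> fst p"
proof -
  obtain s where s: "s 0 = 0" "s (fst q) = fst p"
    "\<forall>i<fst q. s (Suc i) = s i \<or> s (Suc i) = Suc (s i)" "snd q = (\<lambda>i\<in>{0..fst q}. snd p (s i))"
    using assms unfolding reparam_iff by blast
  have "s i \<le> s (fst q)" if "i \<le> fst q" for i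
    using that
  proof (induction i rule: inc_induct)
    case (step n)
    then show ?case using s(3) by (metis Suc_leD order_refl)
  qed simp
  then show thesis using s by (intro that[of s]) (auto simp: mk_path_def prod_eq_iff)
qed

text \<open>Merges the two layers of the quotient: \<open>reparam\<close> generates the
  identifications in \<open>PN\<close>, pointwise adjacency at equal length generates its edges. The
  endpoints are fixed explicitly, as pointwise adjacency alone could move them.\<close>

definition htpy_step :: "'v graph \<Rightarrow> 'v path \<Rightarrow> 'v path \<Rightarrow> bool" where
  "htpy_step X p q \<longleftrightarrow> p \<in> paths X \<and> q \<in> paths X \<and> psrc p = psrc q \<and> ptgt p = ptgt q \<and>
     (reparam p q \<or> fst p = fst q \<and> (\<forall>i\<le>fst p. adj_eq X (snd p i) (snd q i)))"

definition htpy :: "'v graph \<Rightarrow> 'v path \<Rightarrow> 'v path \<Rightarrow> bool" where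
  "htpy X = equivclp (htpy_step X)"

lemma htpy_refl [simp]: "htpy X p p"
  by (simp add: htpy_def)

lemma htpy_sym: "htpy X p q \<Longrightarrow> htpy X q p"
  unfolding htpy_def by (rule equivclp_sym)

lemma htpy_trans [trans]: "htpy X p q \<Longrightarrow> htpy X q r \<Longrightarrow> htpy X p r"
  unfolding htpy_def by (rule equivclp_trans)

lemma htpy_stepI: "htpy_step X p q \<Longrightarrow> htpy X p q"
  unfolding htpy_def by (rule r_into_equivclp)

lemma htpy_induct [consumes 1, case_names refl step]:
  assumes "htpy X p q" "P p"
    "\<And>q r. htpy X p q \<Longrightarrow> htpy_step X q r \<or> htpy_step X r q \<Longrightarrow> P q \<Longrightarrow> P r"
  shows "P q"
  using assms unfolding htpy_def by (rule equivclp_induct)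

lemma htpy_endpoints:
  assumes "htpy X p q" "p \<in> paths X"
  shows "q \<in> paths X \<and> psrc q = psrc p \<and> ptgt q = ptgt p"
  using assms(1) by (induction rule: htpy_induct) (use assms(2) in \<open>auto simp: htpy_step_def\<close>)

lemma reparam_endpoints: "reparam p q \<Longrightarrow> psrc q = psrc p \<and> ptgt q = ptgt p"
  unfolding reparam_iff by auto

lemma reparam_in_paths:
  assumes X: "is_graph X" and p: "p \<in> paths X" and "reparam p q"
  shows "q \<in> paths X"
proof -
  obtain s where s: "s 0 = 0" "s (fst q) = fst p"
    "\<And>i. i < fst q \<Longrightarrow> s (Suc i) = s i \<or> s (Suc i) = Suc (s i)"
    "q = mk_path (fst q) (\<lambda>i. snd p (s i))" "\<And>i. i \<le> fst q \<Longrightarrow> s i \<le> fst p"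
    using reparamE[OF assms(3)] by metis
  have "adj_eq X (snd p (s i)) (snd p (s (Suc i)))" if "i < fst q" for i
    using s(3)[OF that] s(5)[of "Suc i"] that p by (auto simp: paths_iff[OF X])
  then show ?thesis
    by (subst s(4)) (use s(5) p in \<open>auto simp: mk_path_in_paths[OF X] path_verts\<close>)
qed

lemma htpy_reparam: "is_graph X \<Longrightarrow> p \<in> paths X \<Longrightarrow> reparam p q \<Longrightarrow> htpy X p q"
  by (rule htpy_stepI) (auto simp: htpy_step_def reparam_in_paths reparam_endpoints)

lemma htpy_adj:
  assumes "p \<in> paths X" "q \<in> paths X" "fst p = fst q" "psrc p = psrc q" "ptgt p = ptgt q"
    "\<And>i. i \<le> fst p \<Longrightarrow> adj_eq X (snd p i) (snd q i)"
  shows "htpy X p q"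
  by (rule htpy_stepI) (use assms in \<open>auto simp: htpy_step_def\<close>)

section \<open>Homotopy under concatenation and graph maps\<close>

lemma reparam_path_concat_left:
  assumes "reparam p p'"
  shows "reparam (path_concat p q) (path_concat p' q)"
proof -
  obtain s where s: "s 0 = 0" "s (fst p') = fst p"
    "\<And>i. i < fst p' \<Longrightarrow> s (Suc i) = s i \<or> s (Suc i) = Suc (s i)"
    "p' = mk_path (fst p') (\<lambda>i. snd p (s i))" "\<And>i. i \<le> fst p' \<Longrightarrow> s i \<le> fst p"
    using reparamE[OF assms] by metis
  have p': "snd p' i = snd p (s i)" if "i \<le> fst p'" for i
    using that by (subst s(4)) simp
  show ?thesis
    unfolding path_concat_alt[of p' q]
    by (rule reparam_mk_path[where s = "\<lambda>i. if i \<le> fst p' then s i else fst p + (i - fst p')"])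
      (use s(1-3,5) p' in
        \<open>auto simp: path_concat_alt Suc_diff_le not_less_eq_eq le_Suc_eq trans_le_add1\<close>)
qed

text \<open>If \<open>s\<close> begins with a stutter, times just after \<open>fst p\<close> are
  sent back to \<open>fst p\<close>, where the concatenation shows \<open>ptgt p\<close>; hence the
  hypothesis that this equals \<open>psrc q\<close>. Reparametrizing the first factor never sends a
  time belonging to \<open>q\<close> back to the junction.\<close>

lemma reparam_path_concat_right:
  assumes "reparam q q'" "ptgt p = psrc q"
  shows "reparam (path_concat p q) (path_concat p q')"
proof -
  obtain s where s: "s 0 = 0" "s (fst q') = fst q"
    "\<And>i. i < fst q' \<Longrightarrow> s (Suc i) = s i \<or> s (Suc i) = Suc (s i)"
    "q' = mk_path (fst q') (\<lambda>i. snd q (s i))" "\<And>i. i \<le> fst q' \<Longrightarrow> s i \<le> fst q"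
    using reparamE[OF assms(1)] by metis
  have q': "snd q' i = snd q (s i)" if "i \<le> fst q'" for i
    using that by (subst s(4)) simp
  let ?t = "\<lambda>i. if i \<le> fst p then i else fst p + s (i - fst p)"
  show ?thesis
    unfolding path_concat_alt[of p q']
  proof (rule reparam_mk_path[where s = ?t])
    fix i assume i: "i < fst p + fst q'"
    consider "i < fst p" | "i = fst p" | "i > fst p" by linarith
    then show "?t (Suc i) = ?t i \<or> ?t (Suc i) = Suc (?t i)"
    proof cases
      case 2
      then show ?thesis using i s(3)[of 0] s(1) by simp
    next
      case 3
      then show ?thesis using i s(3)[of "i - fst p"] by (auto simp: Suc_diff_le)
    qed simp
  next
    fix i assume i: "i \<le> fst p + fst q'"
    show "(if i \<le> fst p then snd p i else snd q' (i - fst p)) = snd (path_concat p q) (?t i)"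
      using i s(5)[of "i - fst p"] q'[of "i - fst p"] assms(2) by (auto simp: path_concat_alt)
  qed (use s(1,2) in auto)
qed

lemma htpy_step_concat_left:
  assumes X: "is_graph X" and st: "htpy_step X p p'" and q: "q \<in> paths X" "ptgt p = psrc q"
  shows "htpy_step X (path_concat p q) (path_concat p' q)"
  using assms reparam_path_concat_left[of p p' q] path_concat_in_paths[OF X, of _ q]
  by (auto simp: htpy_step_def) (auto simp: path_concat_alt)

lemma htpy_step_concat_right:
  assumes X: "is_graph X" and st: "htpy_step X q q'" and p: "p \<in> paths X" "ptgt p = psrc q"
  shows "htpy_step X (path_concat p q) (path_concat p q')"
  using assms reparam_path_concat_right[of q q' p] path_concat_in_paths[OF X, of p]
  by (auto simp: htpy_step_def) (auto simp: path_concat_alt)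

lemma htpy_concat_left:
  assumes X: "is_graph X" and "htpy X p p'" and p: "p \<in> paths X" "q \<in> paths X" "ptgt p = psrc q"
  shows "htpy X (path_concat p q) (path_concat p' q)"
  using assms(2)
proof (induction rule: htpy_induct)
  case (step r r')
  have "ptgt r = psrc q" "ptgt r' = psrc q"
    using htpy_endpoints[OF step(1) p(1)] step(2) p by (auto simp: htpy_step_def)
  then show ?case
    using step htpy_step_concat_left[OF X _ p(2)] by (meson htpy_stepI htpy_sym htpy_trans)
qed simp

lemma htpy_concat_right:
  assumes X: "is_graph X" and "htpy X q q'" and p: "p \<in> paths X" "q \<in> paths X" "ptgt p = psrc q"
  shows "htpy X (path_concat p q) (path_concat p q')"
  using assms(2)
proof (induction rule: htpy_induct)
  case (step r r')
  have "ptgt p = psrc r" "ptgt p = psrc r'"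
    using htpy_endpoints[OF step(1) p(2)] step(2) p by (auto simp: htpy_step_def)
  then show ?case
    using step htpy_step_concat_right[OF X _ p(1)] by (meson htpy_stepI htpy_sym htpy_trans)
qed simp

lemma htpy_concat:
  assumes X: "is_graph X" and "htpy X p p'" "htpy X q q'"
    and p: "p \<in> paths X" "q \<in> paths X" "ptgt p = psrc q"
  shows "htpy X (path_concat p q) (path_concat p' q')"
proof -
  have "htpy X (path_concat p q) (path_concat p' q)" using assms by (intro htpy_concat_left)
  also have "htpy X \<dots> (path_concat p' q')"
    using assms htpy_endpoints[OF assms(2) p(1)] by (intro htpy_concat_right) auto
  finally show ?thesis .
qed

lemma reparam_path_map: "reparam p q \<Longrightarrow> reparam (path_map f p) (path_map f q)"
proof (erule reparamE)
  fix s assume s: "s 0 = 0" "s (fst q) = fst p"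
    "\<And>i. i < fst q \<Longrightarrow> s (Suc i) = s i \<or> s (Suc i) = Suc (s i)"
    "q = mk_path (fst q) (\<lambda>i. snd p (s i))" "\<And>i. i \<le> fst q \<Longrightarrow> s i \<le> fst p"
  have q: "snd q i = snd p (s i)" if "i \<le> fst q" for i
    using that by (subst s(4)) simp
  show ?thesis unfolding path_map_alt[of f q]
    by (rule reparam_mk_path[where s = s]) (use s(1-3,5) q in \<open>auto simp: path_map_alt\<close>)
qed

lemma htpy_path_map:
  assumes X: "is_graph X" "is_graph Y" and f: "graph_hom X Y f" and "htpy X p q"
  shows "htpy Y (path_map f p) (path_map f q)"
  using assms(4)
proof (induction rule: htpy_induct)
  case (step r r')
  have "htpy_step Y (path_map f r) (path_map f r')" if "htpy_step X r r'" for r r'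
    using that path_map_in_paths[OF X f] reparam_path_map[of r r' f] graph_hom_adj_eq[OF f]
    by (auto simp: htpy_step_def) (auto simp: path_map_alt)
  then show ?case using step by (meson htpy_stepI htpy_sym htpy_trans)
qed simp

text \<open>All of \<open>path_graph n\<close> collapses onto \<open>path_graph 0\<close>, so
  constant paths of every length represent the same arrow.\<close>

lemma htpy_constant:
  assumes "is_graph X" "x \<in> verts X"
  shows "htpy X (path_const x) (mk_path n (\<lambda>_. x))"
  by (rule htpy_reparam[OF assms(1) path_const_in_paths[OF assms]], rule reparam_mk_path[where s = "\<lambda>_. 0"])
    auto

section \<open>Reversal of paths\<close>

definition path_rev :: "'v path \<Rightarrow> 'v path" where
  "path_rev p = mk_path (fst p) (\<lambda>i. snd p (fst p - i))"

lemma path_rev_simps [simp]: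
  "fst (path_rev p) = fst p" "psrc (path_rev p) = ptgt p" "snd (path_rev p) (fst p) = psrc p"
  by (simp_all add: path_rev_def)

lemma path_rev_in_paths:
  assumes X: "is_graph X" and p: "p \<in> paths X"
  shows "path_rev p \<in> paths X"
proof -
  have "adj_eq X (snd p (fst p - i)) (snd p (fst p - Suc i))" if "i < fst p" for i
  proof -
    have "adj_eq X (snd p (fst p - Suc i)) (snd p (Suc (fst p - Suc i)))"
      using p that by (simp add: paths_iff[OF X])
    then show ?thesis using that adj_eq_sym[OF X] by (simp add: Suc_diff_Suc)
  qed
  then show ?thesis using p by (simp add: path_rev_def mk_path_in_paths[OF X] path_verts)
qed

lemma path_rev_path_rev: "p \<in> paths X \<Longrightarrow> path_rev (path_rev p) = p"
  unfolding path_rev_def[of "path_rev p"]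
  by (rule mk_path_eq_pathI) (auto simp: path_rev_def)

text \<open>Cutting \<open>p\<close> off at time \<open>k\<close> before turning back gives paths that are pointwise adjacent for
  consecutive \<open>k\<close>.\<close>

lemma htpy_path_rev:
  assumes X: "is_graph X" and p: "p \<in> paths X"
  shows "htpy X (path_concat p (path_rev p)) (path_const (psrc p))"
proof -
  define n where "n = fst p"
  \<comment> \<open>The tent \<open>min i (n + n - i)\<close> runs out to time \<open>n\<close> and
    back. Capping it at \<open>k\<close> keeps the length \<open>n + n\<close> for every
    \<open>k\<close>, as pointwise comparison requires; \<open>k = 0\<close> gives a constant path
    and \<open>k = n\<close> the full round trip.\<close>
  define g where "g k = mk_path (n + n) (\<lambda>i. snd p (min k (min i (n + n - i))))" for k
  have adj: "adj_eq X (snd p i) (snd p j)" if "i = j \<or> i = Suc j \<or> j = Suc i" "i \<le> n" "j \<le> n" for i j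
    using that p adj_eq_sym[OF X] by (auto simp: paths_iff[OF X] n_def)
  have min_steps: "min k a = min k b \<or> min k a = Suc (min k b) \<or> min k b = Suc (min k a)"
    if "a = b \<or> a = Suc b \<or> b = Suc a" for a b k :: nat
    using that by auto
  have turn: "min i (n + n - i) = min (Suc i) (n + n - Suc i) \<or>
      min i (n + n - i) = Suc (min (Suc i) (n + n - Suc i)) \<or>
      min (Suc i) (n + n - Suc i) = Suc (min i (n + n - i))" if "i < n + n" for i
    using that by (simp add: min_def) arith
  have g: "g k \<in> paths X" if "k \<le> n" for k
    using that path_verts[OF p] unfolding g_def mk_path_in_paths[OF X]
    by (intro conjI allI impI adj min_steps turn) (simp_all add: n_def min.coboundedI1)
  have "htpy X (g 0) (g k)" if "k \<le> n" for k
    using that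
  proof (induction k)
    case (Suc k)
    have "htpy X (g k) (g (Suc k))"
    proof (rule htpy_adj)
      fix i assume "i \<le> fst (g k)"
      then have "i \<le> n + n" by (simp add: g_def)
      moreover have "min k j = min (Suc k) j \<or> Suc (min k j) = min (Suc k) j" for j by linarith
      ultimately show "adj_eq X (snd (g k) i) (snd (g (Suc k)) i)"
        using Suc.prems by (simp add: g_def) (intro adj; auto)
    qed (use Suc.prems g in \<open>simp_all add: g_def\<close>)
    then show ?case using Suc htpy_trans Suc_leD by blast
  qed simp
  moreover have "g n = path_concat p (path_rev p)"
    unfolding g_def path_concat_alt by (rule mk_path_eqI) (auto simp: n_def path_rev_def min_def)
  moreover have "g 0 = mk_path (n + n) (\<lambda>_. psrc p)" by (simp add: g_def)
  ultimately show ?thesis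
    using htpy_constant[OF X path_verts[OF p, of 0], of "n + n"] htpy_trans htpy_sym
    by (metis le0 order_refl)
qed


section \<open>Groupoids, functors and natural transformations\<close>

context
  fixes G :: "('o, 'm) gpd"
  assumes G: "groupoid G"
begin

lemma gdom_in: "f \<in> garr G \<Longrightarrow> gdom G f \<in> gobj G"
  and gcod_in: "f \<in> garr G \<Longrightarrow> gcod G f \<in> gobj G"
  and gid_in: "x \<in> gobj G \<Longrightarrow> gid G x \<in> garr G"
  using G by (auto simp: groupoid_def)

lemma gdom_gid: "x \<in> gobj G \<Longrightarrow> gdom G (gid G x) = x"
  and gcod_gid: "x \<in> gobj G \<Longrightarrow> gcod G (gid G x) = x"
  using G by (auto simp: groupoid_def)

lemma gcomp_in: "g \<in> garr G \<Longrightarrow> f \<in> garr G \<Longrightarrow> gdom G g = gcod G f \<Longrightarrow> gcomp G g f \<in> garr G"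
  and gdom_gcomp:
    "g \<in> garr G \<Longrightarrow> f \<in> garr G \<Longrightarrow> gdom G g = gcod G f \<Longrightarrow> gdom G (gcomp G g f) = gdom G f"
  and gcod_gcomp:
    "g \<in> garr G \<Longrightarrow> f \<in> garr G \<Longrightarrow> gdom G g = gcod G f \<Longrightarrow> gcod G (gcomp G g f) = gcod G g"
  using G by (auto simp: groupoid_def composable_def)

lemma gcomp_gid_right: "f \<in> garr G \<Longrightarrow> gdom G f = x \<Longrightarrow> gcomp G f (gid G x) = f"
  and gcomp_gid_left: "f \<in> garr G \<Longrightarrow> gcod G f = x \<Longrightarrow> gcomp G (gid G x) f = f"
  using G by (auto simp: groupoid_def)

lemma gcomp_assoc:
  "h \<in> garr G \<Longrightarrow> g \<in> garr G \<Longrightarrow> f \<in> garr G \<Longrightarrow> gdom G h = gcod G g \<Longrightarrow> gdom G g = gcod G f \<Longrightarrow>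
    gcomp G (gcomp G h g) f = gcomp G h (gcomp G g f)"
  using G by (auto simp: groupoid_def composable_def)

lemmas groupoid_rules =
  gdom_in gcod_in gid_in gdom_gid gcod_gid gcomp_in gdom_gcomp gcod_gcomp gcomp_gid_right
  gcomp_gid_left gcomp_assoc

end

definition ginv :: "('o, 'm) gpd \<Rightarrow> 'm \<Rightarrow> 'm" where
  "ginv G f = (SOME g. g \<in> garr G \<and> gdom G g = gcod G f \<and> gcod G g = gdom G f \<and>
     gcomp G g f = gid G (gdom G f) \<and> gcomp G f g = gid G (gcod G f))"

lemma ginv_props:
  assumes "groupoid G" "f \<in> garr G"
  shows "ginv G f \<in> garr G" "gdom G (ginv G f) = gcod G f" "gcod G (ginv G f) = gdom G f"
    "gcomp G (ginv G f) f = gid G (gdom G f)" "gcomp G f (ginv G f) = gid G (gcod G f)"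
proof -
  have "\<exists>g. g \<in> garr G \<and> gdom G g = gcod G f \<and> gcod G g = gdom G f \<and>
     gcomp G g f = gid G (gdom G f) \<and> gcomp G f g = gid G (gcod G f)"
    using assms unfolding groupoid_def by blast
  from someI_ex[OF this] show "ginv G f \<in> garr G" "gdom G (ginv G f) = gcod G f"
    "gcod G (ginv G f) = gdom G f" "gcomp G (ginv G f) f = gid G (gdom G f)"
    "gcomp G f (ginv G f) = gid G (gcod G f)"
    unfolding ginv_def by auto
qed

text \<open>Write \<open>g\<close> as \<open>g a\<close> followed after the inverse of
  \<open>a\<close>, replace \<open>g a\<close> by \<open>b f\<close>, and cancel \<open>b\<close>.
  This is the naturality square of the pointwise inverse of a natural transformation.\<close>

lemma ginv_square:
  assumes G: "groupoid G"
    and "a \<in> garr G" "b \<in> garr G" "f \<in> garr G" "g \<in> garr G"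
    and "gdom G b = gcod G f" "gdom G g = gcod G a" "gdom G f = gdom G a" "gcod G g = gcod G b"
    and sq: "gcomp G b f = gcomp G g a"
  shows "gcomp G (ginv G b) g = gcomp G f (ginv G a)"
proof -
  note [simp] = groupoid_rules[OF G] ginv_props[OF G] assms(2-9)
  have "gcomp G (ginv G b) g = gcomp G (ginv G b) (gcomp G (gcomp G g a) (ginv G a))"
    by simp
  also have "\<dots> = gcomp G (ginv G b) (gcomp G (gcomp G b f) (ginv G a))"
    by (simp only: sq)
  also have "\<dots> = gcomp G (ginv G b) (gcomp G b (gcomp G f (ginv G a)))" by simp
  also have "\<dots> = gcomp G (gcomp G (ginv G b) b) (gcomp G f (ginv G a))"
    by (rule gcomp_assoc[OF G, symmetric]) simp_all
  also have "\<dots> = gcomp G f (ginv G a)" by simp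
  finally show ?thesis .
qed

section \<open>Functors and their composition\<close>

context
  fixes G :: "('o, 'm) gpd" and H :: "('p, 'q) gpd" and F :: "('o, 'm, 'p, 'q) gfun"
  assumes F: "is_functor G H F"
begin

lemma functor_fob: "x \<in> gobj G \<Longrightarrow> fob F x \<in> gobj H"
  and functor_far: "f \<in> garr G \<Longrightarrow> far F f \<in> garr H"
  and functor_gdom: "f \<in> garr G \<Longrightarrow> gdom H (far F f) = fob F (gdom G f)"
  and functor_gcod: "f \<in> garr G \<Longrightarrow> gcod H (far F f) = fob F (gcod G f)"
  and functor_gid: "x \<in> gobj G \<Longrightarrow> far F (gid G x) = gid H (fob F x)"
  and functor_gcomp: "g \<in> garr G \<Longrightarrow> f \<in> garr G \<Longrightarrow> gdom G g = gcod G f \<Longrightarrow>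
    far F (gcomp G g f) = gcomp H (far F g) (far F f)"
  and functor_fob_ext: "fob F \<in> extensional (gobj G)"
  and functor_far_ext: "far F \<in> extensional (garr G)"
  using F by (auto simp: is_functor_def composable_def PiE_def)

lemmas functor_rules =
  functor_fob functor_far functor_gdom functor_gcod functor_gid functor_gcomp

end

lemma gfun_eqI: "fob S = fob T \<Longrightarrow> far S = far T \<Longrightarrow> S = (T :: ('o, 'm, 'p, 'q) gfun)"
  by (cases S; cases T) simp

lemma fob_fcomp: "x \<in> gobj G \<Longrightarrow> fob (fcomp G T S) x = fob T (fob S x)"
  and far_fcomp: "f \<in> garr G \<Longrightarrow> far (fcomp G T S) f = far T (far S f)"
  by (simp_all add: fcomp_def compose_eq)

text \<open>Since \<open>fcomp G\<close> restricts to \<open>G\<close>, equations between composites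
  can be tested on the objects and arrows of \<open>G\<close>. The associativity law of an enriched
  category and the compatibility of an enriched functor with composition thereby become identities
  between values.\<close>

lemma fcomp_eqI:
  assumes "\<And>x. x \<in> gobj G \<Longrightarrow> fob T (fob S x) = fob T' (fob S' x)"
    and "\<And>f. f \<in> garr G \<Longrightarrow> far T (far S f) = far T' (far S' f)"
  shows "fcomp G T S = fcomp G T' S'"
  using assms by (auto simp: fcomp_def compose_def intro!: restrict_ext)

text \<open>The shape needed for the unit laws, whose right-hand sides are restricted
  projections.\<close>

lemma fcomp_eq_restrictI:
  assumes "\<And>x. x \<in> gobj G \<Longrightarrow> fob T (fob S x) = u x"
    and "\<And>f. f \<in> garr G \<Longrightarrow> far T (far S f) = v f"
  shows "fcomp G T S = \<lparr>fob = restrict u (gobj G), far = restrict v (garr G)\<rparr>"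
  using assms by (auto simp: fcomp_def compose_def intro!: restrict_ext)

lemma is_functor_fcomp:
  assumes G: "groupoid G" and S: "is_functor G H S" and T: "is_functor H K T"
  shows "is_functor G K (fcomp G T S)"
proof -
  note [simp] = groupoid_rules[OF G] functor_rules[OF S] functor_rules[OF T] fob_fcomp far_fcomp
  have "fob (fcomp G T S) \<in> extensional (gobj G)" "far (fcomp G T S) \<in> extensional (garr G)"
    by (simp_all add: fcomp_def)
  then show ?thesis unfolding is_functor_def by (auto simp: composable_def PiE_def)
qed

lemma fcomp_assoc:
  assumes "is_functor G H S"
  shows "fcomp G (fcomp H U T) S = fcomp G U (fcomp G T S)"
  using functor_fob[OF assms] functor_far[OF assms]
  by (auto simp: fcomp_def compose_def intro!: ext)

lemma id_functor_simps [simp]: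
  "x \<in> gobj G \<Longrightarrow> fob (id_functor G) x = x" "f \<in> garr G \<Longrightarrow> far (id_functor G) f = f"
  by (simp_all add: id_functor_def)

lemma is_functor_id: "groupoid G \<Longrightarrow> is_functor G G (id_functor G)"
  by (auto simp: is_functor_def id_functor_def composable_def groupoid_rules)

lemma fcomp_id_right: "is_functor G H S \<Longrightarrow> fcomp G S (id_functor G) = S"
  using functor_fob_ext functor_far_ext
  by (intro gfun_eqI) (fastforce simp: fcomp_def compose_def id_functor_def extensional_def)+

lemma fcomp_id_left: "is_functor G H S \<Longrightarrow> fcomp G (id_functor H) S = S"
  using functor_fob_ext[of G H S] functor_far_ext[of G H S] functor_fob[of G H S] functor_far[of G H S]
  by (intro gfun_eqI) (auto simp: fcomp_def compose_def extensional_def)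

section \<open>Product groupoids\<close>

lemma prod_gpd_simps [simp]:
  "gobj (prod_gpd G H) = gobj G \<times> gobj H"
  "garr (prod_gpd G H) = garr G \<times> garr H"
  "a \<in> garr G \<Longrightarrow> b \<in> garr H \<Longrightarrow> gdom (prod_gpd G H) (a, b) = (gdom G a, gdom H b)"
  "a \<in> garr G \<Longrightarrow> b \<in> garr H \<Longrightarrow> gcod (prod_gpd G H) (a, b) = (gcod G a, gcod H b)"
  "x \<in> gobj G \<Longrightarrow> y \<in> gobj H \<Longrightarrow> gid (prod_gpd G H) (x, y) = (gid G x, gid H y)"
  by (simp_all add: prod_gpd_def)

lemma composable_prod_gpd:
  "composable (prod_gpd G H) (a', b') (a, b) \<longleftrightarrow> composable G a' a \<and> composable H b' b"
  by (auto simp: composable_def)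

lemma gcomp_prod_gpd:
  "composable G a' a \<Longrightarrow> composable H b' b \<Longrightarrow>
    gcomp (prod_gpd G H) (a', b') (a, b) = (gcomp G a' a, gcomp H b' b)"
  by (simp add: prod_gpd_def)

lemma groupoid_prod_gpd:
  assumes G: "groupoid G" and H: "groupoid H"
  shows "groupoid (prod_gpd G H)"
proof -
  note [simp] = groupoid_rules[OF G] groupoid_rules[OF H] gcomp_prod_gpd composable_def
  have "\<exists>g\<in>garr (prod_gpd G H). gdom (prod_gpd G H) g = gcod (prod_gpd G H) f \<and>
      gcod (prod_gpd G H) g = gdom (prod_gpd G H) f \<and>
      gcomp (prod_gpd G H) g f = gid (prod_gpd G H) (gdom (prod_gpd G H) f) \<and>
      gcomp (prod_gpd G H) f g = gid (prod_gpd G H) (gcod (prod_gpd G H) f)"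
    if "f \<in> garr (prod_gpd G H)" for f
    using that ginv_props[OF G] ginv_props[OF H]
    by (intro bexI[of _ "(ginv G (fst f), ginv H (snd f))"]) auto
  moreover have "gcomp (prod_gpd G H) g f = undefined" if "\<not> composable (prod_gpd G H) g f" for g f
    using that composable_prod_gpd[of G H "fst g" "snd g" "fst f" "snd f"]
    by (cases g; cases f) (auto simp: prod_gpd_def simp del: composable_def)
  moreover have "gdom (prod_gpd G H) \<in> extensional (garr G \<times> garr H)"
    "gcod (prod_gpd G H) \<in> extensional (garr G \<times> garr H)"
    "gid (prod_gpd G H) \<in> extensional (gobj G \<times> gobj H)"
    by (simp_all add: prod_gpd_def)
  ultimately show ?thesis
    unfolding groupoid_def by (auto simp: PiE_def)
qed

lemma prod_functor_simps [simp]: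
  "x \<in> gobj G \<Longrightarrow> y \<in> gobj H \<Longrightarrow> fob (prod_functor G H S T) (x, y) = (fob S x, fob T y)"
  "a \<in> garr G \<Longrightarrow> b \<in> garr H \<Longrightarrow> far (prod_functor G H S T) (a, b) = (far S a, far T b)"
  by (simp_all add: prod_functor_def)

lemma assoc_functor_simps [simp]:
  "x \<in> gobj G \<Longrightarrow> y \<in> gobj H \<Longrightarrow> z \<in> gobj K \<Longrightarrow> fob (assoc_functor G H K) ((x, y), z) = (x, y, z)"
  "a \<in> garr G \<Longrightarrow> b \<in> garr H \<Longrightarrow> c \<in> garr K \<Longrightarrow> far (assoc_functor G H K) ((a, b), c) = (a, b, c)"
  by (simp_all add: assoc_functor_def)

lemma unit_gpd_simps [simp]: "gobj unit_gpd = UNIV" "garr unit_gpd = UNIV"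
  by (auto simp: unit_gpd_def)

section \<open>Natural transformations and functor groupoids\<close>

lemma nat_transsD:
  assumes "(S, T, \<tau>) \<in> nat_transs G H"
  shows "is_functor G H S" "is_functor G H T" "\<tau> \<in> extensional (gobj G)"
    "\<And>x. x \<in> gobj G \<Longrightarrow> \<tau> x \<in> garr H"
    "\<And>x. x \<in> gobj G \<Longrightarrow> gdom H (\<tau> x) = fob S x"
    "\<And>x. x \<in> gobj G \<Longrightarrow> gcod H (\<tau> x) = fob T x"
  using assms by (auto simp: nat_transs_def PiE_def)

text \<open>The endpoints \<open>x\<close> and \<open>y\<close> are separate variables so that the
  rule also matches when the source and target of \<open>f\<close> appear in computed form.\<close>

lemma nat_trans_natural:
  "(S, T, \<tau>) \<in> nat_transs G H \<Longrightarrow> f \<in> garr G \<Longrightarrow> gdom G f = x \<Longrightarrow> gcod G f = y \<Longrightarrow>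
    gcomp H (\<tau> y) (far S f) = gcomp H (far T f) (\<tau> x)"
  by (auto simp: nat_transs_def)

lemma nat_transsI:
  assumes "is_functor G H S" "is_functor G H T"
    "\<And>x. x \<in> gobj G \<Longrightarrow> \<tau> x \<in> garr H"
    "\<And>x. x \<in> gobj G \<Longrightarrow> gdom H (\<tau> x) = fob S x"
    "\<And>x. x \<in> gobj G \<Longrightarrow> gcod H (\<tau> x) = fob T x"
    "\<And>f. f \<in> garr G \<Longrightarrow> gcomp H (\<tau> (gcod G f)) (far S f) = gcomp H (far T f) (\<tau> (gdom G f))"
    and G: "groupoid G"
  shows "(S, T, \<lambda>x\<in>gobj G. \<tau> x) \<in> nat_transs G H"
  using assms(1-6) gdom_in[OF G] gcod_in[OF G] by (simp add: nat_transs_def)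

lemma fun_gpd_simps [simp]:
  "gobj (fun_gpd G H) = {S. is_functor G H S}"
  "garr (fun_gpd G H) = nat_transs G H"
  "(S, T, \<tau>) \<in> nat_transs G H \<Longrightarrow> gdom (fun_gpd G H) (S, T, \<tau>) = S"
  "(S, T, \<tau>) \<in> nat_transs G H \<Longrightarrow> gcod (fun_gpd G H) (S, T, \<tau>) = T"
  "is_functor G H S \<Longrightarrow> gid (fun_gpd G H) S = (S, S, \<lambda>x\<in>gobj G. gid H (fob S x))"
  "(T, U, \<sigma>) \<in> nat_transs G H \<Longrightarrow> (S, T, \<tau>) \<in> nat_transs G H \<Longrightarrow>
    gcomp (fun_gpd G H) (T, U, \<sigma>) (S, T, \<tau>) = (S, U, \<lambda>x\<in>gobj G. gcomp H (\<sigma> x) (\<tau> x))"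
  by (simp_all add: fun_gpd_def)

lemma composable_fun_gpd:
  "composable (fun_gpd G H) (S', T', \<sigma>) (S, T, \<tau>) \<longleftrightarrow>
    (S', T', \<sigma>) \<in> nat_transs G H \<and> (S, T, \<tau>) \<in> nat_transs G H \<and> S' = T"
  by (auto simp: composable_def)

lemma nat_trans_id:
  assumes "groupoid G" "groupoid H" "is_functor G H S"
  shows "(S, S, \<lambda>x\<in>gobj G. gid H (fob S x)) \<in> nat_transs G H"
  by (rule nat_transsI)
    (use assms in \<open>simp_all add: groupoid_rules[OF assms(1)] groupoid_rules[OF assms(2)]
      functor_rules[OF assms(3)]\<close>)

lemma nat_trans_comp:
  assumes G: "groupoid G" and H: "groupoid H"
    and \<sigma>: "(T, U, \<sigma>) \<in> nat_transs G H" and \<tau>: "(S, T, \<tau>) \<in> nat_transs G H"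
  shows "(S, U, \<lambda>x\<in>gobj G. gcomp H (\<sigma> x) (\<tau> x)) \<in> nat_transs G H"
proof (rule nat_transsI)
  note s = nat_transsD[OF \<sigma>] and t = nat_transsD[OF \<tau>]
  note [simp] = groupoid_rules[OF G] groupoid_rules[OF H] s(4-6) t(4-6)
    functor_rules[OF t(1)] functor_rules[OF t(2)] functor_rules[OF s(2)]
  show "is_functor G H S" "is_functor G H U" "groupoid G" by (fact t s G)+
  fix f assume f: "f \<in> garr G"
  note [simp] = f
  have "gcomp H (gcomp H (\<sigma> (gcod G f)) (\<tau> (gcod G f))) (far S f) =
      gcomp H (\<sigma> (gcod G f)) (gcomp H (far T f) (\<tau> (gdom G f)))"
    using nat_trans_natural[OF \<tau> f] by simp
  also have "\<dots> = gcomp H (gcomp H (\<sigma> (gcod G f)) (far T f)) (\<tau> (gdom G f))" by simp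
  also have "\<dots> = gcomp H (gcomp H (far U f) (\<sigma> (gdom G f))) (\<tau> (gdom G f))"
    using nat_trans_natural[OF \<sigma> f] by metis
  finally show "gcomp H (gcomp H (\<sigma> (gcod G f)) (\<tau> (gcod G f))) (far S f) =
      gcomp H (far U f) (gcomp H (\<sigma> (gdom G f)) (\<tau> (gdom G f)))" by simp
qed (use nat_transsD[OF \<sigma>] nat_transsD[OF \<tau>] groupoid_rules[OF H] in simp_all)

lemma nat_trans_inv:
  assumes G: "groupoid G" and H: "groupoid H" and \<tau>: "(S, T, \<tau>) \<in> nat_transs G H"
  shows "(T, S, \<lambda>x\<in>gobj G. ginv H (\<tau> x)) \<in> nat_transs G H"
proof (rule nat_transsI)
  note t = nat_transsD[OF \<tau>]
  fix f assume f: "f \<in> garr G"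
  show "gcomp H (ginv H (\<tau> (gcod G f))) (far T f) = gcomp H (far S f) (ginv H (\<tau> (gdom G f)))"
    by (rule ginv_square[OF H])
      (use f t nat_trans_natural[OF \<tau> f]
        in \<open>simp_all add: groupoid_rules[OF G] functor_rules[OF t(1)] functor_rules[OF t(2)]\<close>)
qed (use nat_transsD[OF \<tau>] G ginv_props[OF H] in simp_all)

lemma groupoid_fun_gpd:
  assumes G: "groupoid G" and H: "groupoid H"
  shows "groupoid (fun_gpd G H)"
  unfolding groupoid_def
proof (intro conjI allI impI ballI)
  let ?F = "fun_gpd G H"
  show "gdom ?F \<in> garr ?F \<rightarrow>\<^sub>E gobj ?F" "gcod ?F \<in> garr ?F \<rightarrow>\<^sub>E gobj ?F"
    by (auto simp: fun_gpd_def nat_transs_def)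
  show "gid ?F \<in> gobj ?F \<rightarrow>\<^sub>E garr ?F"
    using nat_trans_id[OF G H] by (auto simp: fun_gpd_def)
  {
    fix S assume "S \<in> gobj ?F"
    then show "gdom ?F (gid ?F S) = S" "gcod ?F (gid ?F S) = S"
      using nat_trans_id[OF G H] by simp_all
  next
    fix g f assume c: "composable ?F g f"
    obtain S T \<tau> U \<sigma> where gf: "g = (T, U, \<sigma>)" "f = (S, T, \<tau>)"
      "(T, U, \<sigma>) \<in> nat_transs G H" "(S, T, \<tau>) \<in> nat_transs G H"
      using c by (cases g; cases f) (auto simp: composable_fun_gpd)
    then show "gcomp ?F g f \<in> garr ?F" "gdom ?F (gcomp ?F g f) = gdom ?F f"
      "gcod ?F (gcomp ?F g f) = gcod ?F g"
      using nat_trans_comp[OF G H gf(3,4)] by simp_all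
  next
    fix g f assume "\<not> composable ?F g f"
    then show "gcomp ?F g f = undefined"
      by (cases g; cases f) (simp add: composable_fun_gpd, auto simp: fun_gpd_def)
  next
    fix f assume "f \<in> garr ?F"
    then obtain S T \<tau> where f: "f = (S, T, \<tau>)" and \<tau>: "(S, T, \<tau>) \<in> nat_transs G H"
      by (cases f) auto
    note t = nat_transsD[OF \<tau>]
    note [simp] = groupoid_rules[OF H] t(1,2,4-6) functor_fob[OF t(1)] functor_fob[OF t(2)]
      ginv_props[OF H] nat_trans_id[OF G H] \<tau> nat_trans_inv[OF G H \<tau>]
    \<comment> \<open>Composition in \<open>fun_gpd\<close> returns a restricted family;
      extensionality of \<open>\<tau>\<close> makes the unit laws literal equalities of
      triples.\<close>
    have ext: "(\<lambda>x\<in>gobj G. \<tau> x) = \<tau>" using t(3) by (rule extensional_restrict)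
    have "(\<lambda>x\<in>gobj G. gcomp H (\<tau> x) ((\<lambda>x\<in>gobj G. gid H (fob S x)) x)) = (\<lambda>x\<in>gobj G. \<tau> x)"
      "(\<lambda>x\<in>gobj G. gcomp H ((\<lambda>x\<in>gobj G. gid H (fob T x)) x) (\<tau> x)) = (\<lambda>x\<in>gobj G. \<tau> x)"
      by (rule restrict_ext, simp)+
    then show "gcomp ?F f (gid ?F (gdom ?F f)) = f" "gcomp ?F (gid ?F (gcod ?F f)) f = f"
      using f ext by simp_all
    let ?g = "(T, S, \<lambda>x\<in>gobj G. ginv H (\<tau> x))"
    have "(\<lambda>x\<in>gobj G. gcomp H ((\<lambda>x\<in>gobj G. ginv H (\<tau> x)) x) (\<tau> x)) =
        (\<lambda>x\<in>gobj G. gid H (fob S x))"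
      "(\<lambda>x\<in>gobj G. gcomp H (\<tau> x) ((\<lambda>x\<in>gobj G. ginv H (\<tau> x)) x)) =
        (\<lambda>x\<in>gobj G. gid H (fob T x))"
      by (rule restrict_ext, simp)+
    then show "\<exists>g\<in>garr ?F. gdom ?F g = gcod ?F f \<and> gcod ?F g = gdom ?F f \<and>
        gcomp ?F g f = gid ?F (gdom ?F f) \<and> gcomp ?F f g = gid ?F (gcod ?F f)"
      using f by (intro bexI[of _ ?g]) simp_all
  next
    fix h g f assume c: "composable ?F h g \<and> composable ?F g f"
    obtain S T \<tau> U \<sigma> V \<rho> where hgf: "h = (U, V, \<rho>)" "g = (T, U, \<sigma>)" "f = (S, T, \<tau>)"
      and \<rho>: "(U, V, \<rho>) \<in> nat_transs G H" and \<sigma>: "(T, U, \<sigma>) \<in> nat_transs G H"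
      and \<tau>: "(S, T, \<tau>) \<in> nat_transs G H"
      using c by (cases h; cases g; cases f) (auto simp: composable_fun_gpd)
    have "(\<lambda>x\<in>gobj G. gcomp H (\<rho> x) ((\<lambda>x\<in>gobj G. gcomp H (\<sigma> x) (\<tau> x)) x)) =
      (\<lambda>x\<in>gobj G. gcomp H ((\<lambda>x\<in>gobj G. gcomp H (\<rho> x) (\<sigma> x)) x) (\<tau> x))"
      using nat_transsD[OF \<rho>] nat_transsD[OF \<sigma>] nat_transsD[OF \<tau>]
      by (intro restrict_ext) (simp add: gcomp_assoc[OF H])
    then show "gcomp ?F h (gcomp ?F g f) = gcomp ?F (gcomp ?F h g) f"
      using hgf \<rho> \<sigma> \<tau> nat_trans_comp[OF G H \<rho> \<sigma>] nat_trans_comp[OF G H \<sigma> \<tau>] by simp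
  }
qed


section \<open>The self-enrichment of groupoids\<close>

text \<open>Of the two equal ways around the naturality square of \<open>\<beta>\<close> at
  \<open>\<alpha> x\<close>, this one applies \<open>T\<close> to \<open>\<alpha> x\<close> first
  and then \<open>\<beta>\<close> at the target. It is the arrow part of composition in
  \<open>Gpd_self\<close>, isolated for a single pair of arrows.\<close>

definition hcomp ::
  "('o, 'm) gpd \<Rightarrow> ('r, 's) gpd \<Rightarrow> ('p, 'q, 'r, 's) ntrans \<Rightarrow> ('o, 'm, 'p, 'q) ntrans \<Rightarrow>
    ('o, 'm, 'r, 's) ntrans" where
  "hcomp G K = (\<lambda>(T, T', \<beta>) (S, S', \<alpha>).
     (fcomp G T S, fcomp G T' S', \<lambda>x\<in>gobj G. gcomp K (\<beta> (fob S' x)) (far T (\<alpha> x))))"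

text \<open>Naturality is two squares side by side: the square of \<open>\<alpha>\<close> at
  \<open>f\<close>, pushed through \<open>T\<close>, and the square of \<open>\<beta>\<close> at the
  arrow \<open>far S' f\<close>.\<close>

lemma hcomp_in:
  assumes G: "groupoid G" and H: "groupoid H" and K: "groupoid K"
    and \<beta>: "(T, T', \<beta>) \<in> nat_transs H K" and \<alpha>: "(S, S', \<alpha>) \<in> nat_transs G H"
  shows "hcomp G K (T, T', \<beta>) (S, S', \<alpha>) \<in> nat_transs G K"
  unfolding hcomp_def prod.case
proof (rule nat_transsI)
  note b = nat_transsD[OF \<beta>] and a = nat_transsD[OF \<alpha>]
  show "is_functor G K (fcomp G T S)" "is_functor G K (fcomp G T' S')"
    using is_functor_fcomp[OF G] a b by blast+
  note [simp] = groupoid_rules[OF G] groupoid_rules[OF H] groupoid_rules[OF K] a(4-6) b(4-6)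
    functor_rules[OF b(1)] functor_rules[OF b(2)] functor_rules[OF a(1)] functor_rules[OF a(2)]
    fob_fcomp far_fcomp
  show "gcomp K (\<beta> (fob S' x)) (far T (\<alpha> x)) \<in> garr K"
    "gdom K (gcomp K (\<beta> (fob S' x)) (far T (\<alpha> x))) = fob (fcomp G T S) x"
    "gcod K (gcomp K (\<beta> (fob S' x)) (far T (\<alpha> x))) = fob (fcomp G T' S') x"
    if "x \<in> gobj G" for x
    using that by simp_all
  fix f assume [simp]: "f \<in> garr G"
  let ?x = "gdom G f" and ?y = "gcod G f"
  have "gcomp K (gcomp K (\<beta> (fob S' ?y)) (far T (\<alpha> ?y))) (far (fcomp G T S) f) =
      gcomp K (\<beta> (fob S' ?y)) (far T (gcomp H (\<alpha> ?y) (far S f)))"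
    by simp
  also have "\<dots> = gcomp K (\<beta> (fob S' ?y)) (far T (gcomp H (far S' f) (\<alpha> ?x)))"
    using nat_trans_natural[OF \<alpha>, of f] by simp
  also have "\<dots> = gcomp K (gcomp K (\<beta> (fob S' ?y)) (far T (far S' f))) (far T (\<alpha> ?x))"
    by simp
  also have "gcomp K (\<beta> (fob S' ?y)) (far T (far S' f)) =
      gcomp K (far T' (far S' f)) (\<beta> (fob S' ?x))"
    by (rule nat_trans_natural[OF \<beta>]) simp_all
  finally show "gcomp K (gcomp K (\<beta> (fob S' ?y)) (far T (\<alpha> ?y))) (far (fcomp G T S) f) =
      gcomp K (far (fcomp G T' S') f) (gcomp K (\<beta> (fob S' ?x)) (far T (\<alpha> ?x)))"
    by simp
qed (rule G)

lemma Gpd_self_simps [simp]: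
  "eob Gpd_self = {G. groupoid G}" "ehom Gpd_self = fun_gpd"
  by (simp_all add: Gpd_self_def)

lemma fob_ecomp_Gpd_self [simp]:
  "is_functor H K T \<Longrightarrow> is_functor G H S \<Longrightarrow> fob (ecomp Gpd_self G H K) (T, S) = fcomp G T S"
  by (simp add: Gpd_self_def)

lemma far_ecomp_Gpd_self [simp]:
  "b \<in> nat_transs H K \<Longrightarrow> a \<in> nat_transs G H \<Longrightarrow> far (ecomp Gpd_self G H K) (b, a) = hcomp G K b a"
  by (cases b; cases a) (simp add: Gpd_self_def hcomp_def)

lemma eunit_Gpd_self [simp]:
  "fob (eunit Gpd_self G) u = id_functor G"
  "far (eunit Gpd_self G) u = gid (fun_gpd G G) (id_functor G)"
  by (simp_all add: Gpd_self_def)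

text \<open>Preservation of composition is the interchange law between vertical and horizontal
  composition.\<close>

lemma is_functor_ecomp_Gpd_self:
  assumes G: "groupoid G" and H: "groupoid H" and K: "groupoid K"
  shows "is_functor (prod_gpd (fun_gpd H K) (fun_gpd G H)) (fun_gpd G K) (ecomp Gpd_self G H K)"
    (is "is_functor ?P ?Q ?E")
  unfolding is_functor_def
proof (intro conjI allI impI ballI)
  note hc = hcomp_in[OF G H K]
  have "fob ?E \<in> extensional (gobj ?P)" "far ?E \<in> extensional (garr ?P)"
    by (simp_all add: Gpd_self_def)
  then show "fob ?E \<in> gobj ?P \<rightarrow>\<^sub>E gobj ?Q" "far ?E \<in> garr ?P \<rightarrow>\<^sub>E garr ?Q"
    using is_functor_fcomp[OF G] hc by (auto simp: PiE_def)
  {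
    fix f assume "f \<in> garr ?P"
    then obtain T T' \<beta> S S' \<alpha> where f: "f = ((T, T', \<beta>), (S, S', \<alpha>))"
      and \<beta>: "(T, T', \<beta>) \<in> nat_transs H K" and \<alpha>: "(S, S', \<alpha>) \<in> nat_transs G H"
      by auto
    show "gdom ?Q (far ?E f) = fob ?E (gdom ?P f)" "gcod ?Q (far ?E f) = fob ?E (gcod ?P f)"
      using hc[OF \<beta> \<alpha>] nat_transsD(1,2)[OF \<beta>] nat_transsD(1,2)[OF \<alpha>] f \<alpha> \<beta>
      by (simp_all add: hcomp_def)
  next
    fix z assume "z \<in> gobj ?P"
    then obtain T S where z: "z = (T, S)" and T: "is_functor H K T" and S: "is_functor G H S"
      by auto
    show "far ?E (gid ?P z) = gid ?Q (fob ?E z)"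
      using z T S is_functor_fcomp[OF G S T] nat_trans_id[OF G H S] nat_trans_id[OF H K T]
      by (simp add: hcomp_def fob_fcomp functor_rules[OF T] functor_rules[OF S]
          groupoid_rules[OF H] groupoid_rules[OF K] cong: restrict_cong)
  next
    fix g f assume c: "composable ?P g f"
    obtain T T' T'' \<beta> \<beta>' S S' S'' \<alpha> \<alpha>' where gf: "f = ((T, T', \<beta>), (S, S', \<alpha>))"
      "g = ((T', T'', \<beta>'), (S', S'', \<alpha>'))"
      and \<beta>: "(T, T', \<beta>) \<in> nat_transs H K" and \<alpha>: "(S, S', \<alpha>) \<in> nat_transs G H"
      and \<beta>': "(T', T'', \<beta>') \<in> nat_transs H K" and \<alpha>': "(S', S'', \<alpha>') \<in> nat_transs G H"
      using c by (cases g; cases f) (auto simp: composable_prod_gpd composable_fun_gpd)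
    have cc: "composable (fun_gpd H K) (T', T'', \<beta>') (T, T', \<beta>)"
      "composable (fun_gpd G H) (S', S'', \<alpha>') (S, S', \<alpha>)"
      using \<alpha> \<alpha>' \<beta> \<beta>' by (simp_all add: composable_fun_gpd)
    note b = nat_transsD[OF \<beta>] and b' = nat_transsD[OF \<beta>']
      and a = nat_transsD[OF \<alpha>] and a' = nat_transsD[OF \<alpha>']
    note [simp] = groupoid_rules[OF H] groupoid_rules[OF K]
      a(4-6) b(4-6) a'(4-6) b'(4-6)
      functor_rules[OF b(1)] functor_rules[OF b(2)] functor_rules[OF b'(2)]
      functor_rules[OF a(1)] functor_rules[OF a(2)] functor_rules[OF a'(2)]
    have "gcomp K (gcomp K (\<beta>' (fob S'' x)) (\<beta> (fob S'' x))) (far T (gcomp H (\<alpha>' x) (\<alpha> x))) =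
        gcomp K (gcomp K (\<beta>' (fob S'' x)) (far T' (\<alpha>' x))) (gcomp K (\<beta> (fob S' x)) (far T (\<alpha> x)))"
      if [simp]: "x \<in> gobj G" for x
    proof -
      \<comment> \<open>Naturality of \<open>\<beta>\<close> at the component
        \<open>\<alpha>' x\<close> exchanges the two inner factors of the four-fold
        composite.\<close>
      have nat: "gcomp K (\<beta> (fob S'' x)) (far T (\<alpha>' x)) = gcomp K (far T' (\<alpha>' x)) (\<beta> (fob S' x))"
        by (rule nat_trans_natural[OF \<beta>]) simp_all
      have "gcomp K (gcomp K (\<beta>' (fob S'' x)) (\<beta> (fob S'' x))) (far T (gcomp H (\<alpha>' x) (\<alpha> x))) =
          gcomp K (\<beta>' (fob S'' x)) (gcomp K (gcomp K (\<beta> (fob S'' x)) (far T (\<alpha>' x))) (far T (\<alpha> x)))"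
        by simp
      also have "\<dots> = gcomp K (\<beta>' (fob S'' x))
          (gcomp K (gcomp K (far T' (\<alpha>' x)) (\<beta> (fob S' x))) (far T (\<alpha> x)))"
        by (simp only: nat)
      finally show ?thesis by simp
    qed
    then show "far ?E (gcomp ?P g f) = gcomp ?Q (far ?E g) (far ?E f)"
      using gf \<alpha> \<beta> \<alpha>' \<beta>' nat_trans_comp[OF G H \<alpha>' \<alpha>] nat_trans_comp[OF H K \<beta>' \<beta>]
        hc[OF \<beta> \<alpha>] hc[OF \<beta>' \<alpha>']
      by (simp add: gcomp_prod_gpd[OF cc] hcomp_def cong: restrict_cong)
  }
qed

text \<open>Distributing \<open>far U\<close> over a composite and reassociating in \<open>K\<close>
  turns one family of components into the other; the source and target functors agree because
  \<open>fcomp\<close> is strictly associative.\<close>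

lemma hcomp_assoc:
  assumes G: "groupoid G" and H: "groupoid H" and K: "groupoid K"
    and c: "c \<in> nat_transs H K" and b: "b \<in> nat_transs G H" and a: "a \<in> nat_transs F G"
  shows "hcomp F K (hcomp G K c b) a = hcomp F K c (hcomp F H b a)"
proof -
  obtain U U' \<gamma> T T' \<beta> S S' \<alpha> where eq: "c = (U, U', \<gamma>)" "b = (T, T', \<beta>)" "a = (S, S', \<alpha>)"
    by (metis prod_cases3)
  note c = nat_transsD[OF c[unfolded eq]] and b = nat_transsD[OF b[unfolded eq]]
    and a = nat_transsD[OF a[unfolded eq]]
  note [simp] = groupoid_rules[OF G] groupoid_rules[OF H] groupoid_rules[OF K]
    a(4-6) b(4-6) c(4-6)
    functor_rules[OF a(1)] functor_rules[OF b(1)] functor_rules[OF c(1)]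
    functor_rules[OF a(2)] functor_rules[OF b(2)] functor_rules[OF c(2)]
  show ?thesis
    unfolding eq hcomp_def prod.case
    by (simp add: fcomp_assoc[OF a(1)] fcomp_assoc[OF a(2)] far_fcomp fob_fcomp cong: restrict_cong)
qed

lemma hcomp_id_left:
  assumes H: "groupoid H" and a: "a \<in> nat_transs G H"
  shows "hcomp G H (gid (fun_gpd H H) (id_functor H)) a = a"
proof -
  obtain S S' \<alpha> where eq: "a = (S, S', \<alpha>)" by (metis prod_cases3)
  note a = nat_transsD[OF a[unfolded eq]]
  note [simp] = groupoid_rules[OF H] a(4-6) functor_rules[OF a(2)]
  show ?thesis
    using extensional_restrict[OF a(3)]
    by (simp add: eq hcomp_def is_functor_id[OF H] fcomp_id_left[OF a(1)] fcomp_id_left[OF a(2)]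
        cong: restrict_cong)
qed

lemma hcomp_id_right:
  assumes G: "groupoid G" and H: "groupoid H" and a: "a \<in> nat_transs G H"
  shows "hcomp G H a (gid (fun_gpd G G) (id_functor G)) = a"
proof -
  obtain S S' \<alpha> where eq: "a = (S, S', \<alpha>)" by (metis prod_cases3)
  note a = nat_transsD[OF a[unfolded eq]]
  note [simp] = groupoid_rules[OF H] a(4-6) functor_rules[OF a(1)]
  show ?thesis
    using extensional_restrict[OF a(3)]
    by (simp add: eq hcomp_def is_functor_id[OF G] fcomp_id_right[OF a(1)] fcomp_id_right[OF a(2)]
        cong: restrict_cong)
qed

lemma composable_unit_gpd [simp]: "composable unit_gpd a b"
  by (simp add: composable_def)

lemma is_functor_unit_gpdI:
  assumes "groupoid G" "x \<in> gobj G" "\<And>u. fob F u = x" "\<And>u. far F u = gid G x"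
  shows "is_functor unit_gpd G F"
  using assms groupoid_rules[OF assms(1)] by (simp add: is_functor_def PiE_def)

lemma gpd_enriched_category_Gpd_self:
  "gpd_enriched_category (Gpd_self :: (('o, 'm) gpd, _, _) enr_cat)"
  unfolding gpd_enriched_category_def Gpd_self_simps mem_Collect_eq Let_def
proof (intro conjI ballI; (unfold mem_Collect_eq)?)
  fix G H :: "('o, 'm) gpd" assume G: "groupoid G" and H: "groupoid H"
  show "groupoid (fun_gpd G H)" by (rule groupoid_fun_gpd[OF G H])
  let ?A = "fun_gpd G H"
  \<comment> \<open>Folding presents the domains of the projections as the objects and arrows of a
    product groupoid, which is the form that \<open>fcomp_eq_restrictI\<close> expects.\<close>
  note snd = snd_functor_def[of unit_gpd ?A, folded prod_gpd_simps(1,2)]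
    and fst = fst_functor_def[of ?A unit_gpd, folded prod_gpd_simps(1,2)]
  have id_in: "gid (fun_gpd F F) (id_functor F) \<in> nat_transs F F"
    if "groupoid F" for F :: "('o, 'm) gpd"
    using nat_trans_id[OF that that is_functor_id[OF that]] is_functor_id[OF that] by simp
  show "fcomp (prod_gpd unit_gpd ?A) (ecomp Gpd_self G H H)
      (prod_functor unit_gpd ?A (eunit Gpd_self H) (id_functor ?A)) = snd_functor unit_gpd ?A"
    \<comment> \<open>The identity transformation is kept folded as \<open>gid\<close>, so that
      \<open>hcomp_id_left\<close> matches.\<close>
    unfolding snd using is_functor_id[OF H] id_in[OF H] hcomp_id_left[OF H]
    by (intro fcomp_eq_restrictI) (auto simp: fcomp_id_left simp del: fun_gpd_simps(5))
  show "fcomp (prod_gpd ?A unit_gpd) (ecomp Gpd_self G G H)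
      (prod_functor ?A unit_gpd (id_functor ?A) (eunit Gpd_self G)) = fst_functor ?A unit_gpd"
    unfolding fst using is_functor_id[OF G] id_in[OF G] hcomp_id_right[OF G H]
    by (intro fcomp_eq_restrictI) (auto simp: fcomp_id_right simp del: fun_gpd_simps(5))
next
  show "is_functor (prod_gpd (fun_gpd H K) (fun_gpd G H)) (fun_gpd G K) (ecomp Gpd_self G H K)"
    if "groupoid G" "groupoid H" "groupoid K" for G H K :: "('o, 'm) gpd"
    using that by (rule is_functor_ecomp_Gpd_self)
next
  show "is_functor unit_gpd (fun_gpd G G) (eunit Gpd_self G)"
    if G: "groupoid G" for G :: "('o, 'm) gpd"
    by (rule is_functor_unit_gpdI[of _ "id_functor G"])
      (simp_all add: groupoid_fun_gpd[OF G G] is_functor_id[OF G])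
next
  fix W X Y Z :: "('o, 'm) gpd"
  assume g: "groupoid W" "groupoid X" "groupoid Y" "groupoid Z"
  let ?A = "fun_gpd Y Z" and ?B = "fun_gpd X Y" and ?D = "fun_gpd W X"
  let ?P = "prod_gpd (prod_gpd ?A ?B) ?D"
  show "fcomp ?P (ecomp Gpd_self W X Z)
        (prod_functor (prod_gpd ?A ?B) ?D (ecomp Gpd_self X Y Z) (id_functor ?D)) =
      fcomp ?P (ecomp Gpd_self W Y Z)
        (fcomp ?P (prod_functor ?A (prod_gpd ?B ?D) (id_functor ?A) (ecomp Gpd_self W X Y))
          (assoc_functor ?A ?B ?D))"
    using is_functor_fcomp[OF g(2), of Y _ Z] is_functor_fcomp[OF g(1), of X _ Y]
      hcomp_in[OF g(2-4)] hcomp_in[OF g(1-3)]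
    by (intro fcomp_eqI) (auto simp: fob_fcomp far_fcomp fcomp_assoc hcomp_assoc[OF g(2-4)])
qed

text \<open>\<open>T1 x\<close> is \<open>T\<close> with its first argument frozen at
  \<open>x\<close>. An arrow \<open>a\<close> gives a natural transformation because
  \<open>(a, id)\<close> after \<open>(id, b)\<close> and \<open>(id, b)\<close> after
  \<open>(a, id)\<close> are both \<open>(a, b)\<close> in the product.\<close>

lemma is_functor_curry:
  assumes G: "groupoid G" and H: "groupoid H" and K: "groupoid K"
    and T: "is_functor (prod_gpd G H) K T"
  shows "is_functor G (fun_gpd H K) (curry_functor G H T)"
proof -
  define T1 where "T1 x = \<lparr>fob = (\<lambda>y\<in>gobj H. fob T (x, y)), far = (\<lambda>b\<in>garr H. far T (gid G x, b))\<rparr>"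
    for x
  have C: "fob (curry_functor G H T) = (\<lambda>x\<in>gobj G. T1 x)"
    "far (curry_functor G H T) = (\<lambda>a\<in>garr G. (T1 (gdom G a), T1 (gcod G a),
      \<lambda>y\<in>gobj H. far T (a, gid H y)))"
    by (simp_all add: curry_functor_def Let_def T1_def)
  note [simp] = groupoid_rules[OF G] groupoid_rules[OF H] groupoid_rules[OF K]
  have Tsimps [simp]:
    "x \<in> gobj G \<Longrightarrow> y \<in> gobj H \<Longrightarrow> fob T (x, y) \<in> gobj K"
    "a \<in> garr G \<Longrightarrow> b \<in> garr H \<Longrightarrow> far T (a, b) \<in> garr K"
    "a \<in> garr G \<Longrightarrow> b \<in> garr H \<Longrightarrow> gdom K (far T (a, b)) = fob T (gdom G a, gdom H b)"
    "a \<in> garr G \<Longrightarrow> b \<in> garr H \<Longrightarrow> gcod K (far T (a, b)) = fob T (gcod G a, gcod H b)"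
    for a b x y
    using functor_rules[OF T] by auto
  have Tid [simp]: "far T (gid G x, gid H y) = gid K (fob T (x, y))"
    if "x \<in> gobj G" "y \<in> gobj H" for x y
    using functor_gid[OF T, of "(x, y)"] that by simp
  \<comment> \<open>Every composition or naturality equation below has both sides of this form, with
    the same resulting pair after cancelling identities.\<close>
  have Tcomp: "gcomp K (far T (a', b')) (far T (a, b)) = far T (gcomp G a' a, gcomp H b' b)"
    if "a \<in> garr G" "a' \<in> garr G" "b \<in> garr H" "b' \<in> garr H" "gdom G a' = gcod G a"
      "gdom H b' = gcod H b" for a a' b b'
    using functor_gcomp[OF T, of "(a', b')" "(a, b)"] that
      gcomp_prod_gpd[of G a' a H b' b] by (simp add: composable_def)
  have T1: "is_functor H K (T1 x)" if "x \<in> gobj G" for x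
    using that unfolding is_functor_def T1_def by (auto simp: composable_def Tcomp)
  have arr: "(T1 (gdom G a), T1 (gcod G a), \<lambda>y\<in>gobj H. far T (a, gid H y)) \<in> nat_transs H K"
    if "a \<in> garr G" for a
    by (rule nat_transsI) (use that in \<open>simp_all add: T1 H\<close>, simp_all add: T1_def Tcomp)
  show ?thesis
    unfolding is_functor_def
  proof (intro conjI allI impI ballI)
    show "fob (curry_functor G H T) \<in> gobj G \<rightarrow>\<^sub>E gobj (fun_gpd H K)"
      "far (curry_functor G H T) \<in> garr G \<rightarrow>\<^sub>E garr (fun_gpd H K)"
      using T1 arr by (auto simp: C)
    fix g f assume "composable G g f"
    then have gf: "g \<in> garr G" "f \<in> garr G" "gdom G g = gcod G f" by (auto simp: composable_def)
    show "far (curry_functor G H T) (gcomp G g f) =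
        gcomp (fun_gpd H K) (far (curry_functor G H T) g) (far (curry_functor G H T) f)"
      using arr[OF gf(1)] arr[OF gf(2)] gf by (simp add: C Tcomp cong: restrict_cong)
  qed (use T1 arr in \<open>auto simp: C\<close>, auto simp: T1_def cong: restrict_cong)
qed


section \<open>The fundamental groupoid on representatives\<close>

text \<open>Replaces paths by chains of edges, so that components can be treated by induction on
  single edges. The condition on \<open>a\<close> is needed for the empty chain, which exists at
  every element of the type. The converse concatenates edges as paths in \<open>G\<close>
  itself.\<close>

lemma conn_rel_iff:
  assumes G: "is_graph G"
  shows "(a, b) \<in> conn_rel G \<longleftrightarrow> a \<in> verts G \<and> (adj G)\<^sup>*\<^sup>* a b"
proof
  assume "(a, b) \<in> conn_rel G"
  then obtain n g where g: "g \<in> graph_maps (path_graph n) G" "g 0 = a" "g n = b"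
    by (auto simp: conn_rel_def)
  have "(adj G)\<^sup>*\<^sup>* (g 0) (g k)" if "k \<le> n" for k
    using that
  proof (induction k)
    case (Suc k)
    then have "adj_eq G (g k) (g (Suc k))"
      using g(1) by (simp add: graph_maps_path_graph_iff[OF G])
    then show ?case using Suc by (auto simp: adj_eq_def intro: rtranclp.rtrancl_into_rtrancl)
  qed simp
  then show "a \<in> verts G \<and> (adj G)\<^sup>*\<^sup>* a b"
    using g by (auto simp: graph_maps_path_graph_iff[OF G])
next
  assume "a \<in> verts G \<and> (adj G)\<^sup>*\<^sup>* a b"
  then have "(adj G)\<^sup>*\<^sup>* a b" and a: "a \<in> verts G" by auto
  then have "\<exists>p\<in>paths G. psrc p = a \<and> ptgt p = b"
  proof (induction rule: rtranclp_induct)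
    case base
    then show ?case using path_const_in_paths[OF G a] by (intro bexI[of _ "path_const a"]) auto
  next
    case (step b c)
    then obtain p where p: "p \<in> paths G" "psrc p = a" "ptgt p = b" by blast
    have "edge_path b c \<in> paths G"
      using step(2) G by (intro edge_path_in_paths) (auto simp: is_graph_def adj_eq_def)
    then show ?case
      using p path_concat_in_paths[OF G p(1)] ptgt_path_concat[of p "edge_path b c"]
      by (intro bexI[of _ "path_concat p (edge_path b c)"]) auto
  qed
  then show "(a, b) \<in> conn_rel G" by (auto simp: conn_rel_def paths_def)
qed

section \<open>Components of the reparametrization quotient\<close>

lemma verts_all_paths:
  "verts (all_paths X x x') = {p \<in> paths X. psrc p = x \<and> ptgt p = x'}"
  by (auto simp: all_paths_def coprod_graph_def path_space_def paths_def Let_def)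

lemma adj_all_paths:
  "adj (all_paths X x x') p q \<longleftrightarrow> p \<in> verts (all_paths X x x') \<and> q \<in> verts (all_paths X x x') \<and>
     p \<noteq> q \<and> fst p = fst q \<and> (\<forall>i\<le>fst p. adj_eq X (snd p i) (snd q i))"
  by (cases p; cases q)
    (auto simp: all_paths_def coprod_graph_def path_space_def paths_def Let_def)

lemma equiv_reparam_equiv: "equiv (verts (all_paths X x x')) (reparam_equiv X x x')"
  by (rule equivI)
    (auto simp: reparam_equiv_def Let_def refl_on_def sym_def trans_def
      intro: equivclp_sym equivclp_trans)

lemma is_graph_PN: "is_graph X \<Longrightarrow> is_graph (PN X x x')"
  using adj_eq_sym[of X]
  by (fastforce simp: PN_def quotient_graph_def is_graph_def symp_def irreflp_def adj_all_paths)

lemma reparam_equiv_imp_htpy: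
  assumes "(p, q) \<in> reparam_equiv X x x'"
  shows "htpy X p q"
proof -
  let ?V = "verts (all_paths X x x')"
  have "equivclp (\<lambda>p q. p \<in> ?V \<and> q \<in> ?V \<and> reparam p q) p q"
    using assms by (simp add: reparam_equiv_def Let_def)
  then show ?thesis
  proof (induction rule: equivclp_induct)
    case (step q r)
    then have "htpy_step X q r \<or> htpy_step X r q"
      by (auto simp: htpy_step_def verts_all_paths)
    then show ?case using step(3) htpy_stepI htpy_sym htpy_trans by metis
  qed simp
qed

abbreviation reparam_class :: "'v graph \<Rightarrow> 'v path \<Rightarrow> 'v path set" where
  "reparam_class X p \<equiv> reparam_equiv X (psrc p) (ptgt p) `` {p}"

lemma in_all_paths: "p \<in> paths X \<Longrightarrow> p \<in> verts (all_paths X (psrc p) (ptgt p))"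
  by (simp add: verts_all_paths)

lemma verts_PN: "verts (PN X x x') = verts (all_paths X x x') // reparam_equiv X x x'"
  by (simp add: PN_def quotient_graph_def)

lemma reparam_class_in_PN: "p \<in> paths X \<Longrightarrow> reparam_class X p \<in> verts (PN X (psrc p) (ptgt p))"
  unfolding verts_PN by (rule quotientI) (rule in_all_paths)

text \<open>A reparametrization makes the two classes equal, a pointwise adjacency makes them equal
  or adjacent: pointwise adjacent paths may lie in one reparametrization class, so
  \<open>adj\<close> cannot be concluded.\<close>

lemma htpy_step_imp_PN_adj_eq:
  assumes st: "htpy_step X p q"
  shows "adj_eq (PN X (psrc p) (ptgt p)) (reparam_class X p) (reparam_class X q)"
proof -
  let ?V = "verts (all_paths X (psrc p) (ptgt p))"
  have pq: "p \<in> ?V" "q \<in> ?V" "p \<in> paths X" "q \<in> paths X" "psrc q = psrc p" "ptgt q = ptgt p"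
    using st by (auto simp: htpy_step_def verts_all_paths)
  show ?thesis
  proof (cases "reparam p q")
    case True
    then have "(p, q) \<in> reparam_equiv X (psrc p) (ptgt p)"
      using pq by (auto simp: reparam_equiv_def Let_def intro!: r_into_equivclp)
    then show ?thesis
      using equiv_class_eq[OF equiv_reparam_equiv, of p q] pq by (simp add: adj_eq_def)
  next
    case False
    then have "fst p = fst q" "\<forall>i\<le>fst p. adj_eq X (snd p i) (snd q i)"
      using st by (auto simp: htpy_step_def)
    then have "p = q \<or> adj (all_paths X (psrc p) (ptgt p)) p q"
      using pq by (auto simp: adj_all_paths)
    moreover have "p \<in> reparam_class X p" "q \<in> reparam_equiv X (psrc p) (ptgt p) `` {q}"
      using equiv_class_self[OF equiv_reparam_equiv] pq(1,2) by metis+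
    ultimately show ?thesis
      using reparam_class_in_PN[OF pq(3)] reparam_class_in_PN[OF pq(4)] pq(5,6)
      by (auto simp: adj_eq_def PN_def quotient_graph_def)
  qed
qed

lemma htpy_imp_conn_rel:
  assumes X: "is_graph X" and p: "p \<in> paths X" and "htpy X p q"
  shows "(reparam_class X p, reparam_class X q) \<in> conn_rel (PN X (psrc p) (ptgt p))"
proof -
  let ?Q = "PN X (psrc p) (ptgt p)"
  have sym: "adj_eq ?Q A B \<Longrightarrow> adj_eq ?Q B A" for A B
    by (rule adj_eq_sym[OF is_graph_PN[OF X]])
  have "(adj ?Q)\<^sup>*\<^sup>* (reparam_class X p) (reparam_class X q)"
    using assms(3)
  proof (induction rule: htpy_induct)
    case (step q r)
    have e: "psrc q = psrc p" "ptgt q = ptgt p" "psrc r = psrc p" "ptgt r = ptgt p"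
      using htpy_endpoints[OF step(1) p] step(2) by (auto simp: htpy_step_def)
    have "adj_eq ?Q (reparam_class X q) (reparam_class X r)"
      using step(2) htpy_step_imp_PN_adj_eq[of X q r] htpy_step_imp_PN_adj_eq[of X r q] e sym
      by auto
    then show ?case using step(3) by (auto simp: adj_eq_def intro: rtranclp.rtrancl_into_rtrancl)
  qed simp
  then show ?thesis
    by (simp add: conn_rel_iff[OF is_graph_PN[OF X]] reparam_class_in_PN[OF p])
qed

text \<open>An edge of \<open>PN\<close> only guarantees some pair of adjacent representatives
  \<open>b\<close> and \<open>c\<close>. The chain therefore alternates between moving inside a
  class by reparametrization and crossing an edge at such a pair.\<close>

lemma conn_rel_imp_htpy:
  assumes X: "is_graph X" and "(A, B) \<in> conn_rel (PN X x x')" "p \<in> A" "q \<in> B"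
  shows "htpy X p q"
proof -
  let ?R = "reparam_equiv X x x'" and ?V = "verts (all_paths X x x')"
  have same: "htpy X a b" if "A \<in> ?V // ?R" "a \<in> A" "b \<in> A" for A a b
    using quotient_eq_iff[OF equiv_reparam_equiv that(1,1) that(2,3)]
    by (intro reparam_equiv_imp_htpy) simp
  have A: "A \<in> ?V // ?R" and "(adj (PN X x x'))\<^sup>*\<^sup>* A B"
    using assms(2) by (simp_all add: conn_rel_iff[OF is_graph_PN[OF X]] verts_PN)
  from this(2) show ?thesis
    using \<open>q \<in> B\<close>
  proof (induction arbitrary: q rule: rtranclp_induct)
    case base
    then show ?case using same[OF A \<open>p \<in> A\<close>] by blast
  next
    case (step B C)
    obtain b c where bc: "b \<in> B" "c \<in> C" "adj (all_paths X x x') b c" "C \<in> ?V // ?R"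
      using step(2) by (auto simp: PN_def quotient_graph_def)
    have "htpy X p b" by (rule step(3)[OF bc(1)])
    also have "htpy X b c"
      using bc(3) by (intro htpy_adj) (auto simp: adj_all_paths verts_all_paths)
    also have "htpy X c q" using same[OF bc(4,2)] step(4) by blast
    finally show ?case .
  qed
qed

text \<open>The bridge between the layered quotient and \<open>htpy\<close>. A path class is a set
  of reparametrization classes, hence the union to reach the paths themselves.\<close>

lemma mem_path_class_iff:
  assumes X: "is_graph X" and p: "p \<in> paths X"
  shows "q \<in> \<Union>(path_class X p) \<longleftrightarrow> htpy X p q"
proof
  assume "q \<in> \<Union>(path_class X p)"
  then obtain B where "(reparam_class X p, B) \<in> conn_rel (PN X (psrc p) (ptgt p))" "q \<in> B"
    by (auto simp: path_class_def Let_def)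
  moreover have "p \<in> reparam_class X p"
    using equiv_class_self[OF equiv_reparam_equiv] in_all_paths[OF p] by metis
  ultimately show "htpy X p q" using conn_rel_imp_htpy[OF X] by metis
next
  assume h: "htpy X p q"
  have "q \<in> reparam_class X q"
    using equiv_class_self[OF equiv_reparam_equiv] in_all_paths htpy_endpoints[OF h p] by metis
  then show "q \<in> \<Union>(path_class X p)"
    using htpy_imp_conn_rel[OF X p h] unfolding path_class_def Let_def by blast
qed

lemma path_class_eq:
  assumes X: "is_graph X" and p: "p \<in> paths X" and h: "htpy X p q"
  shows "path_class X p = path_class X q"
proof -
  have e: "q \<in> paths X" "psrc q = psrc p" "ptgt q = ptgt p"
    using htpy_endpoints[OF h p] by auto
  let ?C = "conn_rel (PN X (psrc p) (ptgt p))"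
  have tr: "(A, B) \<in> ?C \<Longrightarrow> (B, D) \<in> ?C \<Longrightarrow> (A, D) \<in> ?C" for A B D
    by (auto simp: conn_rel_iff[OF is_graph_PN[OF X]])
  have "(reparam_class X p, reparam_class X q) \<in> ?C"
    "(reparam_class X q, reparam_class X p) \<in> ?C"
    using htpy_imp_conn_rel[OF X p h] htpy_imp_conn_rel[OF X e(1) htpy_sym[OF h]] e by auto
  then show ?thesis unfolding path_class_def Let_def e using tr by blast
qed

definition parr :: "'v graph \<Rightarrow> 'v path \<Rightarrow> 'v pi1_arr" where
  "parr X p = (psrc p, ptgt p, path_class X p)"

lemma parr_eqI: "is_graph X \<Longrightarrow> p \<in> paths X \<Longrightarrow> htpy X p q \<Longrightarrow> parr X p = parr X q"
  using path_class_eq[of X p q] htpy_endpoints[of X p q] by (simp add: parr_def)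

text \<open>Every arrow has a representing path. With this, statements quantified over arrows of
  \<open>Pi1 X\<close> become statements about paths.\<close>

lemma Pi1_arrows_eq: "Pi1_arrows X = parr X ` paths X"
proof (intro equalityI subsetI)
  fix a assume "a \<in> Pi1_arrows X"
  then obtain x x' C where a: "a = (x, x', C)" "C \<in> pi0 (PN X x x')"
    by (auto simp: Pi1_arrows_def)
  then obtain p where p: "p \<in> verts (all_paths X x x')"
    "C = conn_rel (PN X x x') `` {reparam_equiv X x x' `` {p}}"
    by (auto simp: pi0_def verts_PN quotient_def)
  then have "a = parr X p" "p \<in> paths X"
    using a by (auto simp: parr_def path_class_def verts_all_paths)
  then show "a \<in> parr X ` paths X" by blast
next
  fix a assume "a \<in> parr X ` paths X"
  then obtain p where p: "p \<in> paths X" "a = parr X p" by blast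
  have "path_class X p \<in> pi0 (PN X (psrc p) (ptgt p))"
    unfolding path_class_def Let_def pi0_def by (rule quotientI) (rule reparam_class_in_PN[OF p(1)])
  then show "a \<in> Pi1_arrows X"
    using p path_verts[OF p(1)] by (simp add: Pi1_arrows_def parr_def)
qed

lemma gobj_Pi1 [simp]: "gobj (Pi1 X) = verts X"
  by (simp add: Pi1_def)

lemma garr_Pi1: "garr (Pi1 X) = parr X ` paths X"
  by (simp add: Pi1_def Pi1_arrows_eq)

lemma gdom_parr [simp]: "p \<in> paths X \<Longrightarrow> gdom (Pi1 X) (parr X p) = psrc p"
  by (simp add: Pi1_def Pi1_arrows_eq) (simp add: parr_def)

lemma gcod_parr [simp]: "p \<in> paths X \<Longrightarrow> gcod (Pi1 X) (parr X p) = ptgt p"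
  by (simp add: Pi1_def Pi1_arrows_eq) (simp add: parr_def)

lemma gid_Pi1 [simp]: "x \<in> verts X \<Longrightarrow> gid (Pi1 X) x = parr X (path_const x)"
  by (simp add: Pi1_def parr_def)

lemma composable_parr:
  "p \<in> paths X \<Longrightarrow> q \<in> paths X \<Longrightarrow> composable (Pi1 X) (parr X q) (parr X p) \<longleftrightarrow> ptgt p = psrc q"
  by (auto simp: composable_def garr_Pi1)

text \<open>By \<open>htpy_concat\<close> the union that defines composition runs over a constant
  family of classes, so it collapses to the class of the chosen representatives.\<close>

lemma gcomp_parr:
  assumes X: "is_graph X" and pq: "p \<in> paths X" "q \<in> paths X" "ptgt p = psrc q"
  shows "gcomp (Pi1 X) (parr X q) (parr X p) = parr X (path_concat p q)"
proof -
  have "path_class X (path_concat p' q') = path_class X (path_concat p q)"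
    if "p' \<in> \<Union>(path_class X p)" "q' \<in> \<Union>(path_class X q)" for p' q'
    using that mem_path_class_iff[OF X] pq
      path_class_eq[OF X path_concat_in_paths[OF X pq] htpy_concat[OF X _ _ pq]]
    by (metis (no_types))
  \<comment> \<open>The index sets must be inhabited: a union over an empty set would give the empty
    set instead of the common value.\<close>
  moreover have "p \<in> \<Union>(path_class X p)" "q \<in> \<Union>(path_class X q)"
    using mem_path_class_iff[OF X] pq by auto
  ultimately have "(\<Union>p'\<in>\<Union>(path_class X p). \<Union>q'\<in>\<Union>(path_class X q).
      path_class X (path_concat p' q')) = path_class X (path_concat p q)"
    by blast
  moreover have "parr X p \<in> Pi1_arrows X" "parr X q \<in> Pi1_arrows X"
    using pq by (auto simp: Pi1_arrows_eq)
  ultimately show ?thesis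
    using pq by (simp add: Pi1_def) (simp add: parr_def)
qed

lemma gcomp_Pi1_undefined: "\<not> composable (Pi1 X) g f \<Longrightarrow> gcomp (Pi1 X) g f = undefined"
  by (cases g; cases f) (auto simp: Pi1_def composable_def)

lemma groupoid_Pi1:
  assumes X: "is_graph X"
  shows "groupoid (Pi1 X)"
  unfolding groupoid_def
proof (intro conjI allI impI ballI)
  show "gdom (Pi1 X) \<in> garr (Pi1 X) \<rightarrow>\<^sub>E gobj (Pi1 X)" "gcod (Pi1 X) \<in> garr (Pi1 X) \<rightarrow>\<^sub>E gobj (Pi1 X)"
    by (auto simp: Pi1_def Pi1_arrows_def)
  show "gid (Pi1 X) \<in> gobj (Pi1 X) \<rightarrow>\<^sub>E garr (Pi1 X)"
    using path_const_in_paths[OF X] by (auto simp: garr_Pi1) (simp add: Pi1_def)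
next
  fix x assume "x \<in> gobj (Pi1 X)"
  then show "gdom (Pi1 X) (gid (Pi1 X) x) = x" "gcod (Pi1 X) (gid (Pi1 X) x) = x"
    using path_const_in_paths[OF X] by auto
next
  fix g f assume c: "composable (Pi1 X) g f"
  then obtain p q where p: "p \<in> paths X" "f = parr X p" and q: "q \<in> paths X" "g = parr X q"
    by (auto simp: composable_def garr_Pi1)
  then have e: "ptgt p = psrc q" using c composable_parr by blast
  show "gcomp (Pi1 X) g f \<in> garr (Pi1 X)" "gdom (Pi1 X) (gcomp (Pi1 X) g f) = gdom (Pi1 X) f"
    "gcod (Pi1 X) (gcomp (Pi1 X) g f) = gcod (Pi1 X) g"
    using p q e path_concat_in_paths[OF X p(1) q(1) e] by (auto simp: gcomp_parr[OF X] garr_Pi1)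
next
  fix f assume "f \<in> garr (Pi1 X)"
  then obtain p where p: "p \<in> paths X" "f = parr X p" by (auto simp: garr_Pi1)
  have v: "psrc p \<in> verts X" "ptgt p \<in> verts X" using p by auto
  note c = path_const_in_paths[OF X v(1)] path_const_in_paths[OF X v(2)]
  show "gcomp (Pi1 X) f (gid (Pi1 X) (gdom (Pi1 X) f)) = f"
    "gcomp (Pi1 X) (gid (Pi1 X) (gcod (Pi1 X) f)) f = f"
    using p v c path_concat_const_left[OF p(1)] path_concat_const_right[OF p(1)]
    by (simp_all add: gcomp_parr[OF X])
  let ?r = "path_rev p"
  have r: "?r \<in> paths X" by (rule path_rev_in_paths[OF X p(1)])
  \<comment> \<open>The second homotopy is the first one for the reversed path, since reversing
    twice gives \<open>p\<close> back.\<close>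
  have h: "htpy X (path_concat p ?r) (path_const (psrc p))"
    "htpy X (path_concat ?r p) (path_const (ptgt p))"
    using htpy_path_rev[OF X p(1)] htpy_path_rev[OF X r] path_rev_path_rev[OF p(1)] by auto
  have "parr X (path_concat p ?r) = parr X (path_const (psrc p))"
    "parr X (path_concat ?r p) = parr X (path_const (ptgt p))"
    using parr_eqI[OF X _ h(1)] parr_eqI[OF X _ h(2)] path_concat_in_paths[OF X] p r by auto
  then show "\<exists>g\<in>garr (Pi1 X). gdom (Pi1 X) g = gcod (Pi1 X) f \<and> gcod (Pi1 X) g = gdom (Pi1 X) f \<and>
      gcomp (Pi1 X) g f = gid (Pi1 X) (gdom (Pi1 X) f) \<and>
      gcomp (Pi1 X) f g = gid (Pi1 X) (gcod (Pi1 X) f)"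
    using p r v by (intro bexI[of _ "parr X ?r"]) (auto simp: gcomp_parr[OF X] garr_Pi1)
next
  fix h g f assume c: "composable (Pi1 X) h g \<and> composable (Pi1 X) g f"
  then obtain p q r where pqr: "p \<in> paths X" "f = parr X p" "q \<in> paths X" "g = parr X q"
      "r \<in> paths X" "h = parr X r"
    by (auto simp: composable_def garr_Pi1)
  then have "ptgt p = psrc q" "ptgt q = psrc r" using c composable_parr by blast+
  then show "gcomp (Pi1 X) h (gcomp (Pi1 X) g f) = gcomp (Pi1 X) (gcomp (Pi1 X) h g) f"
    using pqr path_concat_in_paths[OF X] by (simp add: gcomp_parr[OF X] path_concat_assoc)
qed (auto simp: gcomp_Pi1_undefined)

section \<open>Functors induced by graph maps\<close>

lemma fob_Pi1_map [simp]: "x \<in> verts X \<Longrightarrow> fob (Pi1_map X Y f) x = f x"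
  by (simp add: Pi1_map_def)

lemma far_Pi1_map:
  assumes X: "is_graph X" "is_graph Y" and f: "graph_hom X Y f" and p: "p \<in> paths X"
  shows "far (Pi1_map X Y f) (parr X p) = parr Y (path_map f p)"
proof -
  have "path_class Y (path_map f p') = path_class Y (path_map f p)"
    if "p' \<in> \<Union>(path_class X p)" for p'
    using that mem_path_class_iff[OF X(1) p]
      path_class_eq[OF X(2) path_map_in_paths[OF X f p] htpy_path_map[OF X f]]
    by (metis (no_types))
  moreover have "p \<in> \<Union>(path_class X p)" using mem_path_class_iff[OF X(1) p] by auto
  ultimately have "(\<Union>p'\<in>\<Union>(path_class X p). path_class Y (path_map f p')) =
      path_class Y (path_map f p)"
    by blast
  moreover have "parr X p \<in> Pi1_arrows X" using p by (auto simp: Pi1_arrows_eq)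
  ultimately show ?thesis
    by (simp add: Pi1_map_def) (simp add: parr_def)
qed

lemma is_functor_Pi1_map:
  assumes X: "is_graph X" "is_graph Y" and f: "graph_hom X Y f"
  shows "is_functor (Pi1 X) (Pi1 Y) (Pi1_map X Y f)"
  unfolding is_functor_def
proof (intro conjI allI impI ballI)
  note far = far_Pi1_map[OF X f] and pm = path_map_in_paths[OF X f]
  show "fob (Pi1_map X Y f) \<in> gobj (Pi1 X) \<rightarrow>\<^sub>E gobj (Pi1 Y)"
    using f by (auto simp: Pi1_map_def graph_hom_def)
  have "far (Pi1_map X Y f) \<in> extensional (garr (Pi1 X))"
    by (simp add: Pi1_map_def Pi1_def)
  then show "far (Pi1_map X Y f) \<in> garr (Pi1 X) \<rightarrow>\<^sub>E garr (Pi1 Y)"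
    using pm by (auto simp: PiE_def garr_Pi1 far)
  {
    fix a assume "a \<in> garr (Pi1 X)"
    then obtain p where p: "p \<in> paths X" "a = parr X p" by (auto simp: garr_Pi1)
    then show "gdom (Pi1 Y) (far (Pi1_map X Y f) a) = fob (Pi1_map X Y f) (gdom (Pi1 X) a)"
      "gcod (Pi1 Y) (far (Pi1_map X Y f) a) = fob (Pi1_map X Y f) (gcod (Pi1 X) a)"
      using pm[OF p(1)] path_verts[OF p(1)] by (auto simp: far)
  next
    fix x assume "x \<in> gobj (Pi1 X)"
    then show "far (Pi1_map X Y f) (gid (Pi1 X) x) = gid (Pi1 Y) (fob (Pi1_map X Y f) x)"
      using f path_const_in_paths[OF X(1)]
      by (auto simp: far path_map_const graph_hom_def Pi_def)
  next
    fix g a assume c: "composable (Pi1 X) g a"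
    then obtain p q where p: "p \<in> paths X" "a = parr X p" and q: "q \<in> paths X" "g = parr X q"
      by (auto simp: composable_def garr_Pi1)
    then have e: "ptgt p = psrc q" using c composable_parr by blast
    show "far (Pi1_map X Y f) (gcomp (Pi1 X) g a) =
        gcomp (Pi1 Y) (far (Pi1_map X Y f) g) (far (Pi1_map X Y f) a)"
      using p q e path_concat_in_paths[OF X(1) p(1) q(1) e] pm
      by (simp add: gcomp_parr X far path_map_concat)
  }
qed


section \<open>The box product\<close>

lemma is_graph_box: "is_graph X \<Longrightarrow> is_graph Y \<Longrightarrow> is_graph (box X Y)"
  by (auto simp: is_graph_def box_def symp_def irreflp_def)

lemma verts_box [simp]: "verts (box X Y) = verts X \<times> verts Y"
  by (simp add: box_def)

lemma graph_hom_box_left: "y \<in> verts Y \<Longrightarrow> graph_hom X (box X Y) (\<lambda>x. (x, y))"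
  by (auto simp: graph_hom_def adj_eq_def box_def)

lemma graph_hom_box_right: "x \<in> verts X \<Longrightarrow> graph_hom Y (box X Y) (\<lambda>y. (x, y))"
  by (auto simp: graph_hom_def adj_eq_def box_def)

text \<open>Pastes two squares that commute up to homotopy along their common side \<open>b\<close>.
  It is the induction step of the interchange law in each of the two directions of the box.\<close>

lemma htpy_paste:
  assumes X: "is_graph X"
    and sq: "htpy X (path_concat a u) (path_concat v b)" "htpy X (path_concat b w) (path_concat z c)"
    and "a \<in> paths X" "b \<in> paths X" "c \<in> paths X" "u \<in> paths X" "v \<in> paths X" "w \<in> paths X"
      "z \<in> paths X"
    and "ptgt a = psrc u" "ptgt v = psrc b" "ptgt b = ptgt u" "ptgt b = psrc w" "psrc z = psrc b"
      "ptgt z = psrc c"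
  shows "htpy X (path_concat a (path_concat u w)) (path_concat (path_concat v z) c)"
proof -
  note [simp] = path_concat_in_paths[OF X] path_concat_assoc assms
  have "htpy X (path_concat (path_concat a u) w) (path_concat (path_concat v b) w)"
    using assms by (intro htpy_concat_left) auto
  moreover have "htpy X (path_concat v (path_concat b w)) (path_concat v (path_concat z c))"
    using assms by (intro htpy_concat_right) auto
  ultimately show ?thesis by (simp, metis htpy_trans)
qed

text \<open>The two ways around a square are not pointwise adjacent, but they become so after a stutter
  at the end of the first one and at the beginning of the second one.\<close>

lemma htpy_box_square:
  assumes X: "is_graph X" and Y: "is_graph Y"
    and x: "x \<in> verts X" "x' \<in> verts X" "adj_eq X x x'"
    and y: "y \<in> verts Y" "y' \<in> verts Y" "adj_eq Y y y'"
  shows "htpy (box X Y) (path_concat (edge_path (x, y) (x', y)) (edge_path (x', y) (x', y')))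
     (path_concat (edge_path (x, y) (x, y')) (edge_path (x, y') (x', y')))"
    (is "htpy ?B ?p ?q")
proof -
  note B = is_graph_box[OF X Y]
  have h: "adj_eq ?B (x, b) (x', b)" if "b \<in> verts Y" for b
    using x(3) that by (auto simp: adj_eq_def box_def)
  have v: "adj_eq ?B (a, y) (a, y')" if "a \<in> verts X" for a
    using y(3) that by (auto simp: adj_eq_def box_def)
  \<comment> \<open>At times 1 and 2 the stuttered paths differ only in the first coordinate, over
    \<open>y\<close> and over \<open>y'\<close>. Without the stutter \<open>(x', y)\<close> would
    face \<open>(x, y')\<close> at time 1, a diagonal that need not be an edge of the box
    product.\<close>
  let ?p' = "mk_path 3 (\<lambda>i. if i = 0 then (x, y) else if i = 1 then (x', y) else (x', y'))"
  let ?q' = "mk_path 3 (\<lambda>i. if i \<le> 1 then (x, y) else if i = 2 then (x, y') else (x', y'))"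
  have p: "?p \<in> paths ?B" and q: "?q \<in> paths ?B"
    using x y h v by (auto intro!: path_concat_in_paths[OF B] edge_path_in_paths[OF B])
  \<comment> \<open>\<open>min i 2\<close> repeats the final time of the first path; below,
    truncated subtraction \<open>i - 1\<close> repeats the initial time of the second.\<close>
  have p': "reparam ?p ?p'"
    by (rule reparam_mk_path[where s = "\<lambda>i. min i 2"]) (auto simp: path_concat_alt edge_path_def)
  have q': "reparam ?q ?q'"
    by (rule reparam_mk_path[where s = "\<lambda>i. i - 1"]) (auto simp: path_concat_alt edge_path_def)
  have "htpy ?B ?p' ?q'"
    using reparam_in_paths[OF B p p'] reparam_in_paths[OF B q q'] x y
    by (intro htpy_adj) (auto intro!: h v adj_eq_sym[OF B h])
  then show ?thesis
    by (intro htpy_trans[OF htpy_reparam[OF B p p']] htpy_trans[OF _ htpy_sym[OF htpy_reparam[OF B q q']]])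
qed

lemma htpy_box_edge:
  assumes X: "is_graph X" and Y: "is_graph Y"
    and x: "x \<in> verts X" "x' \<in> verts X" "adj_eq X x x'" and q: "q \<in> paths Y"
  shows "htpy (box X Y)
     (path_concat (edge_path (x, psrc q) (x', psrc q)) (path_map (\<lambda>y. (x', y)) q))
     (path_concat (path_map (\<lambda>y. (x, y)) q) (edge_path (x, ptgt q) (x', ptgt q)))"
proof -
  note B = is_graph_box[OF X Y]
  have e: "edge_path (x, y) (x', y) \<in> paths (box X Y)" if "y \<in> verts Y" for y
    using edge_path_in_paths[OF X x] path_map_in_paths[OF X B graph_hom_box_left[OF that]]
    by (metis path_map_edge)
  note pm = path_map_in_paths[OF Y B graph_hom_box_right[OF x(1)]]
    path_map_in_paths[OF Y B graph_hom_box_right[OF x(2)]]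
  show ?thesis using Y q
  proof (induction q rule: path_induct)
    case (const y)
    then show ?case using e[OF const]
      by (simp add: path_map_const path_concat_const_left path_concat_const_right)
  next
    case (snoc q y)
    have f: "edge_path (ptgt q) y \<in> paths Y" using snoc by (intro edge_path_in_paths Y) auto
    have v: "psrc q \<in> verts Y" "ptgt q \<in> verts Y" using snoc by auto
    have "htpy (box X Y)
       (path_concat (edge_path (x, psrc q) (x', psrc q))
         (path_concat (path_map (\<lambda>y. (x', y)) q) (path_map (\<lambda>y. (x', y)) (edge_path (ptgt q) y))))
       (path_concat (path_concat (path_map (\<lambda>y. (x, y)) q)
           (path_map (\<lambda>y. (x, y)) (edge_path (ptgt q) y)))
         (edge_path (x, y) (x', y)))"
      by (rule htpy_paste[OF B snoc.IH])
        (use snoc f v e pm pm[OF f] htpy_box_square[OF X Y x v(2)] in \<open>simp_all add: path_map_edge\<close>)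
    then show ?case
      using ptgt_path_concat[of q "edge_path (ptgt q) y"] by (simp add: path_map_concat)
  qed
qed

definition path_mu :: "'v path \<Rightarrow> 'w path \<Rightarrow> ('v \<times> 'w) path" where
  "path_mu p q = path_concat (path_map (\<lambda>x. (x, psrc q)) p) (path_map (\<lambda>y. (ptgt p, y)) q)"

lemma htpy_box_interchange:
  assumes X: "is_graph X" and Y: "is_graph Y" and p: "p \<in> paths X" and q: "q \<in> paths Y"
  shows "htpy (box X Y) (path_mu p q)
    (path_concat (path_map (\<lambda>y. (psrc p, y)) q) (path_map (\<lambda>x. (x, ptgt q)) p))"
proof -
  note B = is_graph_box[OF X Y]
  have v: "psrc q \<in> verts Y" "ptgt q \<in> verts Y" using q by auto
  note pm = path_map_in_paths[OF X B graph_hom_box_left[OF v(1)]]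
    path_map_in_paths[OF X B graph_hom_box_left[OF v(2)]]
  have qm: "path_map (\<lambda>y. (x, y)) q \<in> paths (box X Y)" if "x \<in> verts X" for x
    by (rule path_map_in_paths[OF Y B graph_hom_box_right[OF that] q])
  \<comment> \<open>Proved in the opposite direction, because \<open>htpy_paste\<close> lengthens
    the second factor on its left side and the first factor on its right side, and these have to be
    the two copies of \<open>p\<close>.\<close>
  have "htpy (box X Y) (path_concat (path_map (\<lambda>y. (psrc p, y)) q) (path_map (\<lambda>x. (x, ptgt q)) p))
    (path_mu p q)"
    using X p
  proof (induction p rule: path_induct)
    case (const x)
    then show ?case using qm[OF const]
      by (simp add: path_mu_def path_map_const path_concat_const_left path_concat_const_right)
  next
    case (snoc p x)
    have f: "edge_path (ptgt p) x \<in> paths X" using snoc by (intro edge_path_in_paths X) auto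
    have w: "psrc p \<in> verts X" "ptgt p \<in> verts X" using snoc by auto
    have "htpy (box X Y)
       (path_concat (path_map (\<lambda>y. (psrc p, y)) q)
         (path_concat (path_map (\<lambda>x. (x, ptgt q)) p)
           (path_map (\<lambda>x. (x, ptgt q)) (edge_path (ptgt p) x))))
       (path_concat (path_concat (path_map (\<lambda>x. (x, psrc q)) p)
           (path_map (\<lambda>x. (x, psrc q)) (edge_path (ptgt p) x)))
         (path_map (\<lambda>y. (x, y)) q))"
      by (rule htpy_paste[OF B snoc.IH[unfolded path_mu_def]])
        (use snoc f w v qm pm pm[OF f] htpy_sym[OF htpy_box_edge[OF X Y w(2) snoc(2,3) q]]
          in \<open>simp_all add: path_map_edge\<close>)
    then show ?case
      using ptgt_path_concat[of p "edge_path (ptgt p) x"] by (simp add: path_mu_def path_map_concat)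
  qed
  then show ?thesis by (rule htpy_sym)
qed

section \<open>Functoriality of the monoidal comparison\<close>

lemma path_mu_in_paths:
  assumes X: "is_graph X" "is_graph Y" and p: "p \<in> paths X" "q \<in> paths Y"
  shows "path_mu p q \<in> paths (box X Y)"
  unfolding path_mu_def
  using p path_map_in_paths[OF X(1) is_graph_box[OF X] graph_hom_box_left p(1)]
    path_map_in_paths[OF X(2) is_graph_box[OF X] graph_hom_box_right p(2)]
  by (intro path_concat_in_paths is_graph_box[OF X]) simp_all

lemma path_mu_simps [simp]:
  "psrc (path_mu p q) = (psrc p, psrc q)" "ptgt (path_mu p q) = (ptgt p, ptgt q)"
  using ptgt_path_concat[of "path_map (\<lambda>x. (x, psrc q)) p" "path_map (\<lambda>y. (ptgt p, y)) q"]
  by (simp_all add: path_mu_def)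

lemma far_Pi1_mu:
  assumes X: "is_graph X" "is_graph Y" and p: "p \<in> paths X" and q: "q \<in> paths Y"
  shows "far (Pi1_mu X Y) (parr X p, parr Y q) = parr (box X Y) (path_mu p q)"
proof -
  note B = is_graph_box[OF X]
  have v: "psrc q \<in> verts Y" "ptgt p \<in> verts X" using p q by auto
  have hom: "graph_hom X (box X Y) (\<lambda>x\<in>verts X. (x, psrc q))"
    "graph_hom Y (box X Y) (\<lambda>y\<in>verts Y. (ptgt p, y))"
    using v X
    by (auto intro!: graph_maps_imp_hom graph_hom_restrict graph_hom_box_left graph_hom_box_right)
  have eq: "path_map (\<lambda>x\<in>verts X. (x, psrc q)) p = path_map (\<lambda>x. (x, psrc q)) p"
    "path_map (\<lambda>y\<in>verts Y. (ptgt p, y)) q = path_map (\<lambda>y. (ptgt p, y)) q"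
    using path_map_cong[OF p, of "\<lambda>x\<in>verts X. (x, psrc q)"]
      path_map_cong[OF q, of "\<lambda>y\<in>verts Y. (ptgt p, y)"] by auto
  have "parr X p \<in> Pi1_arrows X" "parr Y q \<in> Pi1_arrows Y"
    using p q by (auto simp: Pi1_arrows_eq)
  then have "far (Pi1_mu X Y) (parr X p, parr Y q) = gcomp (Pi1 (box X Y))
      (far (Pi1_map Y (box X Y) (\<lambda>y\<in>verts Y. (ptgt p, y))) (parr Y q))
      (far (Pi1_map X (box X Y) (\<lambda>x\<in>verts X. (x, psrc q))) (parr X p))"
    using p q by (simp add: Pi1_mu_def)
  also have "\<dots> = parr (box X Y) (path_mu p q)"
    using far_Pi1_map[OF X(1) B hom(1) p] far_Pi1_map[OF X(2) B hom(2) q]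
      path_map_in_paths[OF X(1) B hom(1) p] path_map_in_paths[OF X(2) B hom(2) q]
    by (simp add: eq path_mu_def gcomp_parr[OF B])
  finally show ?thesis .
qed

text \<open>The left side runs through \<open>p\<close>, \<open>p'\<close>, \<open>q\<close>,
  \<open>q'\<close> and the right side through \<open>p\<close>, \<open>q\<close>,
  \<open>p'\<close>, \<open>q'\<close>; one interchange swaps the two middle paths.\<close>

lemma htpy_path_mu_concat:
  assumes X: "is_graph X" and Y: "is_graph Y"
    and p: "p \<in> paths X" "p' \<in> paths X" "ptgt p = psrc p'"
    and q: "q \<in> paths Y" "q' \<in> paths Y" "ptgt q = psrc q'"
  shows "htpy (box X Y) (path_mu (path_concat p p') (path_concat q q'))
    (path_concat (path_mu p q) (path_mu p' q'))"
proof -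
  note B = is_graph_box[OF X Y]
  let ?l = "\<lambda>y. path_map (\<lambda>x. (x, y))" and ?r = "\<lambda>x. path_map (\<lambda>y. (x, y))"
  have l: "?l y p \<in> paths (box X Y)" if "y \<in> verts Y" "p \<in> paths X" for y p
    using that path_map_in_paths[OF X B graph_hom_box_left] by blast
  have r: "?r x q \<in> paths (box X Y)" if "x \<in> verts X" "q \<in> paths Y" for x q
    using that path_map_in_paths[OF Y B graph_hom_box_right] by blast
  have v: "psrc q \<in> verts Y" "ptgt q \<in> verts Y" "psrc p' \<in> verts X" "ptgt p' \<in> verts X"
     "psrc q' \<in> verts Y"
    using p q by auto
  note cc = path_concat_in_paths[OF B]
  have "path_mu (path_concat p p') (path_concat q q') =
      path_concat (?l (psrc q) p) (path_concat (path_mu p' q) (?r (ptgt p') q'))"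
    using p q by (simp add: path_mu_def path_map_concat path_concat_assoc)
  also have "htpy (box X Y) \<dots> (path_concat (?l (psrc q) p)
      (path_concat (path_concat (?r (psrc p') q) (?l (ptgt q) p')) (?r (ptgt p') q')))"
  proof (rule htpy_concat_right[OF B htpy_concat_left[OF B htpy_box_interchange[OF X Y p(2) q(1)]]])
    show "path_mu p' q \<in> paths (box X Y)" by (rule path_mu_in_paths[OF X Y p(2) q(1)])
    then show "path_concat (path_mu p' q) (?r (ptgt p') q') \<in> paths (box X Y)"
      using r[OF v(4) q(2)] q(3) by (intro cc) simp_all
  qed (use l r v p q in simp_all)
  also have "\<dots> = path_concat (path_mu p q) (path_mu p' q')"
    using p q by (simp add: path_mu_def path_concat_assoc)
  finally show ?thesis .
qed

lemma is_functor_Pi1_mu: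
  assumes X: "is_graph X" and Y: "is_graph Y"
  shows "is_functor (prod_gpd (Pi1 X) (Pi1 Y)) (Pi1 (box X Y)) (Pi1_mu X Y)"
  unfolding is_functor_def
proof (intro conjI allI impI ballI)
  let ?P = "prod_gpd (Pi1 X) (Pi1 Y)" and ?B = "Pi1 (box X Y)"
  note B = is_graph_box[OF X Y] and far = far_Pi1_mu[OF X Y] and mu = path_mu_in_paths[OF X Y]
  show "fob (Pi1_mu X Y) \<in> gobj ?P \<rightarrow>\<^sub>E gobj ?B"
    by (auto simp: Pi1_mu_def)
  have "far (Pi1_mu X Y) \<in> extensional (garr ?P)"
    by (simp add: Pi1_mu_def Pi1_arrows_eq garr_Pi1)
  then show "far (Pi1_mu X Y) \<in> garr ?P \<rightarrow>\<^sub>E garr ?B"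
    using mu by (auto simp: PiE_def garr_Pi1 far)
  {
    fix f assume "f \<in> garr ?P"
    then obtain p q where pq: "p \<in> paths X" "q \<in> paths Y" "f = (parr X p, parr Y q)"
      by (auto simp: garr_Pi1)
    then show "gdom ?B (far (Pi1_mu X Y) f) = fob (Pi1_mu X Y) (gdom ?P f)"
      "gcod ?B (far (Pi1_mu X Y) f) = fob (Pi1_mu X Y) (gcod ?P f)"
      using mu[OF pq(1,2)] path_verts[OF pq(1)] path_verts[OF pq(2)]
      by (auto simp: far garr_Pi1 Pi1_mu_def[THEN arg_cong[of _ _ fob]])
  next
    fix z assume "z \<in> gobj ?P"
    then obtain x y where z: "z = (x, y)" "x \<in> verts X" "y \<in> verts Y" by auto
    then show "far (Pi1_mu X Y) (gid ?P z) = gid ?B (fob (Pi1_mu X Y) z)"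
      using path_const_in_paths[OF X, of x] path_const_in_paths[OF Y, of y]
        path_const_in_paths[OF B, of "(x, y)"]
      by (simp add: far Pi1_mu_def[THEN arg_cong[of _ _ fob]] path_mu_def path_map_const
          path_concat_const_right)
  next
    fix g f assume c: "composable ?P g f"
    obtain p q p' q' where pq: "p \<in> paths X" "q \<in> paths Y" "f = (parr X p, parr Y q)"
      "p' \<in> paths X" "q' \<in> paths Y" "g = (parr X p', parr Y q')"
      using c by (auto simp: composable_def garr_Pi1)
    then have c': "composable (Pi1 X) (parr X p') (parr X p)"
      "composable (Pi1 Y) (parr Y q') (parr Y q)"
      using c composable_prod_gpd by metis+
    then have e: "ptgt p = psrc p'" "ptgt q = psrc q'" using pq composable_parr by blast+
    note h = htpy_path_mu_concat[OF X Y pq(1,4) e(1) pq(2,5) e(2)]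
    note cc = path_concat_in_paths[OF X pq(1,4) e(1)] path_concat_in_paths[OF Y pq(2,5) e(2)]
    show "far (Pi1_mu X Y) (gcomp ?P g f) = gcomp ?B (far (Pi1_mu X Y) g) (far (Pi1_mu X Y) f)"
      using c' pq e cc mu parr_eqI[OF B mu[OF cc] h]
      by (simp add: gcomp_prod_gpd far gcomp_parr X Y B)
  }
qed


section \<open>Internal homs of graphs\<close>

lemma is_graph_ihom: "is_graph Y \<Longrightarrow> is_graph (ihom X Y)"
  using adj_eq_sym[of Y] by (auto simp: is_graph_def ihom_def symp_def irreflp_def)

lemma verts_ihom [simp]: "verts (ihom X Y) = graph_maps X Y"
  by (simp add: ihom_def)

text \<open>Passing to \<open>adj_eq\<close> absorbs the distinctness clause of \<open>ihom\<close>
  and leaves a purely pointwise condition.\<close>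

lemma adj_eq_ihom_iff:
  "f \<in> graph_maps X Y \<Longrightarrow> g \<in> graph_maps X Y \<Longrightarrow>
    adj_eq (ihom X Y) f g \<longleftrightarrow> (\<forall>x\<in>verts X. adj_eq Y (f x) (g x))"
  unfolding adj_eq_def[of "ihom X Y"] by (auto simp: ihom_def)

lemma adj_ihomD: "adj (ihom X Y) f g \<Longrightarrow> x \<in> verts X \<Longrightarrow> adj_eq Y (f x) (g x)"
  and adj_ihom_in: "adj (ihom X Y) f g \<Longrightarrow> f \<in> graph_maps X Y \<and> g \<in> graph_maps X Y"
  by (auto simp: ihom_def)

lemma graph_maps_verts: "f \<in> graph_maps X Y \<Longrightarrow> x \<in> verts X \<Longrightarrow> f x \<in> verts Y"
  by (auto simp: graph_maps_def)

lemma graph_maps_ext: "f \<in> graph_maps X Y \<Longrightarrow> f \<in> extensional (verts X)"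
  by (auto simp: graph_maps_def PiE_def)

lemma graph_maps_adj_eq: "f \<in> graph_maps X Y \<Longrightarrow> adj_eq X x y \<Longrightarrow> adj_eq Y (f x) (f y)"
  by (rule graph_hom_adj_eq[OF graph_maps_imp_hom])

lemma compose_in_graph_maps:
  assumes "is_graph X" "g \<in> graph_maps Y Z" "f \<in> graph_maps X Y"
  shows "compose (verts X) g f \<in> graph_maps X Z"
  unfolding compose_def
  by (rule graph_hom_restrict[OF assms(1)])
    (use assms graph_maps_adj_eq[OF assms(2)] in \<open>auto simp: graph_hom_def graph_maps_def\<close>)

lemma compose_assoc_graph_maps:
  "f \<in> graph_maps W X \<Longrightarrow>
    compose (verts W) (compose (verts X) h g) f = compose (verts W) h (compose (verts W) g f)"
  by (auto simp: compose_def graph_maps_verts intro!: restrict_ext)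

lemma graph_id_in: "is_graph X \<Longrightarrow> graph_id X \<in> graph_maps X X"
  unfolding graph_id_def by (rule graph_hom_restrict) (auto simp: graph_hom_def adj_eq_def)

lemma compose_graph_id:
  assumes "f \<in> graph_maps X Y"
  shows "compose (verts X) f (graph_id X) = f" "compose (verts X) (graph_id Y) f = f"
  using graph_maps_ext[OF assms] graph_maps_verts[OF assms]
  by (auto simp: compose_def graph_id_def extensional_def)

text \<open>An edge of the box moves only one of the two maps: either \<open>g\<close> moves and is
  compared at the point \<open>f x\<close>, or \<open>f\<close> moves and \<open>g\<close> carries
  the edge along. Moving both at once could take two steps in \<open>Z\<close>.\<close>

lemma graph_hom_hom_comp:
  assumes X: "is_graph X"
  shows "graph_hom (box (ihom Y Z) (ihom X Y)) (ihom X Z) (hom_comp X Y Z)"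
  unfolding graph_hom_def
proof (intro conjI allI impI)
  show "hom_comp X Y Z \<in> verts (box (ihom Y Z) (ihom X Y)) \<rightarrow> verts (ihom X Z)"
    using compose_in_graph_maps[OF X] by (auto simp: hom_comp_def)
  fix u v assume uv: "adj (box (ihom Y Z) (ihom X Y)) u v"
  obtain g f g' f' where eq: "u = (g, f)" "v = (g', f')" by (metis surj_pair)
  have c: "adj (ihom Y Z) g g' \<and> f = f' \<and> f \<in> graph_maps X Y \<or>
      g = g' \<and> g \<in> graph_maps Y Z \<and> adj (ihom X Y) f f'"
    using uv by (simp add: eq box_def ihom_def)
  then have m: "g \<in> graph_maps Y Z" "g' \<in> graph_maps Y Z" "f \<in> graph_maps X Y" "f' \<in> graph_maps X Y"
    using adj_ihom_in by metis+
  have "adj_eq Z (g (f x)) (g' (f' x))" if "x \<in> verts X" for x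
    using c that m graph_maps_verts[OF m(3) that] adj_ihomD graph_maps_adj_eq[OF m(1)] by metis
  then show "adj_eq (ihom X Z) (hom_comp X Y Z u) (hom_comp X Y Z v)"
    using m compose_in_graph_maps[OF X m(1,3)] compose_in_graph_maps[OF X m(2,4)]
    by (simp add: eq hom_comp_def adj_eq_ihom_iff compose_eq)
qed

lemma graph_hom_hom_unit: "is_graph X \<Longrightarrow> graph_hom (path_graph 0) (ihom X X) (hom_unit X)"
  using graph_id_in by (auto simp: graph_hom_def hom_unit_def path_graph_def)

lemma graph_hom_hom_eval:
  assumes X: "is_graph X"
  shows "graph_hom (box (ihom X Y) X) Y (hom_eval X Y)"
  unfolding graph_hom_def
proof (intro conjI allI impI)
  show "hom_eval X Y \<in> verts (box (ihom X Y) X) \<rightarrow> verts Y"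
    using graph_maps_verts by (fastforce simp: hom_eval_def)
  fix u v assume uv: "adj (box (ihom X Y) X) u v"
  obtain f x f' x' where eq: "u = (f, x)" "v = (f', x')" by (metis surj_pair)
  have c: "adj (ihom X Y) f f' \<and> x = x' \<and> x \<in> verts X \<or>
      f = f' \<and> f \<in> graph_maps X Y \<and> adj X x x'"
    using uv by (simp add: eq box_def ihom_def)
  then have m: "f \<in> graph_maps X Y" "f' \<in> graph_maps X Y" "x \<in> verts X" "x' \<in> verts X"
    using adj_ihom_in X by (auto simp: is_graph_def)
  show "adj_eq Y (hom_eval X Y u) (hom_eval X Y v)"
    using c m adj_ihomD[of X Y f f' x] graph_maps_adj_eq[of f X Y x x']
    by (auto simp: eq hom_eval_def adj_eq_def[of X])
qed

text \<open>Turns a path of graph maps into a path in \<open>Y\<close>, the trace of the vertex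
  \<open>x\<close>; these traces are the components of the natural transformation attached to the
  path.\<close>

lemma graph_hom_ihom_eval_at: "x \<in> verts X \<Longrightarrow> graph_hom (ihom X Y) Y (\<lambda>f. f x)"
  using graph_maps_verts adj_ihomD by (fastforce simp: graph_hom_def)

section \<open>The enrichment\<close>

lemma Pi1_map_id: "is_graph X \<Longrightarrow> Pi1_map X X (graph_id X) = id_functor (Pi1 X)"
proof (rule gfun_eqI)
  assume X: "is_graph X"
  note hom = graph_maps_imp_hom[OF graph_id_in[OF X]]
  show "fob (Pi1_map X X (graph_id X)) = fob (id_functor (Pi1 X))"
    by (auto simp: Pi1_map_def id_functor_def graph_id_def)
  have "far (Pi1_map X X (graph_id X)) a = a" if "a \<in> garr (Pi1 X)" for a
  proof -
    obtain p where p: "p \<in> paths X" "a = parr X p" using \<open>a \<in> garr (Pi1 X)\<close> by (auto simp: garr_Pi1)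
    have "path_map (graph_id X) p = p" by (rule path_map_ident[OF p(1)]) (simp add: graph_id_def)
    then show ?thesis using p by (simp add: far_Pi1_map[OF X X hom])
  qed
  then show "far (Pi1_map X X (graph_id X)) = far (id_functor (Pi1 X))"
    using functor_far_ext[OF is_functor_Pi1_map[OF X X hom]]
    by (auto simp: id_functor_def extensional_def)
qed

lemma Pi1_map_compose:
  assumes X: "is_graph X" "is_graph Y" "is_graph Z" and g: "g \<in> graph_maps Y Z" and f: "f \<in> graph_maps X Y"
  shows "fcomp (Pi1 X) (Pi1_map Y Z g) (Pi1_map X Y f) = Pi1_map X Z (compose (verts X) g f)"
proof (rule gfun_eqI)
  note hom = graph_maps_imp_hom[OF g] graph_maps_imp_hom[OF f]
    graph_maps_imp_hom[OF compose_in_graph_maps[OF X(1) g f]]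
  show "fob (fcomp (Pi1 X) (Pi1_map Y Z g) (Pi1_map X Y f)) = fob (Pi1_map X Z (compose (verts X) g f))"
    using graph_maps_verts[OF f] by (auto simp: Pi1_map_def fcomp_def compose_def)
  have "far (Pi1_map Y Z g) (far (Pi1_map X Y f) a) = far (Pi1_map X Z (compose (verts X) g f)) a"
    if "a \<in> garr (Pi1 X)" for a
  proof -
    obtain p where p: "p \<in> paths X" "a = parr X p" using \<open>a \<in> garr (Pi1 X)\<close> by (auto simp: garr_Pi1)
    have "path_map g (path_map f p) = path_map (compose (verts X) g f) p"
      unfolding path_map_path_map by (rule path_map_cong[OF p(1)]) (simp add: compose_eq)
    then show ?thesis
      using p path_map_in_paths[OF X(1,2) hom(2) p(1)]
      by (simp add: far_Pi1_map[OF X(1,2) hom(2)] far_Pi1_map[OF X(2,3) hom(1)]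
          far_Pi1_map[OF X(1,3) hom(3)])
  qed
  then show "far (fcomp (Pi1 X) (Pi1_map Y Z g) (Pi1_map X Y f)) = far (Pi1_map X Z (compose (verts X) g f))"
    using functor_far_ext[OF is_functor_Pi1_map[OF X(1,3) hom(3)]]
    by (auto simp: fcomp_def compose_def extensional_def)
qed

lemma Graph_enriched_simps [simp]:
  "eob Graph_enriched = {X. is_graph X}" "ehom Graph_enriched X Y = Pi1 (ihom X Y)"
  by (simp_all add: Graph_enriched_def)

lemma is_functor_ecomp_Graph:
  assumes X: "is_graph X" and Y: "is_graph Y" and Z: "is_graph Z"
  shows "is_functor (prod_gpd (Pi1 (ihom Y Z)) (Pi1 (ihom X Y))) (Pi1 (ihom X Z))
    (ecomp Graph_enriched X Y Z)"
proof -
  note h = is_graph_ihom[OF Z, of Y] is_graph_ihom[OF Y, of X] is_graph_ihom[OF Z, of X]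
  show ?thesis
    unfolding Graph_enriched_def enr_cat.simps
    by (rule is_functor_fcomp[OF groupoid_prod_gpd[OF groupoid_Pi1[OF h(1)] groupoid_Pi1[OF h(2)]]
          is_functor_Pi1_mu[OF h(1,2)]
          is_functor_Pi1_map[OF is_graph_box[OF h(1,2)] h(3) graph_hom_hom_comp[OF X]]])
qed

lemma fob_Pi1_mu [simp]: "x \<in> verts X \<Longrightarrow> y \<in> verts Y \<Longrightarrow> fob (Pi1_mu X Y) (x, y) = (x, y)"
  by (simp add: Pi1_mu_def)

lemma fob_ecomp_Graph [simp]:
  "g \<in> graph_maps Y Z \<Longrightarrow> f \<in> graph_maps X Y \<Longrightarrow>
    fob (ecomp Graph_enriched X Y Z) (g, f) = compose (verts X) g f"
  by (simp add: Graph_enriched_def fob_fcomp hom_comp_def)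

text \<open>The image of \<open>path_mu p q\<close> under \<open>hom_comp\<close>, written without
  the restriction to its domain.\<close>

definition path_hcomp :: "'u graph \<Rightarrow> ('v \<Rightarrow> 'w) path \<Rightarrow> ('u \<Rightarrow> 'v) path \<Rightarrow> ('u \<Rightarrow> 'w) path" where
  "path_hcomp X p q = path_concat (path_map (\<lambda>g. compose (verts X) g (psrc q)) p)
     (path_map (\<lambda>f. compose (verts X) (ptgt p) f) q)"

lemma path_map_path_mu:
  "path_map h (path_mu p q) =
    path_concat (path_map (\<lambda>x. h (x, psrc q)) p) (path_map (\<lambda>y. h (ptgt p, y)) q)"
  by (simp add: path_mu_def path_map_concat path_map_path_map)

lemma path_hcomp_eq:
  assumes p: "p \<in> paths (ihom Y Z)" and q: "q \<in> paths (ihom X Y)"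
  shows "path_map (hom_comp X Y Z) (path_mu p q) = path_hcomp X p q"
  unfolding path_map_path_mu path_hcomp_def
  using endpoints_in_verts(2)[OF p] endpoints_in_verts(1)[OF q]
  by (intro arg_cong2[where f = path_concat] path_map_cong[OF p] path_map_cong[OF q])
    (simp_all add: hom_comp_def)

lemma path_hcomp_in_paths:
  assumes "is_graph X" "is_graph Y" "is_graph Z" "p \<in> paths (ihom Y Z)" "q \<in> paths (ihom X Y)"
  shows "path_hcomp X p q \<in> paths (ihom X Z)"
  using path_map_in_paths[OF is_graph_box is_graph_ihom graph_hom_hom_comp path_mu_in_paths]
    path_hcomp_eq assms is_graph_ihom by metis

lemma far_ecomp_Graph:
  assumes X: "is_graph X" and Y: "is_graph Y" and Z: "is_graph Z"
    and p: "p \<in> paths (ihom Y Z)" and q: "q \<in> paths (ihom X Y)"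
  shows "far (ecomp Graph_enriched X Y Z) (parr (ihom Y Z) p, parr (ihom X Y) q) =
    parr (ihom X Z) (path_hcomp X p q)"
proof -
  note h = is_graph_ihom[OF Z, of Y] is_graph_ihom[OF Y, of X] is_graph_ihom[OF Z, of X]
  show ?thesis
    using p q
    by (simp add: Graph_enriched_def far_fcomp garr_Pi1 far_Pi1_mu[OF h(1,2) p q] path_hcomp_eq[OF p q]
        far_Pi1_map[OF is_graph_box[OF h(1,2)] h(3) graph_hom_hom_comp[OF X] path_mu_in_paths[OF h(1,2) p q]])
qed

lemma fob_eunit_Graph: "fob (eunit Graph_enriched X) u = graph_id X"
  by (simp add: Graph_enriched_def fob_fcomp Pi1_unit_def hom_unit_def path_graph_def Pi1_map_def)

lemma far_eunit_Graph:
  assumes X: "is_graph X"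
  shows "far (eunit Graph_enriched X) u = parr (ihom X X) (path_const (graph_id X))"
proof -
  have v: "0 \<in> verts (path_graph 0)" by (simp add: path_graph_def)
  show ?thesis
    using far_Pi1_map[OF is_graph_path_graph is_graph_ihom[OF X] graph_hom_hom_unit[OF X]
        path_const_in_paths[OF is_graph_path_graph v]] v
    by (simp add: Graph_enriched_def far_fcomp Pi1_unit_def path_map_const hom_unit_def)
qed

lemma path_hcomp_simps:
  "psrc (path_hcomp X p q) = compose (verts X) (psrc p) (psrc q)"
  "ptgt (path_hcomp X p q) = compose (verts X) (ptgt p) (ptgt q)"
  using ptgt_path_concat[of "path_map (\<lambda>g. compose (verts X) g (psrc q)) p"
      "path_map (\<lambda>f. compose (verts X) (ptgt p) f) q"]
  by (simp_all add: path_hcomp_def)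

text \<open>Both sides concatenate whiskered copies of \<open>p\<close>, \<open>q\<close> and
  \<open>r\<close> in this order. The whiskerings agree by associativity of composing maps, the
  bracketings by associativity of concatenation.\<close>

lemma path_hcomp_assoc:
  assumes p: "p \<in> paths (ihom Y Z)" and q: "q \<in> paths (ihom X Y)" and r: "r \<in> paths (ihom W X)"
  shows "path_hcomp W (path_hcomp X p q) r = path_hcomp W p (path_hcomp W q r)"
proof -
  have r0: "psrc r \<in> graph_maps W X" using endpoints_in_verts(1)[OF r] by simp
  have 1: "path_map (\<lambda>g. compose (verts W) (compose (verts X) g (psrc q)) (psrc r)) p =
      path_map (\<lambda>g. compose (verts W) g (compose (verts W) (psrc q) (psrc r))) p"
    by (simp add: compose_assoc_graph_maps[OF r0])
  have 2: "path_map (\<lambda>f. compose (verts W) (compose (verts X) (ptgt p) f) (psrc r)) q =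
      path_map (\<lambda>f. compose (verts W) (ptgt p) (compose (verts W) f (psrc r))) q"
    by (simp add: compose_assoc_graph_maps[OF r0])
  \<comment> \<open>The innermost map is now the running vertex of \<open>r\<close> and no longer
    the fixed map \<open>psrc r\<close>, so the two functions agree only on vertices and
    \<open>path_map_cong\<close> is required.\<close>
  have 3: "path_map (\<lambda>e. compose (verts W) (compose (verts X) (ptgt p) (ptgt q)) e) r =
      path_map (\<lambda>e. compose (verts W) (ptgt p) (compose (verts W) (ptgt q) e)) r"
    by (rule path_map_cong[OF r]) (simp add: compose_assoc_graph_maps)
  show ?thesis
    unfolding path_hcomp_def[of W "path_hcomp X p q" r] path_hcomp_def[of W p "path_hcomp W q r"]
      path_hcomp_simps
    unfolding path_hcomp_def path_map_concat path_map_path_map 1 2 3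
    by (rule path_concat_assoc) simp
qed

text \<open>Whiskering a constant path leaves a path of length 0, which concatenation absorbs, and
  whiskering \<open>q\<close> with an identity map does not change it.\<close>

lemma path_hcomp_unit:
  assumes q: "q \<in> paths (ihom X Y)"
  shows "path_hcomp X (path_const (graph_id Y)) q = q" "path_hcomp X q (path_const (graph_id X)) = q"
proof -
  have "path_map (\<lambda>f. compose (verts X) (graph_id Y) f) q = q"
    by (rule path_map_ident[OF q]) (simp add: compose_graph_id)
  moreover have "compose (verts X) (graph_id Y) (psrc q) = psrc q"
    using endpoints_in_verts(1)[OF q] by (simp add: compose_graph_id)
  ultimately show "path_hcomp X (path_const (graph_id Y)) q = q"
    using path_concat_const_left[OF q] by (simp add: path_hcomp_def path_map_const)
  have "path_map (\<lambda>g. compose (verts X) g (graph_id X)) q = q"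
    by (rule path_map_ident[OF q]) (simp add: compose_graph_id)
  then show "path_hcomp X q (path_const (graph_id X)) = q"
    using path_concat_const_right[OF q] by (simp add: path_hcomp_def path_map_const)
qed

lemma is_category_Graph_cat: "is_category Graph_cat"
  by (simp add: is_category_def Graph_cat_def graph_id_in compose_in_graph_maps compose_graph_id
      compose_assoc_graph_maps)

lemma gpd_enriched_category_Graph:
  "gpd_enriched_category (Graph_enriched :: ('v graph, _, _) enr_cat)"
  unfolding gpd_enriched_category_def Graph_enriched_simps mem_Collect_eq Let_def
proof (intro conjI ballI; (unfold mem_Collect_eq)?)
  fix X Y :: "'v graph" assume X: "is_graph X" and Y: "is_graph Y"
  show "groupoid (Pi1 (ihom X Y))" by (rule groupoid_Pi1[OF is_graph_ihom[OF Y]])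
  let ?A = "Pi1 (ihom X Y)"
  note snd = snd_functor_def[of unit_gpd ?A, folded prod_gpd_simps(1,2)]
    and fst = fst_functor_def[of ?A unit_gpd, folded prod_gpd_simps(1,2)]
  have c: "path_const (graph_id X) \<in> paths (ihom X X)" "path_const (graph_id Y) \<in> paths (ihom Y Y)"
    using X Y by (auto intro!: path_const_in_paths is_graph_ihom simp: graph_id_in)
  show "fcomp (prod_gpd unit_gpd ?A) (ecomp Graph_enriched X Y Y)
      (prod_functor unit_gpd ?A (eunit Graph_enriched Y) (id_functor ?A)) = snd_functor unit_gpd ?A"
    unfolding snd using c X Y
    by (intro fcomp_eq_restrictI)
      (auto simp: fob_eunit_Graph far_eunit_Graph graph_id_in compose_graph_id garr_Pi1
        far_ecomp_Graph path_hcomp_unit)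
  show "fcomp (prod_gpd ?A unit_gpd) (ecomp Graph_enriched X X Y)
      (prod_functor ?A unit_gpd (id_functor ?A) (eunit Graph_enriched X)) = fst_functor ?A unit_gpd"
    unfolding fst using c X Y
    by (intro fcomp_eq_restrictI)
      (auto simp: fob_eunit_Graph far_eunit_Graph graph_id_in compose_graph_id garr_Pi1
        far_ecomp_Graph path_hcomp_unit)
next
  show "is_functor (prod_gpd (Pi1 (ihom Y Z)) (Pi1 (ihom X Y))) (Pi1 (ihom X Z))
      (ecomp Graph_enriched X Y Z)"
    if "is_graph X" "is_graph Y" "is_graph Z" for X Y Z :: "'v graph"
    using that by (rule is_functor_ecomp_Graph)
next
  show "is_functor unit_gpd (Pi1 (ihom X X)) (eunit Graph_enriched X)"
    if X: "is_graph X" for X :: "'v graph"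
    by (rule is_functor_unit_gpdI[of _ "graph_id X"])
      (simp_all add: groupoid_Pi1 is_graph_ihom X graph_id_in fob_eunit_Graph far_eunit_Graph)
next
  fix W X Y Z :: "'v graph"
  assume g: "is_graph W" "is_graph X" "is_graph Y" "is_graph Z"
  let ?A = "Pi1 (ihom Y Z)" and ?B = "Pi1 (ihom X Y)" and ?D = "Pi1 (ihom W X)"
  let ?P = "prod_gpd (prod_gpd ?A ?B) ?D"
  show "fcomp ?P (ecomp Graph_enriched W X Z)
        (prod_functor (prod_gpd ?A ?B) ?D (ecomp Graph_enriched X Y Z) (id_functor ?D)) =
      fcomp ?P (ecomp Graph_enriched W Y Z)
        (fcomp ?P (prod_functor ?A (prod_gpd ?B ?D) (id_functor ?A) (ecomp Graph_enriched W X Y))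
          (assoc_functor ?A ?B ?D))"
    using compose_in_graph_maps[OF g(2), of _ Y Z] compose_in_graph_maps[OF g(1), of _ X Y]
      path_hcomp_in_paths[OF g(2-4)] path_hcomp_in_paths[OF g(1-3)]
    by (intro fcomp_eqI)
      (auto simp: fob_fcomp far_fcomp compose_assoc_graph_maps garr_Pi1 far_ecomp_Graph g
        path_hcomp_assoc)
qed


section \<open>The enriched functor\<close>

definition Pi1_eval ::
  "'v graph \<Rightarrow> 'w graph \<Rightarrow>
    (('v \<Rightarrow> 'w) \<times> 'v, ('v \<Rightarrow> 'w) pi1_arr \<times> 'v pi1_arr, 'w, 'w pi1_arr) gfun" where
  "Pi1_eval X Y = fcomp (prod_gpd (Pi1 (ihom X Y)) (Pi1 X))
     (Pi1_map (box (ihom X Y) X) Y (hom_eval X Y)) (Pi1_mu (ihom X Y) X)"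

lemma is_functor_Pi1_eval:
  assumes X: "is_graph X" and Y: "is_graph Y"
  shows "is_functor (prod_gpd (Pi1 (ihom X Y)) (Pi1 X)) (Pi1 Y) (Pi1_eval X Y)"
proof -
  note h = is_graph_ihom[OF Y, of X]
  show ?thesis
    unfolding Pi1_eval_def
    by (rule is_functor_fcomp[OF groupoid_prod_gpd[OF groupoid_Pi1[OF h] groupoid_Pi1[OF X]]
          is_functor_Pi1_mu[OF h X]
          is_functor_Pi1_map[OF is_graph_box[OF h X] Y graph_hom_hom_eval[OF X]]])
qed

lemma fob_Pi1_eval [simp]:
  "f \<in> graph_maps X Y \<Longrightarrow> x \<in> verts X \<Longrightarrow> fob (Pi1_eval X Y) (f, x) = f x"
  by (simp add: Pi1_eval_def fob_fcomp hom_eval_def)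

lemma far_Pi1_eval:
  assumes X: "is_graph X" and Y: "is_graph Y" and p: "p \<in> paths (ihom X Y)" and q: "q \<in> paths X"
  shows "far (Pi1_eval X Y) (parr (ihom X Y) p, parr X q) =
    parr Y (path_concat (path_map (\<lambda>f. f (psrc q)) p) (path_map (ptgt p) q))"
proof -
  note h = is_graph_ihom[OF Y, of X]
  have "path_map (hom_eval X Y) (path_mu p q) =
      path_concat (path_map (\<lambda>f. f (psrc q)) p) (path_map (ptgt p) q)"
    unfolding path_map_path_mu
    using endpoints_in_verts(2)[OF p] endpoints_in_verts(1)[OF q]
    by (intro arg_cong2[where f = path_concat] path_map_cong[OF p] path_map_cong[OF q])
      (simp_all add: hom_eval_def)
  then show ?thesis
    using p q
    by (simp add: Pi1_eval_def far_fcomp garr_Pi1 far_Pi1_mu[OF h X p q]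
        far_Pi1_map[OF is_graph_box[OF h X] Y graph_hom_hom_eval[OF X] path_mu_in_paths[OF h X p q]])
qed

lemma efhom_Pi1_enriched:
  "efhom Pi1_enriched X Y = curry_functor (Pi1 (ihom X Y)) (Pi1 X) (Pi1_eval X Y)"
  by (simp add: Pi1_enriched_def Pi1_eval_def)

text \<open>The left-hand record is the value at \<open>f\<close> of the curried evaluation. The
  identity arrow at \<open>f\<close> is represented by a path of length 0, so only the image of the
  second path survives.\<close>

lemma Pi1_eval_left:
  assumes X: "is_graph X" and Y: "is_graph Y" and f: "f \<in> graph_maps X Y"
  shows "\<lparr>fob = (\<lambda>x\<in>gobj (Pi1 X). fob (Pi1_eval X Y) (f, x)),
      far = (\<lambda>b\<in>garr (Pi1 X). far (Pi1_eval X Y) (gid (Pi1 (ihom X Y)) f, b))\<rparr> = Pi1_map X Y f"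
proof (rule gfun_eqI; simp)
  show "(\<lambda>x\<in>verts X. fob (Pi1_eval X Y) (f, x)) = fob (Pi1_map X Y f)"
    using f by (auto simp: Pi1_map_def)
  note hom = graph_maps_imp_hom[OF f]
  have c: "path_const f \<in> paths (ihom X Y)"
    using f by (simp add: path_const_in_paths is_graph_ihom Y)
  have "far (Pi1_eval X Y) (gid (Pi1 (ihom X Y)) f, b) = far (Pi1_map X Y f) b"
    if "b \<in> garr (Pi1 X)" for b
  proof -
    obtain q where q: "q \<in> paths X" "b = parr X q" using \<open>b \<in> garr (Pi1 X)\<close> by (auto simp: garr_Pi1)
    show ?thesis
      using q f path_concat_const_left[OF path_map_in_paths[OF X Y hom q(1)]]
      by (simp add: far_Pi1_eval[OF X Y c] far_Pi1_map[OF X Y hom] path_map_const)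
  qed
  then show "(\<lambda>b\<in>garr (Pi1 X). far (Pi1_eval X Y) (gid (Pi1 (ihom X Y)) f, b)) =
      far (Pi1_map X Y f)"
    using functor_far_ext[OF is_functor_Pi1_map[OF X Y hom]] by (auto simp: extensional_def)
qed

lemma fob_efhom:
  assumes "is_graph X" "is_graph Y" "f \<in> graph_maps X Y"
  shows "fob (efhom Pi1_enriched X Y) f = Pi1_map X Y f"
  using Pi1_eval_left[OF assms] assms(3) by (simp add: efhom_Pi1_enriched curry_functor_def Let_def)

text \<open>Pairing \<open>p\<close> with the identity at \<open>x\<close> contributes a constant
  path at the end, which disappears; what remains is the trace of \<open>x\<close> along
  \<open>p\<close>.\<close>

lemma far_efhom:
  assumes X: "is_graph X" and Y: "is_graph Y" and p: "p \<in> paths (ihom X Y)"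
  shows "far (efhom Pi1_enriched X Y) (parr (ihom X Y) p) =
    (Pi1_map X Y (psrc p), Pi1_map X Y (ptgt p), \<lambda>x\<in>verts X. parr Y (path_map (\<lambda>f. f x) p))"
proof -
  have e: "psrc p \<in> graph_maps X Y" "ptgt p \<in> graph_maps X Y"
    using endpoints_in_verts[OF p] by auto
  have "far (Pi1_eval X Y) (parr (ihom X Y) p, gid (Pi1 X) x) = parr Y (path_map (\<lambda>f. f x) p)"
    if x: "x \<in> verts X" for x
  proof -
    have "path_map (\<lambda>f. f x) p \<in> paths Y"
      by (rule path_map_in_paths[OF is_graph_ihom[OF Y] Y graph_hom_ihom_eval_at[OF x] p])
    then show ?thesis
      using x path_const_in_paths[OF X x] path_concat_const_right[of "path_map (\<lambda>f. f x) p" Y]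
      by (simp add: far_Pi1_eval[OF X Y p] path_map_const)
  qed
  then show ?thesis
    using p e Pi1_eval_left[OF X Y e(1)] Pi1_eval_left[OF X Y e(2)]
    by (simp add: efhom_Pi1_enriched curry_functor_def Let_def garr_Pi1 cong: restrict_cong)
qed

lemma is_functor_efhom:
  assumes X: "is_graph X" and Y: "is_graph Y"
  shows "is_functor (Pi1 (ihom X Y)) (fun_gpd (Pi1 X) (Pi1 Y)) (efhom Pi1_enriched X Y)"
  unfolding efhom_Pi1_enriched
  by (rule is_functor_curry[OF groupoid_Pi1[OF is_graph_ihom[OF Y]] groupoid_Pi1[OF X]
        groupoid_Pi1[OF Y] is_functor_Pi1_eval[OF X Y]])

text \<open>\<open>path_hcomp\<close> traverses \<open>p\<close> before \<open>q\<close>, whereas \<open>hcomp\<close> traverses them in the opposite order: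
  naturality of the transformation given by \<open>p\<close> exchanges the two.\<close>

lemma far_efhom_hcomp:
  assumes X: "is_graph X" and Y: "is_graph Y" and Z: "is_graph Z"
    and p: "p \<in> paths (ihom Y Z)" and q: "q \<in> paths (ihom X Y)"
  shows "far (efhom Pi1_enriched X Z) (parr (ihom X Z) (path_hcomp X p q)) =
    hcomp (Pi1 X) (Pi1 Z) (far (efhom Pi1_enriched Y Z) (parr (ihom Y Z) p))
      (far (efhom Pi1_enriched X Y) (parr (ihom X Y) q))"
proof -
  have e: "psrc p \<in> graph_maps Y Z" "ptgt p \<in> graph_maps Y Z"
    "psrc q \<in> graph_maps X Y" "ptgt q \<in> graph_maps X Y"
    using endpoints_in_verts[OF p] endpoints_in_verts[OF q] by auto
  \<comment> \<open>Naturality of this family is read off from \<open>efhom\<close> being a functor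
    into \<open>fun_gpd\<close>; the homotopy behind it is the interchange law inside
    \<open>Pi1_mu\<close>.\<close>
  have b: "(Pi1_map Y Z (psrc p), Pi1_map Y Z (ptgt p), \<lambda>y\<in>verts Y. parr Z (path_map (\<lambda>g. g y) p))
      \<in> nat_transs (Pi1 Y) (Pi1 Z)"
    using functor_far[OF is_functor_efhom[OF Y Z], of "parr (ihom Y Z) p"] p
    by (simp add: far_efhom[OF Y Z p] garr_Pi1)
  have "parr Z (path_map (\<lambda>f. f x) (path_hcomp X p q)) =
      gcomp (Pi1 Z) (parr Z (path_map (\<lambda>g. g (ptgt q x)) p))
        (far (Pi1_map Y Z (psrc p)) (parr Y (path_map (\<lambda>f. f x) q)))"
    if x: "x \<in> verts X" for x
  proof -
    let ?q = "path_map (\<lambda>f. f x) q" and ?p = "\<lambda>y. path_map (\<lambda>g. g y) p"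
    have q': "?q \<in> paths Y"
      by (rule path_map_in_paths[OF is_graph_ihom[OF Y] Y graph_hom_ihom_eval_at[OF x] q])
    have v: "psrc q x \<in> verts Y" "ptgt q x \<in> verts Y" using graph_maps_verts x e by metis+
    have p': "?p (psrc q x) \<in> paths Z"
      by (rule path_map_in_paths[OF is_graph_ihom[OF Z] Z graph_hom_ihom_eval_at[OF v(1)] p])
    note hom = graph_maps_imp_hom[OF e(2)]
    have "gcomp (Pi1 Z) ((\<lambda>y\<in>verts Y. parr Z (?p y)) (ptgt q x))
          (far (Pi1_map Y Z (psrc p)) (parr Y ?q)) =
        gcomp (Pi1 Z) (far (Pi1_map Y Z (ptgt p)) (parr Y ?q))
          ((\<lambda>y\<in>verts Y. parr Z (?p y)) (psrc q x))"
      by (rule nat_trans_natural[OF b]) (use q' in \<open>simp_all add: garr_Pi1\<close>)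
    also have "\<dots> = parr Z (path_concat (?p (psrc q x)) (path_map (ptgt p) ?q))"
      using v q' p' path_map_in_paths[OF Y Z hom q']
      by (simp add: far_Pi1_map[OF Y Z hom q'] gcomp_parr[OF Z])
    also have "path_concat (?p (psrc q x)) (path_map (ptgt p) ?q) =
        path_map (\<lambda>f. f x) (path_hcomp X p q)"
      by (simp add: path_hcomp_def path_map_concat path_map_path_map compose_eq x)
    finally show ?thesis using v by simp
  qed
  then show ?thesis
    using e
    by (simp add: far_efhom[OF X Z path_hcomp_in_paths[OF X Y Z p q]] far_efhom[OF Y Z p]
        far_efhom[OF X Y q] hcomp_def path_hcomp_simps Pi1_map_compose[OF X Y Z]
        graph_maps_verts cong: restrict_cong)
qed

lemma gpd_enriched_functor_Pi1:
  "gpd_enriched_functor (Graph_enriched :: ('v graph, _, _) enr_cat) Gpd_self Pi1_enriched"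
proof -
  have efob: "efob Pi1_enriched = (Pi1 :: 'v graph \<Rightarrow> _)" by (simp add: Pi1_enriched_def)
  show ?thesis
    unfolding gpd_enriched_functor_def Graph_enriched_simps Gpd_self_simps mem_Collect_eq Let_def efob
  proof (intro conjI ballI; (unfold mem_Collect_eq)?)
    show "gpd_enriched_category (Graph_enriched :: ('v graph, _, _) enr_cat)"
      by (rule gpd_enriched_category_Graph)
    show "gpd_enriched_category (Gpd_self :: (('v, 'v pi1_arr) gpd, _, _) enr_cat)"
      by (rule gpd_enriched_category_Gpd_self)
  next
    fix X :: "'v graph" assume X: "is_graph X"
    show "groupoid (Pi1 X)" by (rule groupoid_Pi1[OF X])
    \<comment> \<open>On arrows the unit law says that \<open>efhom\<close> preserves the identity
      at \<open>graph_id X\<close>, the arrow that \<open>eunit\<close> selects. Both identities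
      stay folded as \<open>gid\<close> so that \<open>functor_gid\<close> applies.\<close>
    have "far (efhom Pi1_enriched X X) (gid (Pi1 (ihom X X)) (graph_id X)) =
        gid (fun_gpd (Pi1 X) (Pi1 X)) (id_functor (Pi1 X))"
      using functor_gid[OF is_functor_efhom[OF X X], of "graph_id X"] graph_id_in[OF X]
      by (simp add: fob_efhom[OF X X] Pi1_map_id[OF X] del: gid_Pi1 fun_gpd_simps(5))
    then show "fcomp unit_gpd (efhom Pi1_enriched X X) (eunit Graph_enriched X) = eunit Gpd_self (Pi1 X)"
      using graph_id_in[OF X]
      by (intro gfun_eqI ext)
        (simp_all add: fob_fcomp far_fcomp fob_eunit_Graph far_eunit_Graph[OF X] fob_efhom[OF X X]
          Pi1_map_id[OF X])
  next
    show "is_functor (Pi1 (ihom X Y)) (fun_gpd (Pi1 X) (Pi1 Y)) (efhom Pi1_enriched X Y)"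
      if "is_graph X" "is_graph Y" for X Y :: "'v graph"
      using that by (rule is_functor_efhom)
  next
    fix X Y Z :: "'v graph" assume X: "is_graph X" and Y: "is_graph Y" and Z: "is_graph Z"
    let ?A = "Pi1 (ihom Y Z)" and ?B = "Pi1 (ihom X Y)"
    have hom: "is_functor (Pi1 Y) (Pi1 Z) (Pi1_map Y Z g)" "is_functor (Pi1 X) (Pi1 Y) (Pi1_map X Y f)"
      if "g \<in> graph_maps Y Z" "f \<in> graph_maps X Y" for g f
      using that by (auto intro!: is_functor_Pi1_map X Y Z graph_maps_imp_hom)
    have far: "far (efhom Pi1_enriched Y Z) (parr (ihom Y Z) p) \<in> nat_transs (Pi1 Y) (Pi1 Z)"
      "far (efhom Pi1_enriched X Y) (parr (ihom X Y) q) \<in> nat_transs (Pi1 X) (Pi1 Y)"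
      if "p \<in> paths (ihom Y Z)" "q \<in> paths (ihom X Y)" for p q
      using functor_far[OF is_functor_efhom[OF Y Z]] functor_far[OF is_functor_efhom[OF X Y]] that
      by (auto simp: garr_Pi1)
    show "fcomp (prod_gpd ?A ?B) (efhom Pi1_enriched X Z) (ecomp Graph_enriched X Y Z) =
        fcomp (prod_gpd ?A ?B) (ecomp Gpd_self (Pi1 X) (Pi1 Y) (Pi1 Z))
          (prod_functor ?A ?B (efhom Pi1_enriched Y Z) (efhom Pi1_enriched X Y))"
    proof (rule fcomp_eqI)
      fix z assume "z \<in> gobj (prod_gpd ?A ?B)"
      then obtain g f where gf: "z = (g, f)" "g \<in> graph_maps Y Z" "f \<in> graph_maps X Y" by auto
      then show "fob (efhom Pi1_enriched X Z) (fob (ecomp Graph_enriched X Y Z) z) =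
          fob (ecomp Gpd_self (Pi1 X) (Pi1 Y) (Pi1 Z))
            (fob (prod_functor ?A ?B (efhom Pi1_enriched Y Z) (efhom Pi1_enriched X Y)) z)"
        using hom[OF gf(2,3)] compose_in_graph_maps[OF X gf(2,3)]
        by (simp add: fob_efhom X Y Z Pi1_map_compose[OF X Y Z])
    next
      fix a assume "a \<in> garr (prod_gpd ?A ?B)"
      then obtain p q where pq: "a = (parr (ihom Y Z) p, parr (ihom X Y) q)"
        "p \<in> paths (ihom Y Z)" "q \<in> paths (ihom X Y)"
        by (auto simp: garr_Pi1)
      then show "far (efhom Pi1_enriched X Z) (far (ecomp Graph_enriched X Y Z) a) =
          far (ecomp Gpd_self (Pi1 X) (Pi1 Y) (Pi1 Z))
            (far (prod_functor ?A ?B (efhom Pi1_enriched Y Z) (efhom Pi1_enriched X Y)) a)"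
        using far[OF pq(2,3)]
        by (simp add: garr_Pi1 far_ecomp_Graph[OF X Y Z] far_efhom_hcomp[OF X Y Z])
    qed
  qed
qed

theorem theorem3p11:
  "is_enrichment_of (Graph_enriched :: ('v graph, 'v \<Rightarrow> 'v, ('v \<Rightarrow> 'v) pi1_arr) enr_cat) Graph_cat
   \<and> (\<forall>X Y :: 'v graph. is_graph X \<and> is_graph Y \<longrightarrow> ehom Graph_enriched X Y = Pi1 (ihom X Y))
   \<and> gpd_enriched_functor
       (Graph_enriched :: ('v graph, 'v \<Rightarrow> 'v, ('v \<Rightarrow> 'v) pi1_arr) enr_cat) Gpd_self Pi1_enriched
   \<and> (\<forall>X :: 'v graph. is_graph X \<longrightarrow> efob Pi1_enriched X = Pi1 X)
   \<and> (\<forall>(X :: 'v graph) Y. is_graph X \<and> is_graph Y \<longrightarrow>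
        (\<forall>f\<in>graph_maps X Y. fob (efhom Pi1_enriched X Y) f = Pi1_map X Y f))"
proof (intro conjI)
  show "is_enrichment_of (Graph_enriched :: ('v graph, 'v \<Rightarrow> 'v, ('v \<Rightarrow> 'v) pi1_arr) enr_cat) Graph_cat"
    unfolding is_enrichment_of_def
    using is_category_Graph_cat gpd_enriched_category_Graph
    by (simp add: fob_eunit_Graph) (simp add: Graph_cat_def)
qed (auto simp: gpd_enriched_functor_Pi1 fob_efhom, simp add: Pi1_enriched_def)

end
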